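(* Let $L>0$ and $k\in\mathbb{N}$. Then, uniformly for $z$ in the closed disc $\{|z|\le 1+L/\sqrt{N}\}$, $$\mathbb{E}\big(|\det(G_N-z)|^{2k}\big)=e^{Nk(|z|^2-1)+\frac{k^2}{2}\log N}\,\frac{(2\pi)^{k/2}}{G(1+k)}\,F_k\big(\sqrt{N}(1-|z|^2)\big)\,(1+o(1)),\qquad N\to\infty,$$ where $F_k(x)=\mathbb{P}(\lambda^{(\mathrm{GUE}_k)}_{\max}<x)$.
   Context: $G_N=N^{-1/2}G$ where $G$ is an $N\times N$ matrix of i.i.d. standard complex Gaussian entries (density $\pi^{-1}e^{-|w|^2}$). $G$ denotes the Barnes $G$-function (so $G(1+k)=\prod_{j=0}^{k-1}j!$). A $k\times k$ GUE matrix $H$ is a Hermitian random matrix with density proportional to $e^{-\mathrm{Tr}(H^2)/2}$ with respect to Lebesgue measure on its independent real entries; $\lambda^{(\mathrm{GUE}_k)}_{\max}$ is its largest eigenvalue. *)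

theory Defs
  imports "HOL-Probability.Probability"
begin

text \<open>Square matrices of variable size n are represented as functions
  nat \<times> nat \<Rightarrow> complex, only the entries (i,j) with i,j < n being relevant.\<close>

definition cdet :: "nat \<Rightarrow> (nat \<times> nat \<Rightarrow> complex) \<Rightarrow> complex" where
  "cdet n A = (\<Sum>p\<in>{p. p permutes {..<n}}. of_int (sign p) * (\<Prod>i<n. A (i, p i)))"

definition std_cgauss :: "complex measure" where
  "std_cgauss = density lborel (\<lambda>w. ennreal (exp (- ((cmod w)^2)) / pi))"

definition ginibre :: "nat \<Rightarrow> (nat \<times> nat \<Rightarrow> complex) measure" where
  "ginibre N = PiM ({..<N} \<times> {..<N}) (\<lambda>_. std_cgauss)"

definition ginibre_moment :: "nat \<Rightarrow> nat \<Rightarrow> complex \<Rightarrow> real" where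
  "ginibre_moment N k z = (\<integral>G. (cmod (cdet N (\<lambda>(i,j). G (i,j) / of_real (sqrt (real N))
        - (if i = j then z else 0)))) ^ (2*k) \<partial>ginibre N)"

text \<open>Hermitian k \<times> k matrix built from its k^2 independent real entries:
  x(i,i) diagonal, x(i,j) real part and x(j,i) imaginary part of H(i,j) for i<j.\<close>
definition herm_of :: "(nat \<times> nat \<Rightarrow> real) \<Rightarrow> nat \<times> nat \<Rightarrow> complex" where
  "herm_of x = (\<lambda>(i,j). if i = j then complex_of_real (x (i,i))
      else if i < j then Complex (x (i,j)) (x (j,i))
      else Complex (x (j,i)) (- x (i,j)))"

definition mtrace_sq :: "nat \<Rightarrow> (nat \<times> nat \<Rightarrow> complex) \<Rightarrow> real" where
  "mtrace_sq k H = Re (\<Sum>i<k. \<Sum>j<k. H (i,j) * H (j,i))"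

definition gue_unnorm :: "nat \<Rightarrow> (nat \<times> nat \<Rightarrow> real) measure" where
  "gue_unnorm k = density (PiM ({..<k} \<times> {..<k}) (\<lambda>_. lborel))
      (\<lambda>x. ennreal (exp (- mtrace_sq k (herm_of x) / 2)))"

definition gue :: "nat \<Rightarrow> (nat \<times> nat \<Rightarrow> real) measure" where
  "gue k = density (gue_unnorm k)
      (\<lambda>_. ennreal (1 / enn2real (emeasure (gue_unnorm k) (space (gue_unnorm k)))))"

definition lambda_max :: "nat \<Rightarrow> (nat \<times> nat \<Rightarrow> complex) \<Rightarrow> real" where
  "lambda_max k H = Max {t::real. cdet k (\<lambda>(i,j). (if i = j then of_real t else 0) - H (i,j)) = 0}"

definition F_gue :: "nat \<Rightarrow> real \<Rightarrow> real" where
  "F_gue k x = measure (gue k) {y \<in> space (gue k). lambda_max k (herm_of y) < x}"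

definition barnesG1 :: "nat \<Rightarrow> real" where
  "barnesG1 k = (\<Prod>j<k. fact j)"

end

theory Submission
  imports Defs "HOL-Real_Asymp.Real_Asymp" "Jordan_Normal_Form.Determinant"
begin

text \<open>The moment is an integral over \<open>k \<times> k\<close> matrices: expanding \<open>\<bar>det (G - z)\<bar>\<^sup>2\<^sup>k\<close> with Wick's formula and regrouping
  the permutations gives \<open>E det (\<bar>z\<bar>\<^sup>2 + X X\<^sup>*)\<^sup>N\<close> for a \<open>k \<times> k\<close> Ginibre matrix \<open>X\<close>. The map \<open>X \<mapsto> X X\<^sup>*\<close> carries
  Lebesgue measure to a multiple of Lebesgue measure on the positive definite matrices \<open>P\<close> (by induction
  on \<open>k\<close>, splitting off a Schur complement on both sides), so the moment is a multiple of
  \<open>\<integral> det (N \<bar>z\<bar>\<^sup>2 + P)\<^sup>N exp (- tr P) dP\<close> over \<open>P > 0\<close>. Substituting \<open>P = N (1 - \<bar>z\<bar>\<^sup>2) - \<surd>N H\<close> turns the domain into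
  \<open>H < \<surd>N (1 - \<bar>z\<bar>\<^sup>2)\<close>, that is, into a condition on the largest eigenvalue of \<open>H\<close>, and the integrand into
  \<open>det (1 - H / \<surd>N)\<^sup>N exp (\<surd>N tr H)\<close>, which tends to \<open>exp (- tr H\<^sup>2 / 2)\<close> pointwise. Its total mass is an explicit
  product of factorials, so Stirling's formula and Scheffe's lemma give convergence in \<open>L\<^sup>1\<close>. This is
  uniform over all domains, and the limiting integral is bounded below for \<open>\<bar>z\<bar> \<le> 1 + L / \<surd>N\<close>.\<close>

subsection \<open>Hermitian matrices and Schur complements\<close>

text \<open>Positivity is encoded through pivots rather than eigenvalues: the last diagonal entry
  and the Schur complement decide whether a Hermitian matrix is positive definite. This recursion
  also yields the sign of determinants, openness, measurability, the change of variables and the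
  gamma integrals, so most inductions on \<open>k\<close> split off the last row and column. Only
  \<open>lambda_max\<close>, a largest characteristic root, has to be translated into this language.

  The duality rests on a common index set: the k-th power of an N by N determinant and the N-th
  power of a k by k determinant are both determinants over \<open>{..<N} \<times> {..<k}\<close>,
  and both are expanded in principal minors.

  The substitution is a saddle point. The weight det to the power N times
  \<open>exp (- tr P)\<close> is stationary where N |z|^2 + P equals N times the identity, and its
  width is of order sqrt N. After centring and scaling, \<open>z\<close> is left only in a scalar
  prefactor and in the domain. Near |z| = 1 the boundary of the cone lies within the width of the
  saddle, which is why a GUE probability survives in the limit.\<close>

lemma cdet_det: "cdet k A = det (mat k k A)"
  unfolding cdet_def det_def
  by (simp add: lessThan_atLeast0 sign_def permutes_in_image cong: prod.cong)
     (rule sum.cong; auto simp: permutes_in_image intro!: prod.cong)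

lemma cdet_cong:
  assumes "\<And>i j. i < k \<Longrightarrow> j < k \<Longrightarrow> A (i, j) = B (i, j)"
  shows "cdet k A = cdet k B"
  unfolding cdet_def
  by (intro sum.cong refl arg_cong2[of _ _ _ _ "(*)"] prod.cong assms)
     (use permutes_in_image in fastforce)+

lemma cdet_0 [simp]: "cdet 0 A = 1"
  by (simp add: cdet_def)

text \<open>The pivot is the last diagonal entry, so the complement of a matrix on indices up to
  \<open>k\<close> is again read on the indices below \<open>k\<close>.\<close>

definition schur :: "nat \<Rightarrow> (nat \<times> nat \<Rightarrow> complex) \<Rightarrow> nat \<times> nat \<Rightarrow> complex" where
  "schur k A = (\<lambda>(i, j). A (i, j) - A (i, k) * A (k, j) / A (k, k))"

text \<open>Block Gauss elimination: \<open>U\<close> is unit upper triangular, and \<open>D\<close>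
  is block lower triangular with the Schur complement and the pivot on its diagonal.\<close>

lemma cdet_schur:
  assumes "A (k, k) \<noteq> 0"
  shows "cdet (Suc k) A = A (k, k) * cdet k (schur k A)"
proof -
  define U where "U = four_block_mat (1\<^sub>m k) (mat k 1 (\<lambda>(i, j). A (i, k) / A (k, k))) (0\<^sub>m 1 k) (1\<^sub>m 1)"
  define D where "D = four_block_mat (mat k k (schur k A)) (0\<^sub>m k 1) (mat 1 k (\<lambda>(i, j). A (k, j))) (mat 1 1 (\<lambda>_. A (k, k)))"
  have "mat (Suc k) (Suc k) A = U * D"
    unfolding U_def D_def
    apply (subst mult_four_block_mat[of _ k k _ 1 _ 1 _ _ k _ 1])
            apply simp_all
    apply (rule eq_matI)
      apply (auto simp: schur_def four_block_mat_def scalar_prod_def assms less_Suc_eq row_def col_def)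
    done
  moreover have "det U = 1"
    unfolding U_def by (subst det_four_block_mat_lower_left_zero[of _ k _ 1]) auto
  moreover have "det D = det (mat k k (schur k A)) * A (k, k)"
    unfolding D_def by (subst det_four_block_mat_upper_right_zero[of _ k _ 1]) (auto simp: det_single)
  moreover have "det (U * D) = det U * det D"
    by (rule det_mult[of _ "k + 1"]) (auto simp: U_def D_def)
  ultimately show ?thesis
    by (simp add: cdet_det)
qed

lemma cdet_eq_0I:
  assumes "\<exists>i<k. v i \<noteq> 0" and "\<And>i. i < k \<Longrightarrow> (\<Sum>j<k. A (i, j) * v j) = 0"
  shows "cdet k A = 0"
proof -
  have "mat k k A *\<^sub>v vec k v = 0\<^sub>v k"
    using assms(2) by (intro eq_vecI) (auto simp: scalar_prod_def lessThan_atLeast0)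
  moreover have "vec k v \<noteq> 0\<^sub>v k"
    using assms(1) by (metis index_vec index_zero_vec(1))
  ultimately show ?thesis
    unfolding cdet_det by (subst det_0_iff_vec_prod_zero_field[of _ k]) (auto intro!: exI[of _ "vec k v"])
qed

definition qform :: "nat \<Rightarrow> (nat \<times> nat \<Rightarrow> complex) \<Rightarrow> (nat \<Rightarrow> complex) \<Rightarrow> complex" where
  "qform k A v = (\<Sum>i<k. \<Sum>j<k. cnj (v i) * A (i, j) * v j)"

text \<open>Taking the real part keeps this meaningful for every matrix; Hermitian symmetry is
  carried separately by \<open>hermitian\<close>. Only coordinates below \<open>k\<close> decide
  whether a vector counts as nonzero.\<close>

definition posdef :: "nat \<Rightarrow> (nat \<times> nat \<Rightarrow> complex) \<Rightarrow> bool" where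
  "posdef k A \<longleftrightarrow> (\<forall>v. (\<exists>i<k. v i \<noteq> 0) \<longrightarrow> 0 < Re (qform k A v))"

definition hermitian :: "nat \<Rightarrow> (nat \<times> nat \<Rightarrow> complex) \<Rightarrow> bool" where
  "hermitian k A \<longleftrightarrow> (\<forall>i<k. \<forall>j<k. A (j, i) = cnj (A (i, j)))"

lemma posdef_cong:
  assumes "\<And>i j. i < k \<Longrightarrow> j < k \<Longrightarrow> A (i, j) = B (i, j)"
  shows "posdef k A \<longleftrightarrow> posdef k B"
  using assms by (simp add: posdef_def qform_def)

lemma posdef_0 [simp]: "posdef 0 A"
  by (simp add: posdef_def)

lemma hermitianD: "hermitian k A \<Longrightarrow> i < k \<Longrightarrow> j < k \<Longrightarrow> cnj (A (i, j)) = A (j, i)"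
  by (metis hermitian_def)

lemma hermitian_diag_real: "hermitian k A \<Longrightarrow> i < k \<Longrightarrow> A (i, i) = of_real (Re (A (i, i)))"
  unfolding hermitian_def by (metis complex_cnj_cancel_iff Reals_cnj_iff of_real_Re)

lemma hermitian_schur: "hermitian (Suc k) A \<Longrightarrow> hermitian k (schur k A)"
  unfolding hermitian_def[of k] schur_def by (auto simp: hermitianD[of "Suc k" A])

text \<open>Completion of the square in the last coordinate.\<close>

lemma qform_Suc:
  assumes h: "hermitian (Suc k) A" and p: "A (k, k) = of_real p" "p \<noteq> 0"
  shows "qform (Suc k) A v =
    qform k (schur k A) v + of_real (p * (cmod (v k + (\<Sum>j<k. A (k, j) * v j) / of_real p))\<^sup>2)"
proof -
  define s where "s = (\<Sum>j<k. A (k, j) * v j)"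
  have cs: "cnj s = (\<Sum>i<k. cnj (v i) * A (i, k))"
    unfolding s_def cnj_sum using h
    by (intro sum.cong) (auto simp: hermitianD[OF h])
  have "qform (Suc k) A v = (\<Sum>i<k. \<Sum>j<k. cnj (v i) * A (i, j) * v j) + cnj s * v k + cnj (v k) * s + cnj (v k) * of_real p * v k"
    unfolding qform_def using p
    by (simp add: sum.distrib cs sum_distrib_right mult.assoc)
      (simp add: s_def sum_distrib_left sum_distrib_right mult.assoc)
  moreover have "qform k (schur k A) v = (\<Sum>i<k. \<Sum>j<k. cnj (v i) * A (i, j) * v j) - cnj s * s / of_real p"
  proof -
    have "qform k (schur k A) v = (\<Sum>i<k. \<Sum>j<k. cnj (v i) * A (i, j) * v j - (cnj (v i) * A (i, k)) * (A (k, j) * v j) / of_real p)"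
      unfolding qform_def schur_def using p by (intro sum.cong refl) (simp add: algebra_simps)
    also have "\<dots> = (\<Sum>i<k. \<Sum>j<k. cnj (v i) * A (i, j) * v j) - cnj s * s / of_real p"
      unfolding cs by (simp add: sum_subtractf s_def sum_product sum_divide_distrib)
    finally show ?thesis .
  qed
  moreover have "of_real (p * (cmod (v k + s / of_real p))\<^sup>2) =
      of_real p * (v k * cnj (v k)) + s * cnj (v k) + cnj s * v k + cnj s * s / of_real p"
    unfolding of_real_mult complex_norm_square using p(2) by (simp add: field_simps)
  ultimately show ?thesis
    unfolding s_def[symmetric] by (simp add: algebra_simps)
qed

text \<open>The recursion behind nearly every later argument about positivity. Both directions read
  off the completed square.\<close>

lemma posdef_Suc:
  assumes h: "hermitian (Suc k) A"
  shows "posdef (Suc k) A \<longleftrightarrow> 0 < Re (A (k, k)) \<and> posdef k (schur k A)"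
proof -
  define p where "p = Re (A (k, k))"
  have Ap: "A (k, k) = of_real p"
    unfolding p_def using hermitian_diag_real[OF h, of k] by simp
  show ?thesis
  proof (intro iffI conjI)
    assume pd: "posdef (Suc k) A"
    have "0 < Re (qform (Suc k) A (\<lambda>i. if i = k then 1 else 0))"
      using pd unfolding posdef_def by fastforce
    also have "qform (Suc k) A (\<lambda>i. if i = k then 1 else 0) = A (k, k)"
      by (simp add: qform_def)
    finally show p0: "0 < Re (A (k, k))" .
    show "posdef k (schur k A)"
      unfolding posdef_def
    proof (intro allI impI)
      fix v :: "nat \<Rightarrow> complex" assume v: "\<exists>i<k. v i \<noteq> 0"
      \<comment> \<open>The last coordinate is chosen to make the completed square vanish, so the
        form of \<open>A\<close> at \<open>w\<close> is the form of the Schur complement at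
        \<open>v\<close>.\<close>
      define w where "w = v(k := - (\<Sum>j<k. A (k, j) * v j) / of_real p)"
      have "\<exists>i<Suc k. w i \<noteq> 0" using v by (auto simp: w_def)
      hence "0 < Re (qform (Suc k) A w)" using pd unfolding posdef_def by blast
      also have "qform (Suc k) A w = qform k (schur k A) w"
        using p0 by (subst qform_Suc[OF h Ap]) (auto simp: w_def p_def)
      also have "\<dots> = qform k (schur k A) v"
        by (auto simp: qform_def w_def intro!: sum.cong)
      finally show "0 < Re (qform k (schur k A) v)" .
    qed
  next
    assume *: "0 < Re (A (k, k)) \<and> posdef k (schur k A)"
    hence p: "p > 0" by (simp add: p_def)
    show "posdef (Suc k) A"
      unfolding posdef_def
    proof (intro allI impI)
      fix v :: "nat \<Rightarrow> complex" assume v: "\<exists>i<Suc k. v i \<noteq> 0"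
      have q: "Re (qform (Suc k) A v) = Re (qform k (schur k A) v) +
          p * (cmod (v k + (\<Sum>j<k. A (k, j) * v j) / of_real p))\<^sup>2"
        using p by (subst qform_Suc[OF h Ap]) auto
      show "0 < Re (qform (Suc k) A v)"
      proof (cases "\<exists>i<k. v i \<noteq> 0")
        case True
        hence "0 < Re (qform k (schur k A) v)" using * by (auto simp: posdef_def)
        thus ?thesis unfolding q using p by (intro add_pos_nonneg) auto
      next
        case False
        hence "v k \<noteq> 0" using v less_Suc_eq by auto
        with False p show ?thesis unfolding q by (simp add: qform_def)
      qed
    qed
  qed
qed

text \<open>The determinant is the product of the successive pivots, each of them real and
  positive.\<close>

lemma cdet_posdef:
  "hermitian k A \<Longrightarrow> posdef k A \<Longrightarrow> cdet k A = of_real (Re (cdet k A)) \<and> 0 < Re (cdet k A)"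
proof (induction k arbitrary: A)
  case (Suc k)
  from Suc.prems have p: "0 < Re (A (k, k))" and pd: "posdef k (schur k A)"
    by (auto simp: posdef_Suc)
  have r: "A (k, k) = of_real (Re (A (k, k)))"
    using hermitian_diag_real[OF Suc.prems(1), of k] by simp
  have n0: "A (k, k) \<noteq> 0" using p by auto
  obtain d where d: "cdet k (schur k A) = of_real d" "d > 0"
    using Suc.IH[OF hermitian_schur[OF Suc.prems(1)] pd] by metis
  have "cdet (Suc k) A = of_real (Re (A (k, k)) * d)"
    using cdet_schur[of A k] n0 d r by simp
  thus ?case using d p by simp
qed simp

text \<open>Openness among Hermitian matrices, tested on sequences: pivots converge to a positive
  limit, so they are eventually positive, and the Schur complements converge entrywise.\<close>

lemma posdef_open:
  assumes "hermitian k A" "posdef k A" "\<And>n. hermitian k (B n)"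
    and "\<And>i j. i < k \<Longrightarrow> j < k \<Longrightarrow> (\<lambda>n. B n (i, j)) \<longlonglongrightarrow> A (i, j)"
  shows "\<forall>\<^sub>F n in sequentially. posdef k (B n)"
  using assms
proof (induction k arbitrary: A B)
  case (Suc k)
  from Suc.prems have p: "0 < Re (A (k, k))" and pd: "posdef k (schur k A)"
    by (auto simp: posdef_Suc)
  have n0: "A (k, k) \<noteq> 0" using p by auto
  have "\<forall>\<^sub>F n in sequentially. posdef k (schur k (B n))"
    by (rule Suc.IH[OF hermitian_schur[OF Suc.prems(1)] pd hermitian_schur[OF Suc.prems(3)]])
       (auto simp: schur_def n0 intro!: tendsto_intros Suc.prems(4))
  moreover have "\<forall>\<^sub>F n in sequentially. 0 < Re (B n (k, k))"
    using Suc.prems(4)[of k k] p by (intro order_tendstoD(1)[OF tendsto_Re]) auto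
  ultimately show ?case
    by eventually_elim (use Suc.prems(3) in \<open>simp add: posdef_Suc\<close>)
qed simp

subsection \<open>Positive definiteness and the largest eigenvalue\<close>

text \<open>First variation in the direction \<open>u = A v\<close>: the form along
  \<open>v + e u\<close> is a quadratic in \<open>e\<close> that starts at a value at most 0 with
  slope twice the squared norm of \<open>u\<close>, yet never becomes negative.\<close>

lemma psd_kernel:
  assumes h: "hermitian k A" and psd: "\<And>v. 0 \<le> Re (qform k A v)" and v0: "Re (qform k A v) \<le> 0"
    and i: "i < k"
  shows "(\<Sum>j<k. A (i, j) * v j) = 0"
proof -
  define u where "u i = (\<Sum>j<k. A (i, j) * v j)" for i
  define S where "S = (\<Sum>i<k. (cmod (u i))\<^sup>2)"
  define C where "C = Re (qform k A u)"
  have Cc: "C \<ge> 0" unfolding C_def by (rule psd)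
  have S0: "S \<ge> 0" unfolding S_def by (intro sum_nonneg) auto
  have uu: "(\<Sum>i<k. cnj (u i) * u i) = of_real S"
    unfolding S_def of_real_sum complex_norm_square by (simp add: mult.commute)
  have 1: "(\<Sum>i<k. \<Sum>j<k. cnj (u i) * A (i, j) * v j) = of_real S"
    unfolding uu[symmetric] by (simp add: u_def sum_distrib_left mult.assoc)
  have cu: "cnj (u j) = (\<Sum>i<k. cnj (v i) * A (i, j))" if "j < k" for j
    unfolding u_def cnj_sum using that by (intro sum.cong) (auto simp: hermitianD[OF h])
  have 2: "(\<Sum>i<k. \<Sum>j<k. cnj (v i) * A (i, j) * u j) = of_real S"
    unfolding uu[symmetric] by (subst sum.swap) (simp add: cu sum_distrib_right)
  have q: "Re (qform k A (\<lambda>i. v i + of_real e * u i)) = Re (qform k A v) + 2 * e * S + e\<^sup>2 * C" for e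
  proof -
    have "qform k A (\<lambda>i. v i + of_real e * u i) = qform k A v
        + of_real e * (\<Sum>i<k. \<Sum>j<k. cnj (u i) * A (i, j) * v j)
        + of_real e * (\<Sum>i<k. \<Sum>j<k. cnj (v i) * A (i, j) * u j)
        + of_real (e\<^sup>2) * qform k A u"
      unfolding qform_def sum_distrib_left sum.distrib[symmetric]
      by (intro sum.cong refl) (simp add: algebra_simps power2_eq_square)
    thus ?thesis by (simp add: 1 2 C_def)
  qed
  have sq: "2 * (- r) * (r * (C + 1)) + r\<^sup>2 * C = - r\<^sup>2 * (C + 2)" for r
    by (simp add: algebra_simps power2_eq_square)
  have "S = 0"
  proof (rule ccontr)
    assume "S \<noteq> 0"
    hence Sp: "S > 0" using S0 by simp
    \<comment> \<open>The parameter \<open>e = - S / (C + 1)\<close> makes the two last terms equal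
      to a negative multiple of a square. The denominator \<open>C + 1\<close> also covers
      \<open>C = 0\<close>.\<close>
    have "0 \<le> Re (qform k A v) + 2 * (- S / (C + 1)) * S + (- S / (C + 1))\<^sup>2 * C"
      unfolding q[symmetric] by (rule psd)
    hence "0 \<le> 2 * (- S / (C + 1)) * S + (- S / (C + 1))\<^sup>2 * C"
      using v0 by linarith
    also have "\<dots> = 2 * (- (S / (C + 1))) * (S / (C + 1) * (C + 1)) + (S / (C + 1))\<^sup>2 * C"
      using Cc by simp
    also have "\<dots> = - (S / (C + 1))\<^sup>2 * (C + 2)"
      using sq[of "S / (C + 1)"] by simp
    also have "\<dots> < 0"
      using Sp Cc by (simp add: zero_less_mult_iff)
    finally show False by simp
  qed
  hence "u i = 0"
    unfolding S_def using i by (subst (asm) sum_nonneg_eq_0_iff) auto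
  thus ?thesis by (simp add: u_def)
qed

text \<open>A nonzero vector on which a semidefinite form vanishes lies in the kernel, and a kernel
  vector forces the determinant to be 0.\<close>

lemma posdef_if_psd_cdet:
  assumes "hermitian k A" "\<And>v. 0 \<le> Re (qform k A v)" "cdet k A \<noteq> 0"
  shows "posdef k A"
  unfolding posdef_def
proof (intro allI impI)
  fix v :: "nat \<Rightarrow> complex" assume v: "\<exists>i<k. v i \<noteq> 0"
  show "0 < Re (qform k A v)"
  proof (rule ccontr)
    assume "\<not> ?thesis"
    hence "cdet k A = 0"
      by (intro cdet_eq_0I[OF v] psd_kernel[OF assms(1,2)]) auto
    thus False using assms(3) by simp
  qed
qed

text \<open>The matrix under the determinant in \<open>lambda_max\<close>; with it, the
  characteristic equation and the condition that \<open>H\<close> lies below \<open>t\<close>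
  concern the same object.\<close>

definition cshift :: "real \<Rightarrow> (nat \<times> nat \<Rightarrow> complex) \<Rightarrow> nat \<times> nat \<Rightarrow> complex" where
  "cshift t H = (\<lambda>(i, j). (if i = j then of_real t else 0) - H (i, j))"

lemma hermitian_cshift: "hermitian k H \<Longrightarrow> hermitian k (cshift t H)"
  unfolding hermitian_def[of k "cshift t H"] by (auto simp: cshift_def hermitianD)

lemma qform_cshift:
  "Re (qform k (cshift t H) v) = t * (\<Sum>i<k. (cmod (v i))\<^sup>2) - Re (qform k H v)"
proof -
  have "qform k (cshift t H) v =
      (\<Sum>i<k. \<Sum>j<k. (if i = j then of_real t * (cnj (v i) * v j) else 0) - cnj (v i) * H (i, j) * v j)"
    unfolding qform_def cshift_def by (intro sum.cong refl) (simp add: algebra_simps)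
  also have "\<dots> = of_real t * of_real (\<Sum>i<k. (cmod (v i))\<^sup>2) - qform k H v"
    by (simp add: sum_subtractf qform_def sum_distrib_left mult.commute flip: complex_norm_square)
  finally show ?thesis by (simp flip: of_real_mult)
qed

lemma sum_norm_sq_pos:
  fixes v :: "nat \<Rightarrow> complex"
  assumes "\<exists>i<k. v i \<noteq> 0"
  shows "0 < (\<Sum>i<k. (cmod (v i))\<^sup>2)"
proof -
  from assms obtain i where "i < k" "v i \<noteq> 0" by blast
  thus ?thesis by (intro sum_pos2[of "{..<k}" i]) auto
qed

lemma posdef_cshift_mono:
  assumes "posdef k (cshift s H)" "s \<le> t"
  shows "posdef k (cshift t H)"
  unfolding posdef_def
proof (intro allI impI)
  fix v :: "nat \<Rightarrow> complex" assume v: "\<exists>i<k. v i \<noteq> 0"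
  have "0 < Re (qform k (cshift s H) v)" using assms(1) v by (simp add: posdef_def)
  also have "\<dots> \<le> Re (qform k (cshift t H) v)"
    unfolding qform_cshift using assms(2) by (intro diff_mono mult_right_mono sum_nonneg) auto
  finally show "0 < Re (qform k (cshift t H) v)" .
qed

text \<open>A crude operator norm bound; it only has to provide some threshold beyond which shifts
  are positive definite.\<close>

lemma norm_qform_le:
  "cmod (qform k H v) \<le> (\<Sum>i<k. \<Sum>j<k. cmod (H (i, j))) * (\<Sum>i<k. (cmod (v i))\<^sup>2)"
proof -
  let ?S = "\<Sum>i<k. (cmod (v i))\<^sup>2"
  have le: "cmod (v i) * cmod (v j) \<le> ?S" if "i < k" "j < k" for i j
  proof -
    have "(cmod (v i))\<^sup>2 \<le> ?S" "(cmod (v j))\<^sup>2 \<le> ?S"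
      using that by (auto intro!: member_le_sum[of _ _ "\<lambda>i. (cmod (v i))\<^sup>2"])
    moreover have "2 * cmod (v i) * cmod (v j) \<le> (cmod (v i))\<^sup>2 + (cmod (v j))\<^sup>2"
      by (rule sum_squares_bound)
    ultimately show ?thesis by linarith
  qed
  have "cmod (qform k H v) \<le> (\<Sum>i<k. \<Sum>j<k. cmod (H (i, j)) * ?S)"
    unfolding qform_def
    by (intro order.trans[OF norm_sum] sum_mono)
       (auto simp: norm_mult mult.left_commute[of "cmod (v _)" "cmod (H _)"] mult.assoc intro!: mult_left_mono le)
  thus ?thesis by (simp add: sum_distrib_right)
qed

lemma posdef_cshift_large:
  assumes "t > (\<Sum>i<k. \<Sum>j<k. cmod (H (i, j)))"
  shows "posdef k (cshift t H)"
  unfolding posdef_def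
proof (intro allI impI)
  fix v :: "nat \<Rightarrow> complex" assume v: "\<exists>i<k. v i \<noteq> 0"
  have "Re (qform k H v) \<le> (\<Sum>i<k. \<Sum>j<k. cmod (H (i, j))) * (\<Sum>i<k. (cmod (v i))\<^sup>2)"
    by (rule order.trans[OF complex_Re_le_cmod norm_qform_le])
  also have "\<dots> < t * (\<Sum>i<k. (cmod (v i))\<^sup>2)"
    using assms sum_norm_sq_pos[OF v] by (rule mult_strict_right_mono)
  finally show "0 < Re (qform k (cshift t H) v)"
    unfolding qform_cshift by simp
qed

text \<open>\<open>lambda_max\<close> is a \<open>Max\<close>, which needs a finite set. The
  characteristic polynomial is nonzero because its value at a large shift is a positive
  determinant.\<close>

lemma finite_cdet_roots:
  assumes h: "hermitian k H"
  shows "finite {t::real. cdet k (cshift t H) = 0}"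
proof -
  define q :: "complex poly" where
    "q = (\<Sum>p\<in>{p. p permutes {..<k}}. of_int (sign p) * (\<Prod>i<k. [:- H (i, p i), (if i = p i then 1 else 0):]))"
  have q: "poly q (of_real t) = cdet k (cshift t H)" for t :: real
    unfolding q_def cdet_def
    by (simp add: poly_sum poly_prod cshift_def of_int_poly) (intro sum.cong prod.cong arg_cong2[of _ _ _ _ "(*)"]; simp)
  obtain T :: real where T: "T > (\<Sum>i<k. \<Sum>j<k. cmod (H (i, j)))"
    using gt_ex by blast
  have "q \<noteq> 0"
    using q[of T] cdet_posdef[OF hermitian_cshift[OF h] posdef_cshift_large[OF T]] by auto
  hence "finite {z. poly q z = 0}" by (rule poly_roots_finite)
  hence "finite (of_real -` {z. poly q z = 0} :: real set)"
    by (rule finite_vimageI) (auto intro: inj_of_real)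
  thus ?thesis by (simp add: q vimage_def)
qed

lemma cdet_cshift_continuous: "isCont (\<lambda>t. cdet k (cshift t H)) t"
proof -
  have [continuous_intros]: "isCont (\<lambda>x. if b then complex_of_real x else 0) t" for b
    by (cases b) auto
  show ?thesis
    unfolding cdet_def cshift_def by (auto intro!: continuous_intros)
qed

text \<open>The infimum \<open>t0\<close> of the shifts with a positive definite result is the
  largest root. At \<open>t0\<close> the form is semidefinite by a limit from above but not definite
  by openness, so the determinant vanishes there; above \<open>t0\<close> it is positive. For
  \<open>k = 0\<close> there would be no root at all.\<close>

lemma lambda_max_less_iff:
  assumes h: "hermitian k H" and k: "k \<ge> 1"
  shows "lambda_max k H < x \<longleftrightarrow> posdef k (cshift x H)"
proof -
  define S where "S = {t. posdef k (cshift t H)}"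
  have hs: "hermitian k (cshift t H)" for t by (rule hermitian_cshift[OF h])
  \<comment> \<open>Testing with the first coordinate vector bounds \<open>S\<close> from below,
    which makes its infimum meaningful.\<close>
  have notpd: "t \<notin> S" if "t \<le> Re (H (0, 0))" for t
  proof
    assume "t \<in> S"
    hence "0 < Re (qform k (cshift t H) (\<lambda>i. if i = 0 then 1 else 0))"
      using k unfolding S_def posdef_def by auto
    also have "qform k (cshift t H) (\<lambda>i. if i = 0 then 1 else 0) = (\<Sum>i<k. if i = 0 then cshift t H (0, 0) else 0)"
      unfolding qform_def using k by (intro sum.cong refl) (auto simp: if_distrib[of "(*) _"] cong: if_cong)
    also have "Re \<dots> = t - Re (H (0, 0))"
      using k by (auto simp: cshift_def)
    finally show False using that by simp
  qed
  have Sne: "S \<noteq> {}"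
    unfolding S_def using posdef_cshift_large[where k = k and H = H] gt_ex by blast
  have Sbdd: "bdd_below S"
    using notpd by (intro bdd_belowI[of _ "Re (H (0, 0))"]) (meson linear)
  define t0 where "t0 = Inf S"
  have above: "posdef k (cshift t H)" if "t > t0" for t
    using that posdef_cshift_mono cInf_lessD[OF Sne, of t] unfolding S_def t0_def
    by (metis (mono_tags) less_imp_le mem_Collect_eq)
  have psd: "0 \<le> Re (qform k (cshift t0 H) v)" for v
  proof (rule field_le_epsilon)
    fix e :: real assume e: "e > 0"
    define s where "s = (\<Sum>i<k. (cmod (v i))\<^sup>2)"
    have s0: "s \<ge> 0" unfolding s_def by (intro sum_nonneg) auto
    \<comment> \<open>The denominator \<open>s + 1\<close> keeps the increment defined when
      \<open>v\<close> vanishes on the relevant indices.\<close>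
    define d where "d = e / (s + 1)"
    have d: "d > 0" "d * s \<le> e"
      using e s0 by (auto simp: d_def field_simps)
    have "0 \<le> Re (qform k (cshift (t0 + d) H) v)"
    proof (cases "\<exists>i<k. v i \<noteq> 0")
      case True thus ?thesis using above[of "t0 + d"] d by (auto simp: posdef_def intro: less_imp_le)
    qed (simp add: qform_def)
    also have "\<dots> = Re (qform k (cshift t0 H) v) + d * s"
      unfolding qform_cshift s_def by (simp add: algebra_simps)
    finally show "0 \<le> Re (qform k (cshift t0 H) v) + e" using d by linarith
  qed
  have "t0 \<notin> S"
  proof
    assume "t0 \<in> S"
    hence pd: "posdef k (cshift t0 H)" by (simp add: S_def)
    \<comment> \<open>If \<open>t0\<close> itself belonged to \<open>S\<close>, openness would place
      points slightly below \<open>t0\<close> in \<open>S\<close> as well.\<close>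
    have "\<forall>\<^sub>F n in sequentially. posdef k (cshift (t0 - 1 / real (Suc n)) H)"
    proof (rule posdef_open[OF hs pd hs])
      fix i j
      have "(\<lambda>n. complex_of_real (t0 - 1 / real (Suc n))) \<longlonglongrightarrow> of_real (t0 - 0)"
        by (intro tendsto_of_real tendsto_diff tendsto_const LIMSEQ_Suc[OF lim_1_over_n])
      thus "(\<lambda>n. cshift (t0 - 1 / real (Suc n)) H (i, j)) \<longlonglongrightarrow> cshift t0 H (i, j)"
        by (cases "i = j") (auto simp: cshift_def intro!: tendsto_intros simp del: of_real_diff)
    qed
    then obtain n where "t0 - 1 / real (Suc n) \<in> S"
      by (auto simp: S_def eventually_sequentially)
    hence "t0 \<le> t0 - 1 / real (Suc n)"
      unfolding t0_def by (rule cInf_lower[OF _ Sbdd])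
    moreover have "1 / real (Suc n) > 0" by simp
    ultimately show False by linarith
  qed
  hence d0: "cdet k (cshift t0 H) = 0"
    using posdef_if_psd_cdet[OF hs psd] by (auto simp: S_def)
  have "lambda_max k H = t0"
    unfolding lambda_max_def cshift_def[symmetric]
  proof (rule Max_eqI[OF finite_cdet_roots[OF h]])
    fix t assume t: "t \<in> {t. cdet k (cshift t H) = 0}"
    show "t \<le> t0"
    proof (rule ccontr)
      assume "\<not> t \<le> t0"
      with cdet_posdef[OF hs above[of t]] t show False by auto
    qed
  qed (use d0 in auto)
  moreover have "posdef k (cshift x H) \<Longrightarrow> t0 < x"
    using \<open>t0 \<notin> S\<close> cInf_lower[OF _ Sbdd, of x] unfolding t0_def S_def
    by (metis mem_Collect_eq order_le_less)
  ultimately show ?thesis using above by blast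
qed

text \<open>Adding 1 / (n + 1) times the identity makes the matrix positive definite; being real and
  nonnegative passes to the limit.\<close>

lemma cdet_psd_nonneg:
  assumes h: "hermitian k A" and psd: "\<And>v. 0 \<le> Re (qform k A v)"
  shows "cdet k A = of_real (Re (cdet k A))" "0 \<le> Re (cdet k A)"
proof -
  \<comment> \<open>The sign change lets the perturbed matrix be written as a \<open>cshift\<close>,
    so the facts about shifts apply.\<close>
  define B where "B = (\<lambda>(i, j). - A (i, j))"
  have hB: "hermitian k B" unfolding hermitian_def[of k B] by (auto simp: B_def hermitianD[OF h])
  have qB: "qform k B v = - qform k A v" for v
    by (simp add: qform_def B_def sum_negf)
  have pd: "posdef k (cshift (1 / real (Suc n)) B)" for n
    unfolding posdef_def
  proof (intro allI impI)
    fix v :: "nat \<Rightarrow> complex" assume v: "\<exists>i<k. v i \<noteq> 0"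
    show "0 < Re (qform k (cshift (1 / real (Suc n)) B) v)"
      unfolding qform_cshift qB using psd[of v] sum_norm_sq_pos[OF v] by (auto intro!: add_pos_nonneg)
  qed
  note d = cdet_posdef[OF hermitian_cshift[OF hB] pd]
  have d0: "0 \<le> Re (cdet k (cshift (1 / real (Suc n)) B))" for n
    using d[of n] by simp
  have A0: "cdet k (cshift 0 B) = cdet k A"
    by (intro cdet_cong) (auto simp: cshift_def B_def)
  have "(\<lambda>n. cdet k (cshift (1 / real (Suc n)) B)) \<longlonglongrightarrow> cdet k (cshift 0 B)"
    by (rule isCont_tendsto_compose[OF cdet_cshift_continuous LIMSEQ_Suc[OF lim_1_over_n]])
  hence lim: "(\<lambda>n. cdet k (cshift (1 / real (Suc n)) B)) \<longlonglongrightarrow> cdet k A"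
    by (simp only: A0)
  show "0 \<le> Re (cdet k A)"
    by (rule tendsto_lowerbound[OF tendsto_Re[OF lim]]) (use d0 in \<open>simp_all del: of_nat_Suc\<close>)
  have "(\<lambda>n. Im (cdet k (cshift (1 / real (Suc n)) B))) \<longlonglongrightarrow> Im (cdet k A)"
    by (rule tendsto_Im[OF lim])
  moreover have "Im (cdet k (cshift (1 / real (Suc n)) B)) = 0" for n
    using d[of n] by (metis Im_complex_of_real)
  ultimately have "Im (cdet k A) = 0"
    by (simp add: LIMSEQ_const_iff)
  thus "cdet k A = of_real (Re (cdet k A))" by (simp add: complex_eq_iff)
qed

subsection \<open>Second-order asymptotics of determinants\<close>

text \<open>Comparison with the scalar majorant (1 + |w|)^n. It turns n |w_n| \<rightarrow> 0 into
  (1 + w_n)^n \<rightarrow> 1.\<close>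

lemma norm_one_plus_power_minus_one_le:
  fixes w :: "'a :: real_normed_algebra_1"
  shows "norm ((1 + w) ^ n - 1) \<le> exp (real n * norm w) - 1"
proof -
  have "norm ((1 + w) ^ n - 1) \<le> (1 + norm w) ^ n - 1"
  proof (induction n)
    case (Suc n)
    have "(1 + w) ^ Suc n - 1 = (1 + w) * ((1 + w) ^ n - 1) + w"
      by (simp add: algebra_simps)
    also have "norm \<dots> \<le> norm (1 + w) * norm ((1 + w) ^ n - 1) + norm w"
      by (intro norm_triangle_mono norm_mult_ineq order.refl)
    also have "\<dots> \<le> (1 + norm w) * ((1 + norm w) ^ n - 1) + norm w"
      by (intro add_right_mono mult_mono Suc.IH order.trans[OF norm_triangle_ineq]) auto
    finally show ?case by (simp add: algebra_simps)
  qed simp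
  also have "(1 + norm w) ^ n \<le> exp (norm w) ^ n"
    by (intro power_mono) auto
  finally show ?thesis by (simp add: exp_of_nat_mult)
qed

text \<open>The derivative of \<open>(1 + u) exp (- u + u\<^sup>2 / 2)\<close> is \<open>u\<^sup>2 exp (- u + u\<^sup>2 / 2)\<close>.\<close>
lemma one_plus_times_exp_bound:
  fixes u :: complex
  assumes "norm u \<le> 1"
  shows "norm ((1 + u) * exp (- u + u\<^sup>2 / 2) - 1) \<le> exp 2 * norm u ^ 3"
proof -
  define f where "f = (\<lambda>u::complex. (1 + u) * exp (- u + u\<^sup>2 / 2))"
  have "norm (f u - f 0) \<le> (exp 2 * norm u ^ 2) * norm (u - 0)"
  proof (rule field_differentiable_bound[of "cball 0 (norm u)" f "\<lambda>u. u\<^sup>2 * exp (- u + u\<^sup>2 / 2)"])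
    fix z :: complex assume z: "z \<in> cball 0 (norm u)"
    show "(f has_field_derivative z\<^sup>2 * exp (- z + z\<^sup>2 / 2)) (at z within cball 0 (norm u))"
      unfolding f_def by (auto intro!: derivative_eq_intros simp: algebra_simps power2_eq_square)
    have z1: "norm z \<le> norm u" "norm z \<le> 1" using z assms by auto
    have "norm (- z + z\<^sup>2 / 2) \<le> norm z + norm z ^ 2 / 2"
      by (rule order.trans[OF norm_triangle_ineq]) (simp add: norm_power norm_divide)
    also have "\<dots> \<le> 2" using z1 power_le_one[of "norm z" 2] by simp
    finally have "norm (exp (- z + z\<^sup>2 / 2)) \<le> exp 2"
      using norm_exp[of "- z + z\<^sup>2 / 2"] by (meson exp_le_cancel_iff order.trans)
    thus "norm (z\<^sup>2 * exp (- z + z\<^sup>2 / 2)) \<le> exp 2 * norm u ^ 2"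
      unfolding norm_mult norm_power using z1
      by (subst mult.commute, intro mult_mono power_mono) auto
  qed auto
  thus ?thesis by (simp add: f_def power3_eq_cube power2_eq_square mult.assoc)
qed

lemma tendsto_inverse_sqrt: "(\<lambda>n. 1 / complex_of_real (sqrt (real n))) \<longlonglongrightarrow> 0"
proof -
  have "(\<lambda>n. 1 / sqrt (real n)) \<longlonglongrightarrow> 0"
    by real_asymp
  hence "(\<lambda>n. complex_of_real (1 / sqrt (real n))) \<longlonglongrightarrow> of_real 0"
    by (rule tendsto_of_real)
  thus ?thesis by simp
qed

lemma tendsto_drop_sqrt:
  assumes "(\<lambda>n. of_real (sqrt (real n)) * u n) \<longlonglongrightarrow> (a :: complex)"
  shows "u \<longlonglongrightarrow> 0"
proof -
  have "(\<lambda>n. 1 / of_real (sqrt (real n)) * (of_real (sqrt (real n)) * u n)) \<longlonglongrightarrow> 0 * a"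
    by (intro tendsto_mult tendsto_inverse_sqrt assms)
  moreover have "\<forall>\<^sub>F n in sequentially. 1 / of_real (sqrt (real n)) * (of_real (sqrt (real n)) * u n) = u n"
    using eventually_gt_at_top[of 0] by eventually_elim simp
  ultimately have "u \<longlonglongrightarrow> 0 * a" by (rule Lim_transform_eventually)
  thus ?thesis by simp
qed

text \<open>Second-order expansion of the logarithm in multiplicative form: 1 + u equals (1 + w) exp
  (u - u^2 / 2) with w of order |u|^3. Since n u^2 converges and u tends to 0, n |w| tends to 0 and
  only the factor exp (- n u^2 / 2) remains.\<close>

lemma power_times_exp_tendsto:
  fixes u :: "nat \<Rightarrow> complex"
  assumes lim: "(\<lambda>n. of_real (sqrt (real n)) * u n) \<longlonglongrightarrow> a"
  shows "(\<lambda>n. (1 + u n) ^ n * exp (- (of_nat n * u n))) \<longlonglongrightarrow> exp (- a\<^sup>2 / 2)"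
proof -
  have u0: "u \<longlonglongrightarrow> 0" by (rule tendsto_drop_sqrt[OF lim])
  have "(\<lambda>n. (of_real (sqrt (real n)) * u n)\<^sup>2) \<longlonglongrightarrow> a\<^sup>2"
    by (intro tendsto_intros lim)
  hence sq: "(\<lambda>n. of_nat n * (u n)\<^sup>2) \<longlonglongrightarrow> a\<^sup>2"
    by (simp add: power_mult_distrib flip: of_real_power)
  define w where "w n = (1 + u n) * exp (- u n + (u n)\<^sup>2 / 2) - 1" for n
  have "(\<lambda>n. exp 2 * (norm (of_nat n * (u n)\<^sup>2) * norm (u n))) \<longlonglongrightarrow> exp 2 * (norm (a\<^sup>2) * norm (0 :: complex))"
    by (intro tendsto_intros sq u0)
  hence e0: "(\<lambda>n. exp 2 * (norm (of_nat n * (u n)\<^sup>2) * norm (u n))) \<longlonglongrightarrow> 0" by simp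
  have "(\<lambda>n. (1 + w n) ^ n - 1) \<longlonglongrightarrow> 0"
  proof (rule Lim_null_comparison)
    have "\<forall>\<^sub>F n in sequentially. norm (u n) < 1"
      using tendsto_norm[OF u0] by (intro order_tendstoD(2)) auto
    thus "\<forall>\<^sub>F n in sequentially. norm ((1 + w n) ^ n - 1) \<le> exp (exp 2 * (norm (of_nat n * (u n)\<^sup>2) * norm (u n))) - 1"
    proof eventually_elim
      case (elim n)
      have "norm (w n) \<le> exp 2 * norm (u n) ^ 3"
        unfolding w_def using elim by (intro one_plus_times_exp_bound) auto
      hence "real n * norm (w n) \<le> real n * (exp 2 * norm (u n) ^ 3)"
        by (intro mult_left_mono) auto
      also have "\<dots> = exp 2 * (norm (of_nat n * (u n)\<^sup>2) * norm (u n))"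
        by (simp add: norm_mult norm_power power3_eq_cube power2_eq_square)
      finally show ?case
        by (intro order.trans[OF norm_one_plus_power_minus_one_le]) auto
    qed
    show "(\<lambda>n. exp (exp 2 * (norm (of_nat n * (u n)\<^sup>2) * norm (u n))) - 1) \<longlonglongrightarrow> 0"
      using tendsto_diff[OF tendsto_exp[OF e0] tendsto_const[of 1]] by simp
  qed
  hence "(\<lambda>n. (1 + w n) ^ n) \<longlonglongrightarrow> 1"
    by (subst (asm) LIM_zero_iff)
  hence "(\<lambda>n. (1 + w n) ^ n * exp (- (of_nat n * (u n)\<^sup>2) / 2)) \<longlonglongrightarrow> 1 * exp (- a\<^sup>2 / 2)"
    by (intro tendsto_intros sq) auto
  moreover have "(1 + w n) ^ n * exp (- (of_nat n * (u n)\<^sup>2) / 2) = (1 + u n) ^ n * exp (- (of_nat n * u n))" for n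
  proof -
    have "(1 + w n) ^ n = (1 + u n) ^ n * exp (of_nat n * (- u n + (u n)\<^sup>2 / 2))"
      by (simp add: w_def power_mult_distrib exp_of_nat_mult)
    thus ?thesis by (simp add: algebra_simps flip: exp_add)
  qed
  ultimately show ?thesis by simp
qed

text \<open>The term \<open>B\<close> of order 1 / n makes the statement inductive: eliminating the
  pivot subtracts a product of two entries of order 1 / sqrt n, so a correction of order 1 / n
  appears after one step even if \<open>B\<close> is 0 at the start.\<close>

lemma cdet_power_tendsto:
  assumes "\<And>i j. i < k \<Longrightarrow> j < k \<Longrightarrow>
    (\<lambda>n. of_nat n * (A n (i, j) - ((if i = j then 1 else 0) - H (i, j) / of_real (sqrt (real n))))) \<longlonglongrightarrow> B (i, j)"
  shows "(\<lambda>n. cdet k (A n) ^ n * exp (of_real (sqrt (real n)) * (\<Sum>i<k. H (i, i)))) \<longlonglongrightarrow>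
    exp ((\<Sum>i<k. B (i, i)) - (\<Sum>i<k. \<Sum>j<k. H (i, j) * H (j, i)) / 2)"
  using assms
proof (induction k arbitrary: A B)
  case (Suc k)
  let ?s = "\<lambda>n. complex_of_real (sqrt (real n))"
  have s2: "?s n * ?s n = of_nat n" for n by (simp flip: of_real_mult)
  have off: "(\<lambda>n. ?s n * (A n (i, j) - (if i = j then 1 else 0))) \<longlonglongrightarrow> - H (i, j)"
    if "i < Suc k" "j < Suc k" for i j
  proof -
    have "(\<lambda>n. 1 / ?s n * (of_nat n * (A n (i, j) - ((if i = j then 1 else 0) - H (i, j) / ?s n))) - H (i, j)) \<longlonglongrightarrow> 0 * B (i, j) - H (i, j)"
      by (intro tendsto_diff tendsto_mult tendsto_inverse_sqrt Suc.prems that tendsto_const)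
    moreover have "\<forall>\<^sub>F n in sequentially. 1 / ?s n * (of_nat n * (A n (i, j) - ((if i = j then 1 else 0) - H (i, j) / ?s n))) - H (i, j)
       = ?s n * (A n (i, j) - (if i = j then 1 else 0))"
      using eventually_gt_at_top[of 0]
      by eventually_elim (simp only: s2[symmetric], simp add: field_simps)
    ultimately have "(\<lambda>n. ?s n * (A n (i, j) - (if i = j then 1 else 0))) \<longlonglongrightarrow> 0 * B (i, j) - H (i, j)"
      by (rule Lim_transform_eventually)
    thus ?thesis by (simp only: mult_zero_left diff_0)
  qed
  define u where "u n = A n (k, k) - 1" for n
  have u: "(\<lambda>n. ?s n * u n) \<longlonglongrightarrow> - H (k, k)" using off[of k k] by (simp add: u_def)
  have u0: "u \<longlonglongrightarrow> 0" by (rule tendsto_drop_sqrt[OF u])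
  have a1: "(\<lambda>n. A n (k, k)) \<longlonglongrightarrow> 1"
    using u0 unfolding u_def by (subst (asm) LIM_zero_iff)
  have pivot: "(\<lambda>n. A n (k, k) ^ n * exp (?s n * H (k, k))) \<longlonglongrightarrow> exp (B (k, k) - H (k, k) * H (k, k) / 2)"
  proof -
    have "(\<lambda>n. of_nat n * (A n (k, k) - (1 - H (k, k) / ?s n))) \<longlonglongrightarrow> B (k, k)"
      using Suc.prems[of k k] by simp
    moreover have "of_nat n * (A n (k, k) - (1 - H (k, k) / ?s n)) = of_nat n * u n + ?s n * H (k, k)" for n
      by (cases "n = 0") (simp_all add: u_def field_simps flip: s2)
    ultimately have "(\<lambda>n. of_nat n * u n + ?s n * H (k, k)) \<longlonglongrightarrow> B (k, k)" by simp
    hence "(\<lambda>n. (1 + u n) ^ n * exp (- (of_nat n * u n)) * exp (of_nat n * u n + ?s n * H (k, k)))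
        \<longlonglongrightarrow> exp (- (- H (k, k))\<^sup>2 / 2) * exp (B (k, k))"
      by (intro tendsto_mult power_times_exp_tendsto u tendsto_exp)
    thus ?thesis
      by (simp add: u_def mult.assoc power2_eq_square algebra_simps flip: exp_add)
  qed
  \<comment> \<open>Over \<open>i < k\<close> the traces of the corrections add up to half of the
    last row and column in the trace of the square of \<open>H\<close>, counted twice; this is
    exactly what the top left block does not contain.\<close>
  define B' where "B' = (\<lambda>(i, j). B (i, j) - H (i, k) * H (k, j))"
  have "(\<lambda>n. cdet k (schur k (A n)) ^ n * exp (?s n * (\<Sum>i<k. H (i, i)))) \<longlonglongrightarrow>
    exp ((\<Sum>i<k. B' (i, i)) - (\<Sum>i<k. \<Sum>j<k. H (i, j) * H (j, i)) / 2)"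
  proof (rule Suc.IH)
    fix i j assume ij: "i < k" "j < k"
    have "(\<lambda>n. of_nat n * (A n (i, j) - ((if i = j then 1 else 0) - H (i, j) / ?s n))
        - (?s n * A n (i, k)) * (?s n * A n (k, j)) / A n (k, k)) \<longlonglongrightarrow> B (i, j) - (- H (i, k)) * (- H (k, j)) / 1"
      using ij off[of i k] off[of k j] Suc.prems[of i j] by (intro tendsto_intros a1) auto
    moreover have "of_nat n * (schur k (A n) (i, j) - ((if i = j then 1 else 0) - H (i, j) / ?s n)) =
        of_nat n * (A n (i, j) - ((if i = j then 1 else 0) - H (i, j) / ?s n))
        - (?s n * A n (i, k)) * (?s n * A n (k, j)) / A n (k, k)" for n
      unfolding schur_def by (simp add: algebra_simps flip: s2)
    ultimately show "(\<lambda>n. of_nat n * (schur k (A n) (i, j) - ((if i = j then 1 else 0) - H (i, j) / ?s n))) \<longlonglongrightarrow> B' (i, j)"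
      by (simp add: B'_def)
  qed
  from tendsto_mult[OF pivot this]
  have "(\<lambda>n. A n (k, k) ^ n * exp (?s n * H (k, k)) * (cdet k (schur k (A n)) ^ n * exp (?s n * (\<Sum>i<k. H (i, i)))))
    \<longlonglongrightarrow> exp ((\<Sum>i<Suc k. B (i, i)) - (\<Sum>i<Suc k. \<Sum>j<Suc k. H (i, j) * H (j, i)) / 2)"
    by (simp add: B'_def sum.distrib sum_subtractf add_divide_distrib algebra_simps flip: exp_add)
  moreover have "\<forall>\<^sub>F n in sequentially. A n (k, k) \<noteq> 0"
    by (rule tendsto_imp_eventually_ne[OF a1]) simp
  hence "\<forall>\<^sub>F n in sequentially. A n (k, k) ^ n * exp (?s n * H (k, k)) * (cdet k (schur k (A n)) ^ n * exp (?s n * (\<Sum>i<k. H (i, i))))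
      = cdet (Suc k) (A n) ^ n * exp (?s n * (\<Sum>i<Suc k. H (i, i)))"
    by eventually_elim (simp add: cdet_schur power_mult_distrib algebra_simps exp_add)
  ultimately show ?case by (simp cong: tendsto_cong)
qed simp

subsection \<open>Lebesgue integrals over complex coordinates\<close>

lemma measurable_Complex [measurable (raw)]:
  assumes "f \<in> borel_measurable M" "g \<in> borel_measurable M"
  shows "(\<lambda>x. Complex (f x) (g x)) \<in> borel_measurable M"
  using assms unfolding Complex_eq by measurable

lemma lborel_complex_eq_distr:
  "(lborel :: complex measure) = distr (lborel \<Otimes>\<^sub>M lborel) borel (\<lambda>(x, y). Complex x y)"
proof (rule lborel_eqI)
  fix l u :: complex assume lu: "\<And>b. b \<in> Basis \<Longrightarrow> l \<bullet> b \<le> u \<bullet> b"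
  have le: "Re l \<le> Re u" "Im l \<le> Im u"
    using lu[of 1] lu[of \<i>] by (auto simp: Basis_complex_def)
  have m: "(\<lambda>(x, y). Complex x y) \<in> borel_measurable (lborel \<Otimes>\<^sub>M lborel)"
    unfolding case_prod_beta by measurable
  have "emeasure (distr (lborel \<Otimes>\<^sub>M lborel) borel (\<lambda>(x, y). Complex x y)) (box l u)
      = emeasure (lborel \<Otimes>\<^sub>M lborel) ({Re l<..<Re u} \<times> {Im l<..<Im u})"
    using m by (subst emeasure_distr)
      (auto intro!: arg_cong2[of _ _ _ _ emeasure] simp: box_def Basis_complex_def space_pair_measure)
  also have "\<dots> = ennreal (Re u - Re l) * ennreal (Im u - Im l)"
    using le by (subst lborel.emeasure_pair_measure_Times) auto
  also have "\<dots> = (\<Prod>b\<in>Basis. (u - l) \<bullet> b)"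
    using le by (simp add: Basis_complex_def ennreal_mult)
  finally show "emeasure (distr (lborel \<Otimes>\<^sub>M lborel) borel (\<lambda>(x, y). Complex x y)) (box l u) = (\<Prod>b\<in>Basis. (u - l) \<bullet> b)" .
qed simp

lemma nn_integral_complex:
  assumes [measurable]: "F \<in> borel_measurable borel"
  shows "(\<integral>\<^sup>+z. F z \<partial>lborel) = (\<integral>\<^sup>+x. \<integral>\<^sup>+y. F (Complex x y) \<partial>lborel \<partial>lborel)"
  by (subst lborel_complex_eq_distr)
     (simp add: nn_integral_distr lborel.nn_integral_fst[symmetric] case_prod_beta)

text \<open>Multiplication by \<open>c = a + i b\<close> is undone in two real substitutions, first
  in \<open>x\<close> with factor 1 / |a|, then in \<open>y\<close> with factor |a| / (a^2 + b^2).
  The first one requires \<open>a \<noteq> 0\<close>.\<close>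

lemma nn_integral_complex_mult_aux:
  assumes [measurable]: "F \<in> borel_measurable borel" and a: "Re c \<noteq> 0"
  shows "(\<integral>\<^sup>+z. F z \<partial>lborel) = ennreal ((cmod c)\<^sup>2) * (\<integral>\<^sup>+z. F (c * z) \<partial>lborel)"
proof -
  define a where "a = Re c"
  define b where "b = Im c"
  have a0: "a \<noteq> 0" using a by (simp add: a_def)
  have "(\<integral>\<^sup>+z. F (c * z) \<partial>lborel) = (\<integral>\<^sup>+x. \<integral>\<^sup>+y. F (Complex (a * x - b * y) (a * y + b * x)) \<partial>lborel \<partial>lborel)"
    by (subst nn_integral_complex) (auto intro!: nn_integral_cong arg_cong[of _ _ F] simp: complex_eq_iff a_def b_def)
  also have "\<dots> = (\<integral>\<^sup>+y. \<integral>\<^sup>+x. F (Complex (a * x - b * y) (a * y + b * x)) \<partial>lborel \<partial>lborel)"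
    by (rule lborel_pair.Fubini') measurable
  also have "\<dots> = (\<integral>\<^sup>+y. ennreal \<bar>1 / a\<bar> * (\<integral>\<^sup>+x. F (Complex x (a * y + b * ((x + b * y) / a))) \<partial>lborel) \<partial>lborel)"
  proof (rule nn_integral_cong)
    fix y
    show "(\<integral>\<^sup>+x. F (Complex (a * x - b * y) (a * y + b * x)) \<partial>lborel) =
       ennreal \<bar>1 / a\<bar> * (\<integral>\<^sup>+x. F (Complex x (a * y + b * ((x + b * y) / a))) \<partial>lborel)"
      using a0 by (subst nn_integral_real_affine[where c = "1 / a" and t = "b * y / a"])
        (auto intro!: nn_integral_cong arg_cong2[of _ _ _ _ "(*)"] arg_cong[of _ _ F] simp: field_simps)
  qed
  also have "\<dots> = ennreal \<bar>1 / a\<bar> * (\<integral>\<^sup>+y. \<integral>\<^sup>+x. F (Complex x (a * y + b * ((x + b * y) / a))) \<partial>lborel \<partial>lborel)"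
    by (rule nn_integral_cmult) measurable
  also have "(\<integral>\<^sup>+y. \<integral>\<^sup>+x. F (Complex x (a * y + b * ((x + b * y) / a))) \<partial>lborel \<partial>lborel) =
     (\<integral>\<^sup>+x. \<integral>\<^sup>+y. F (Complex x (a * y + b * ((x + b * y) / a))) \<partial>lborel \<partial>lborel)"
    by (rule lborel_pair.Fubini') measurable
  also have "\<dots> = (\<integral>\<^sup>+x. ennreal \<bar>a / (a\<^sup>2 + b\<^sup>2)\<bar> * (\<integral>\<^sup>+y. F (Complex x y) \<partial>lborel) \<partial>lborel)"
  proof (rule nn_integral_cong)
    fix x
    have p: "a\<^sup>2 + b\<^sup>2 > 0" using a0 by (simp add: sum_power2_gt_zero_iff)
    have "a * (- (b * x / (a\<^sup>2 + b\<^sup>2)) + a / (a\<^sup>2 + b\<^sup>2) * y) + b * ((x + b * (- (b * x / (a\<^sup>2 + b\<^sup>2)) + a / (a\<^sup>2 + b\<^sup>2) * y)) / a) = y" for y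
    proof -
      define X where "X = - (b * x / (a\<^sup>2 + b\<^sup>2)) + a / (a\<^sup>2 + b\<^sup>2) * y"
      have "X = (a * y - b * x) / (a\<^sup>2 + b\<^sup>2)"
        unfolding X_def by (simp add: diff_divide_distrib)
      hence X: "X * (a\<^sup>2 + b\<^sup>2) = a * y - b * x"
        using nonzero_eq_divide_eq[of "a\<^sup>2 + b\<^sup>2" X "a * y - b * x"] p by (metis less_numeral_extra(3))
      have "a * (a * X + b * ((x + b * X) / a)) = X * (a\<^sup>2 + b\<^sup>2) + b * x"
        using a0 by (simp add: field_simps power2_eq_square)
      hence "a * (a * X + b * ((x + b * X) / a)) = a * y"
        unfolding X by simp
      thus ?thesis using a0 by (simp add: X_def)
    qed
    moreover have ne: "a / (a\<^sup>2 + b\<^sup>2) \<noteq> 0" using a0 p by simp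
    ultimately show "(\<integral>\<^sup>+y. F (Complex x (a * y + b * ((x + b * y) / a))) \<partial>lborel) =
       ennreal \<bar>a / (a\<^sup>2 + b\<^sup>2)\<bar> * (\<integral>\<^sup>+y. F (Complex x y) \<partial>lborel)"
      by (subst nn_integral_real_affine[OF _ ne, where t = "- (b * x / (a\<^sup>2 + b\<^sup>2))"]) auto
  qed
  also have "\<dots> = ennreal \<bar>a / (a\<^sup>2 + b\<^sup>2)\<bar> * (\<integral>\<^sup>+z. F z \<partial>lborel)"
    by (subst nn_integral_cmult) (auto simp: nn_integral_complex)
  finally have "(\<integral>\<^sup>+z. F (c * z) \<partial>lborel) = ennreal \<bar>1 / a\<bar> * (ennreal \<bar>a / (a\<^sup>2 + b\<^sup>2)\<bar> * (\<integral>\<^sup>+z. F z \<partial>lborel))" .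
  also have "\<dots> = ennreal (1 / (cmod c)\<^sup>2) * (\<integral>\<^sup>+z. F z \<partial>lborel)"
    using a0 by (simp add: mult.assoc[symmetric] cmod_power2 a_def b_def abs_divide flip: ennreal_mult')
  finally have e: "(\<integral>\<^sup>+z. F (c * z) \<partial>lborel) = ennreal (1 / (cmod c)\<^sup>2) * (\<integral>\<^sup>+z. F z \<partial>lborel)" .
  have "ennreal ((cmod c)\<^sup>2) * ennreal (1 / (cmod c)\<^sup>2) = 1"
    using a by (subst ennreal_mult'[symmetric]) auto
  thus ?thesis unfolding e by (simp add: mult.assoc[symmetric])
qed

lemma nn_integral_complex_affine:
  assumes [measurable]: "F \<in> borel_measurable borel" and c: "c \<noteq> 0"
  shows "(\<integral>\<^sup>+z. F z \<partial>lborel) = ennreal ((cmod c)\<^sup>2) * (\<integral>\<^sup>+z. F (c * z + t) \<partial>lborel)"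
proof -
  have mult: "(\<integral>\<^sup>+z. G z \<partial>lborel) = ennreal ((cmod c)\<^sup>2) * (\<integral>\<^sup>+z. G (c * z) \<partial>lborel)"
    if [measurable]: "G \<in> borel_measurable borel" for G
  proof (cases "Re c = 0")
    case True
    \<comment> \<open>For purely imaginary \<open>c\<close> both factors \<open>1 + \<i>\<close> and
      \<open>d\<close> have a nonzero real part, so the previous case applies twice.\<close>
    define d where "d = c / (1 + \<i>)"
    have cd: "c = (1 + \<i>) * d" by (simp add: d_def complex_eq_iff)
    have "d = Complex (Im c / 2) (Im c / 2)"
      using True unfolding d_def by (simp add: complex_eq_iff Re_divide Im_divide power2_eq_square)
    hence "Re d \<noteq> 0" using c True by (auto simp: complex_eq_iff)
    hence "(\<integral>\<^sup>+z. G z \<partial>lborel) = ennreal ((cmod (1 + \<i>))\<^sup>2) * (ennreal ((cmod d)\<^sup>2) * (\<integral>\<^sup>+z. G ((1 + \<i>) * (d * z)) \<partial>lborel))"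
      by (subst nn_integral_complex_mult_aux[of _ "1 + \<i>"], measurable, simp,
          subst nn_integral_complex_mult_aux[of _ d], auto)
    thus ?thesis
      unfolding cd by (simp add: norm_mult power_mult_distrib ennreal_mult mult.assoc)
  next
    case False
    show ?thesis by (rule nn_integral_complex_mult_aux) (use that False in simp_all)
  qed
  have "(\<integral>\<^sup>+z. F z \<partial>lborel) = (\<integral>\<^sup>+z. F (t + z) \<partial>lborel)"
    by (subst lborel_distr_plus[of t, symmetric]) (simp add: nn_integral_distr)
  also have "\<dots> = ennreal ((cmod c)\<^sup>2) * (\<integral>\<^sup>+z. F (t + c * z) \<partial>lborel)"
    by (rule mult) measurable
  finally show ?thesis by (simp add: add.commute)
qed

section \<open>Product Lebesgue measure under coordinatewise maps, shears and rotations\<close>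

interpretation lb: product_sigma_finite "\<lambda>_. lborel :: 'a :: euclidean_space measure"
  by standard

abbreviation leb :: "'i set \<Rightarrow> ('i \<Rightarrow> 'a :: euclidean_space) measure" where
  "leb J \<equiv> PiM J (\<lambda>_. lborel)"

lemma measurable_leb_update [measurable]:
  "(\<lambda>(x, y). x(i := y)) \<in> leb J \<Otimes>\<^sub>M lborel \<rightarrow>\<^sub>M leb (insert i J)"
  by (rule measurable_add_dim)

text \<open>Fubini, one coordinate at a time. The map may vary with the coordinate while its
  Jacobian \<open>K\<close> may not; this serves both the real translations with scaling and the
  complex scalings.\<close>

lemma nn_integral_leb_coordinatewise:
  fixes F :: "('i \<Rightarrow> 'a :: euclidean_space) \<Rightarrow> ennreal"
    and h :: "'i \<Rightarrow> 'a \<Rightarrow> 'a"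
  assumes "finite J" and [measurable]: "\<And>i. h i \<in> borel_measurable borel"
    and sub: "\<And>i G. G \<in> borel_measurable borel \<Longrightarrow> (\<integral>\<^sup>+y. G y \<partial>lborel) = K * (\<integral>\<^sup>+y. G (h i y) \<partial>lborel)"
    and "F \<in> borel_measurable (leb J)"
  shows "(\<integral>\<^sup>+x. F x \<partial>leb J) = K ^ card J * (\<integral>\<^sup>+x. F (\<lambda>e\<in>J. h e (x e)) \<partial>leb J)"
  using assms(1,4)
proof (induction J arbitrary: F rule: finite_induct)
  case empty
  have "(\<lambda>e\<in>{}. h e (x e)) = x" if "x \<in> space (leb {})" for x :: "'i \<Rightarrow> 'a"
    using that by (auto simp: space_PiM)
  hence "(\<integral>\<^sup>+x. F (\<lambda>e\<in>{}. h e (x e)) \<partial>leb {}) = (\<integral>\<^sup>+x. F x \<partial>leb {})"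
    by (intro nn_integral_cong arg_cong[of _ _ F])
  thus ?case by (simp only: card.empty power_0 mult_1)
next
  case (insert i J)
  note [measurable] = insert.prems
  have "(\<integral>\<^sup>+x. F x \<partial>leb (insert i J)) = (\<integral>\<^sup>+x. (\<integral>\<^sup>+y. F (x(i := y)) \<partial>lborel) \<partial>leb J)"
    by (rule lb.product_nn_integral_insert) (use insert in auto)
  also have "\<dots> = (\<integral>\<^sup>+x. K * (\<integral>\<^sup>+y. F (x(i := h i y)) \<partial>lborel) \<partial>leb J)"
  proof (rule nn_integral_cong)
    fix x :: "'i \<Rightarrow> 'a" assume [measurable]: "x \<in> space (leb J)"
    show "(\<integral>\<^sup>+y. F (x(i := y)) \<partial>lborel) = K * (\<integral>\<^sup>+y. F (x(i := h i y)) \<partial>lborel)"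
      by (rule sub) measurable
  qed
  also have "\<dots> = K * (\<integral>\<^sup>+x. (\<integral>\<^sup>+y. F (x(i := h i y)) \<partial>lborel) \<partial>leb J)"
    by (rule nn_integral_cmult) measurable
  also have "(\<integral>\<^sup>+x. (\<integral>\<^sup>+y. F (x(i := h i y)) \<partial>lborel) \<partial>leb J) =
      K ^ card J * (\<integral>\<^sup>+x. (\<integral>\<^sup>+y. F ((\<lambda>e\<in>J. h e (x e))(i := h i y)) \<partial>lborel) \<partial>leb J)"
    by (rule insert.IH) measurable
  also have "(\<integral>\<^sup>+x. (\<integral>\<^sup>+y. F ((\<lambda>e\<in>J. h e (x e))(i := h i y)) \<partial>lborel) \<partial>leb J) =
      (\<integral>\<^sup>+x. F (\<lambda>e\<in>insert i J. h e (x e)) \<partial>leb (insert i J))"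
    by (subst lb.product_nn_integral_insert)
       (use insert.hyps in \<open>auto intro!: nn_integral_cong arg_cong[of _ _ F]\<close>)
  finally show ?case
    unfolding card_insert_disjoint[OF insert.hyps(1,2)] power_Suc mult.assoc .
qed

lemma nn_integral_leb_affine_real:
  fixes F :: "('i \<Rightarrow> real) \<Rightarrow> ennreal"
  assumes "finite J" "c \<noteq> 0" "F \<in> borel_measurable (leb J)"
  shows "(\<integral>\<^sup>+x. F x \<partial>leb J) = ennreal \<bar>c\<bar> ^ card J * (\<integral>\<^sup>+x. F (\<lambda>e\<in>J. t e + c * x e) \<partial>leb J)"
proof (rule nn_integral_leb_coordinatewise)
  fix i and G :: "real \<Rightarrow> ennreal" assume "G \<in> borel_measurable borel"
  from nn_integral_real_affine[OF this assms(2), of "t i"]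
  show "(\<integral>\<^sup>+y. G y \<partial>lborel) = ennreal \<bar>c\<bar> * (\<integral>\<^sup>+y. G (t i + c * y) \<partial>lborel)" .
qed (use assms in auto)

lemma nn_integral_leb_scale_complex:
  fixes F :: "('i \<Rightarrow> complex) \<Rightarrow> ennreal"
  assumes "finite J" "c \<noteq> 0" "F \<in> borel_measurable (leb J)"
  shows "(\<integral>\<^sup>+x. F x \<partial>leb J) = ennreal ((cmod c)\<^sup>2) ^ card J * (\<integral>\<^sup>+x. F (\<lambda>e\<in>J. c * x e) \<partial>leb J)"
proof (rule nn_integral_leb_coordinatewise)
  fix G :: "complex \<Rightarrow> ennreal" assume "G \<in> borel_measurable borel"
  from nn_integral_complex_affine[OF this assms(2), of 0]
  show "(\<integral>\<^sup>+y. G y \<partial>lborel) = ennreal ((cmod c)\<^sup>2) * (\<integral>\<^sup>+y. G (c * y) \<partial>lborel)" by simp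
qed (use assms in auto)

text \<open>A shear: the last hypothesis says that \<open>g\<close> ignores coordinate
  \<open>i\<close>, so with the other coordinates fixed the substitution is affine in one complex
  variable.\<close>

lemma nn_integral_leb_update:
  fixes F :: "('i \<Rightarrow> complex) \<Rightarrow> ennreal"
  assumes J: "finite J" "i \<in> J" and c: "c \<noteq> 0"
    and [measurable]: "g \<in> borel_measurable (leb J)" "F \<in> borel_measurable (leb J)"
    and g: "\<And>x y. g (x(i := y)) = g x"
  shows "(\<integral>\<^sup>+x. F x \<partial>leb J) = ennreal ((cmod c)\<^sup>2) * (\<integral>\<^sup>+x. F (x(i := c * x i + g x)) \<partial>leb J)"
proof -
  define I where "I = J - {i}"
  have JI: "J = insert i I" "i \<notin> I" "finite I" using J by (auto simp: I_def)
  have [measurable]: "g \<in> borel_measurable (leb (insert i I))" "F \<in> borel_measurable (leb (insert i I))"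
    by (simp_all flip: JI(1))
  have [measurable]: "(\<lambda>x. x(i := c * x i + g x)) \<in> leb (insert i I) \<rightarrow>\<^sub>M leb (insert i I)"
    by (rule measurable_PiM_single') (auto simp: space_PiM PiE_iff extensional_def)
  have "(\<integral>\<^sup>+x. F x \<partial>leb (insert i I)) = (\<integral>\<^sup>+x. (\<integral>\<^sup>+y. F (x(i := y)) \<partial>lborel) \<partial>leb I)"
    by (rule lb.product_nn_integral_insert) (use JI in auto)
  also have "\<dots> = (\<integral>\<^sup>+x. ennreal ((cmod c)\<^sup>2) * (\<integral>\<^sup>+y. F (x(i := c * y + g (x(i := 0)))) \<partial>lborel) \<partial>leb I)"
  proof (rule nn_integral_cong)
    fix x :: "'i \<Rightarrow> complex" assume [measurable]: "x \<in> space (leb I)"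
    show "(\<integral>\<^sup>+y. F (x(i := y)) \<partial>lborel) = ennreal ((cmod c)\<^sup>2) * (\<integral>\<^sup>+y. F (x(i := c * y + g (x(i := 0)))) \<partial>lborel)"
      by (rule nn_integral_complex_affine[OF _ c]) measurable
  qed
  also have "\<dots> = ennreal ((cmod c)\<^sup>2) * (\<integral>\<^sup>+x. (\<integral>\<^sup>+y. F (x(i := c * y + g (x(i := 0)))) \<partial>lborel) \<partial>leb I)"
    by (rule nn_integral_cmult) measurable
  also have "(\<integral>\<^sup>+x. (\<integral>\<^sup>+y. F (x(i := c * y + g (x(i := 0)))) \<partial>lborel) \<partial>leb I) =
      (\<integral>\<^sup>+x. F (x(i := c * x i + g x)) \<partial>leb (insert i I))"
    by (subst lb.product_nn_integral_insert) (use JI in \<open>simp_all add: g\<close>)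
  finally show ?thesis by (simp flip: JI(1))
qed

text \<open>A unitary map of two coordinates, factored into two shears with Jacobians r^2 / |b|^2
  and |b|^2 / r^2. The factorisation divides by \<open>cnj b\<close>, hence
  \<open>b \<noteq> 0\<close>.\<close>

lemma nn_integral_leb_rotate:
  fixes F :: "('i \<Rightarrow> complex) \<Rightarrow> ennreal"
  assumes J: "finite J" "p \<in> J" "q \<in> J" "p \<noteq> q" and b: "b \<noteq> 0"
    and r: "r = sqrt ((cmod a)\<^sup>2 + (cmod b)\<^sup>2)"
    and [measurable]: "F \<in> borel_measurable (leb J)"
  shows "(\<integral>\<^sup>+x. F (x(p := (b * x p - a * x q) / r, q := (cnj a * x p + cnj b * x q) / r)) \<partial>leb J)
    = (\<integral>\<^sup>+x. F x \<partial>leb J)"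
proof -
  have r0: "r > 0" unfolding r using b by (auto intro!: add_nonneg_pos)
  have r2: "of_real r * of_real r = a * cnj a + b * cnj b"
    unfolding r by (simp add: complex_norm_square[symmetric] flip: of_real_mult)
  have [measurable]: "(\<lambda>x. x(p := of_real r / cnj b * x p + - (a / cnj b) * x q)) \<in> leb J \<rightarrow>\<^sub>M leb J"
    using J by (intro measurable_PiM_single') (auto simp: space_PiM PiE_iff extensional_def)
  have Fm: "(\<lambda>x. F (x(p := of_real r / cnj b * x p + - (a / cnj b) * x q))) \<in> borel_measurable (leb J)"
    by measurable
  have gm: "(\<lambda>x. cnj a / r * x p) \<in> borel_measurable (leb J)"
    using J by measurable
  have c2: "cnj b / r \<noteq> 0" using b r0 by simp
  have "(\<integral>\<^sup>+x. F x \<partial>leb J) = ennreal ((cmod (of_real r / cnj b))\<^sup>2) *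
      (\<integral>\<^sup>+x. F (x(p := of_real r / cnj b * x p + - (a / cnj b) * x q)) \<partial>leb J)"
    by (rule nn_integral_leb_update) (use J b r0 in auto)
  also have "(\<integral>\<^sup>+x. F (x(p := of_real r / cnj b * x p + - (a / cnj b) * x q)) \<partial>leb J) =
      ennreal ((cmod (cnj b / r))\<^sup>2) *
      (\<integral>\<^sup>+x. F ((x(q := cnj b / r * x q + cnj a / r * x p))(p := of_real r / cnj b * x p + - (a / cnj b) * (cnj b / r * x q + cnj a / r * x p))) \<partial>leb J)"
    using J(4) by (subst nn_integral_leb_update[OF J(1,3) c2 gm Fm]) auto
  also have "\<dots> = ennreal ((cmod (cnj b / r))\<^sup>2) *
      (\<integral>\<^sup>+x. F (x(p := (b * x p - a * x q) / r, q := (cnj a * x p + cnj b * x q) / r)) \<partial>leb J)"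
  proof -
    have e2: "cnj b / r * t + cnj a / r * s = (cnj a * s + cnj b * t) / r" for s t
      by (simp add: add_divide_distrib)
    have "of_real r / cnj b * s + - (a / cnj b) * ((cnj a * s + cnj b * t) / r) = (b * s - a * t) / r" for s t
    proof -
      have "of_real r / cnj b * s + - (a / cnj b) * ((cnj a * s + cnj b * t) / r) =
        ((of_real r * of_real r) * s - a * (cnj b * t + cnj a * s)) / (cnj b * of_real r)"
        using b r0 by (simp add: field_simps)
      also have "\<dots> = (b * s - a * t) / r"
        unfolding r2 using b r0 by (simp add: field_simps)
      finally show ?thesis .
    qed

    thus ?thesis
      by (intro arg_cong2[of _ _ _ _ "(*)"] refl nn_integral_cong arg_cong[of _ _ F])
        (simp only: e2 fun_upd_twist[OF J(4)])
  qed
  finally have "(\<integral>\<^sup>+x. F x \<partial>leb J) = (ennreal ((cmod (of_real r / cnj b))\<^sup>2) * ennreal ((cmod (cnj b / r))\<^sup>2)) *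
      (\<integral>\<^sup>+x. F (x(p := (b * x p - a * x q) / r, q := (cnj a * x p + cnj b * x q) / r)) \<partial>leb J)"
    by (simp only: mult.assoc)
  also have "ennreal ((cmod (of_real r / cnj b))\<^sup>2) * ennreal ((cmod (cnj b / r))\<^sup>2) = 1"
    using b r0 by (subst ennreal_mult'[symmetric]) (simp_all add: norm_divide power_divide)
  finally show ?thesis by (simp only: mult_1)
qed

text \<open>A disc of squared radius t has area pi t, so the squared modulus pushes planar Lebesgue
  measure to a constant multiple of Lebesgue measure on the half-line.\<close>

lemma nn_integral_complex_radial:
  fixes g :: "real \<Rightarrow> ennreal"
  assumes [measurable]: "g \<in> borel_measurable borel"
  shows "(\<integral>\<^sup>+z. g ((cmod z)\<^sup>2) \<partial>lborel) = ennreal pi * (\<integral>\<^sup>+t. indicator {0<..} t * g t \<partial>lborel)"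
proof -
  have "distr lborel borel (\<lambda>z::complex. (cmod z)\<^sup>2) = density lborel (\<lambda>t. ennreal pi * indicator {0<..} t)"
    (is "?D1 = ?D2")
  proof (rule measure_eqI_generator_eq[where E = "range atMost" and \<Omega> = UNIV and A = "\<lambda>i. {..real i}"])
    have D1: "emeasure ?D1 {..t} = ennreal (pi * max 0 t)" for t :: real
    proof (cases "t < 0")
      case True
      have "t < (cmod z)\<^sup>2" for z :: complex
        using True zero_le_power2[of "cmod z"] by linarith
      hence "(\<lambda>z::complex. (cmod z)\<^sup>2) -` {..t} = {}"
        by (auto simp: not_le[symmetric])
      thus ?thesis using True by (subst emeasure_distr) auto
    next
      case False
      have "(\<lambda>z::complex. (cmod z)\<^sup>2) -` {..t} = cball 0 (sqrt t)"
        using False by (auto simp: real_le_rsqrt real_sqrt_le_iff) (metis real_sqrt_le_mono real_sqrt_pow2 norm_ge_zero power_mono not_less)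
      moreover have "emeasure lborel (cball (0::complex) (sqrt t)) = ennreal (pi * t)"
        using False by (subst emeasure_cball) (auto simp: unit_ball_vol_2 numeral_2_eq_2[symmetric])
      ultimately show ?thesis using False by (subst emeasure_distr) auto
    qed
    have D2: "emeasure ?D2 {..t} = ennreal (pi * max 0 t)" for t :: real
    proof -
      have "emeasure ?D2 {..t} = (\<integral>\<^sup>+x. ennreal pi * indicator {0<..t} x \<partial>lborel)"
        by (subst emeasure_density) (auto intro!: nn_integral_cong split: split_indicator)
      also have "\<dots> = ennreal pi * emeasure lborel {0<..t}"
        by (rule nn_integral_cmult_indicator) simp
      also have "emeasure lborel {0<..t} = ennreal (max 0 t)"
        by (cases "t \<ge> 0") auto
      finally show ?thesis by (simp add: ennreal_mult)
    qed
    show "emeasure ?D1 X = emeasure ?D2 X" if "X \<in> range atMost" for X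
      using that D1 D2 by auto
    show "sets ?D1 = sigma_sets UNIV (range atMost)"
      by (simp add: borel_eq_atMost)
    show "sets ?D2 = sigma_sets UNIV (range atMost)"
      by (simp add: borel_eq_atMost)
    show "emeasure ?D1 {..real i} \<noteq> \<infinity>" for i
      by (simp add: D1)
    show "(\<Union>i. {..real i}) = UNIV"
      using real_arch_simple by auto
  qed (auto simp: Int_stable_def)
  hence "(\<integral>\<^sup>+t. g t \<partial>distr lborel borel (\<lambda>z::complex. (cmod z)\<^sup>2)) =
     (\<integral>\<^sup>+t. g t \<partial>density lborel (\<lambda>t. ennreal pi * indicator {0<..} t))" by simp
  thus ?thesis
    by (simp add: nn_integral_distr nn_integral_density nn_integral_cmult mult.assoc)
qed

text \<open>The density of the squared norm is built up by convolution: a further complex coordinate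
  integrates \<open>q ^ n\<close> over \<open>0 < q < p\<close>, which raises the power by one and
  divides by \<open>n + 1\<close>.\<close>

lemma nn_integral_leb_radial:
  fixes g :: "real \<Rightarrow> ennreal" and J :: "'i set"
  assumes "finite J" "J \<noteq> {}" "g \<in> borel_measurable borel"
  shows "(\<integral>\<^sup>+v. g (\<Sum>e\<in>J. (cmod (v e))\<^sup>2) \<partial>leb J) =
    ennreal (pi ^ card J / fact (card J - 1)) * (\<integral>\<^sup>+p. indicator {0<..} p * ennreal (p ^ (card J - 1)) * g p \<partial>lborel)"
  using assms
proof (induction J arbitrary: g rule: finite_ne_induct)
  case (singleton i)
  note [measurable] = singleton
  have "(\<integral>\<^sup>+v. g (\<Sum>e\<in>{i}. (cmod (v e))\<^sup>2) \<partial>leb {i}) = (\<integral>\<^sup>+v. g ((cmod (v i))\<^sup>2) \<partial>leb {i})"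
    by simp
  also have "\<dots> = (\<integral>\<^sup>+z. g ((cmod z)\<^sup>2) \<partial>lborel)"
    by (rule lb.product_nn_integral_singleton) measurable
  finally show ?case by (simp add: nn_integral_complex_radial)
next
  case (insert i J)
  note [measurable] = insert.prems
  define n where "n = card J - 1"
  have cJ: "card J = Suc n"
    using insert.hyps by (simp add: n_def card_gt_0_iff)
  have "(\<integral>\<^sup>+v. g (\<Sum>e\<in>insert i J. (cmod (v e))\<^sup>2) \<partial>leb (insert i J)) =
      (\<integral>\<^sup>+v. (\<integral>\<^sup>+z. g (\<Sum>e\<in>insert i J. (cmod ((v(i := z)) e))\<^sup>2) \<partial>lborel) \<partial>leb J)"
    by (rule lb.product_nn_integral_insert) (use insert.hyps in auto)
  also have "\<dots> = (\<integral>\<^sup>+v. (\<integral>\<^sup>+z. g ((cmod z)\<^sup>2 + (\<Sum>e\<in>J. (cmod (v e))\<^sup>2)) \<partial>lborel) \<partial>leb J)"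
  proof -
    have "(\<Sum>e\<in>insert i J. (cmod ((v(i := z)) e))\<^sup>2) = (cmod z)\<^sup>2 + (\<Sum>e\<in>J. (cmod (v e))\<^sup>2)"
      for v :: "'i \<Rightarrow> complex" and z
      using insert.hyps by (subst sum.insert) (auto intro!: sum.cong split: if_splits)
    thus ?thesis by (simp only:)
  qed
  also have "\<dots> = (\<integral>\<^sup>+v. ennreal pi * (\<integral>\<^sup>+t. indicator {0<..} t * g (t + (\<Sum>e\<in>J. (cmod (v e))\<^sup>2)) \<partial>lborel) \<partial>leb J)"
    by (intro nn_integral_cong nn_integral_complex_radial) measurable
  also have "\<dots> = ennreal (pi ^ card J / fact n) * (\<integral>\<^sup>+q. indicator {0<..} q * ennreal (q ^ n) * (ennreal pi * (\<integral>\<^sup>+t. indicator {0<..} t * g (t + q) \<partial>lborel)) \<partial>lborel)"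
    unfolding n_def by (rule insert.IH) measurable
  also have "(\<integral>\<^sup>+q. indicator {0<..} q * ennreal (q ^ n) * (ennreal pi * (\<integral>\<^sup>+t. indicator {0<..} t * g (t + q) \<partial>lborel)) \<partial>lborel) =
      ennreal pi * (\<integral>\<^sup>+q. indicator {0<..} q * ennreal (q ^ n) * (\<integral>\<^sup>+t. indicator {0<..} t * g (t + q) \<partial>lborel) \<partial>lborel)"
    by (subst nn_integral_cmult[symmetric]) (auto intro!: nn_integral_cong simp: mult_ac)
  also have "(\<integral>\<^sup>+q. indicator {0<..} q * ennreal (q ^ n) * (\<integral>\<^sup>+t. indicator {0<..} t * g (t + q) \<partial>lborel) \<partial>lborel) =
     (\<integral>\<^sup>+q. (\<integral>\<^sup>+p. indicator {0<..} q * ennreal (q ^ n) * (indicator {0<..} (p - q) * g p) \<partial>lborel) \<partial>lborel)"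
  proof (rule nn_integral_cong)
    fix q :: real
    have "(\<integral>\<^sup>+t. indicator {0<..} t * g (t + q) \<partial>lborel) = (\<integral>\<^sup>+p. indicator {0<..} (p - q) * g p \<partial>lborel)"
      by (subst nn_integral_real_affine[where c = 1 and t = q, of "\<lambda>p. indicator {0<..} (p - q) * g p"]) (auto simp: add.commute)
    thus "indicator {0<..} q * ennreal (q ^ n) * (\<integral>\<^sup>+t. indicator {0<..} t * g (t + q) \<partial>lborel) =
      (\<integral>\<^sup>+p. indicator {0<..} q * ennreal (q ^ n) * (indicator {0<..} (p - q) * g p) \<partial>lborel)"
      by (simp add: nn_integral_cmult)
  qed
  also have "\<dots> = (\<integral>\<^sup>+p. (\<integral>\<^sup>+q. indicator {0<..} q * ennreal (q ^ n) * (indicator {0<..} (p - q) * g p) \<partial>lborel) \<partial>lborel)"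
    by (rule lborel_pair.Fubini') measurable
  also have "\<dots> = (\<integral>\<^sup>+p. ennreal (1 / real (Suc n)) * (indicator {0<..} p * ennreal (p ^ Suc n) * g p) \<partial>lborel)"
  proof (rule nn_integral_cong)
    fix p :: real
    have "(\<integral>\<^sup>+q. indicator {0<..} q * ennreal (q ^ n) * (indicator {0<..} (p - q) * g p) \<partial>lborel) =
       (\<integral>\<^sup>+q. g p * (ennreal (q ^ n) * indicator {0<..<p} q) \<partial>lborel)"
      by (intro nn_integral_cong) (auto split: split_indicator simp: mult_ac)
    also have "\<dots> = g p * (\<integral>\<^sup>+q. ennreal (q ^ n) * indicator {0<..<p} q \<partial>lborel)"
      by (rule nn_integral_cmult) measurable
    also have "(\<integral>\<^sup>+q. ennreal (q ^ n) * indicator {0<..<p} q \<partial>lborel) = ennreal (1 / real (Suc n)) * (indicator {0<..} p * ennreal (p ^ Suc n))"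
    proof (cases "p > 0")
      case True
      have "(\<integral>\<^sup>+q. ennreal (q ^ n) * indicator {0<..<p} q \<partial>lborel) = (\<integral>\<^sup>+q. ennreal (q ^ n) * indicator {0..p} q \<partial>lborel)"
        using AE_lborel_singleton[of 0] AE_lborel_singleton[of p]
        by (intro nn_integral_cong_AE, eventually_elim) (auto simp: indicator_def)
      also have "\<dots> = ennreal (p ^ Suc n / real (Suc n) - 0 ^ Suc n / real (Suc n))"
      proof (rule nn_integral_FTC_Icc)
        fix q :: real
        have "((\<lambda>q. q ^ Suc n / real (Suc n)) has_real_derivative real (Suc n) * q ^ n / real (Suc n)) (at q)"
          by (intro DERIV_cdivide) (use DERIV_pow[of "Suc n" q] in simp)
        thus "((\<lambda>q. q ^ Suc n / real (Suc n)) has_real_derivative q ^ n) (at q)" by simp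
      qed (use True in auto)
      finally show ?thesis using True by (simp flip: ennreal_mult')
    next
      case False
      hence "{0<..<p} = {}" by auto
      thus ?thesis using False by simp
    qed
    finally show "(\<integral>\<^sup>+q. indicator {0<..} q * ennreal (q ^ n) * (indicator {0<..} (p - q) * g p) \<partial>lborel) =
      ennreal (1 / real (Suc n)) * (indicator {0<..} p * ennreal (p ^ Suc n) * g p)"
      by (simp only: mult_ac)
  qed
  also have "\<dots> = ennreal (1 / real (Suc n)) * (\<integral>\<^sup>+p. indicator {0<..} p * ennreal (p ^ Suc n) * g p \<partial>lborel)"
    by (rule nn_integral_cmult) measurable
  finally have "(\<integral>\<^sup>+v. g (\<Sum>e\<in>insert i J. (cmod (v e))\<^sup>2) \<partial>leb (insert i J)) =
      (ennreal (pi ^ card J / fact n) * (ennreal pi * ennreal (1 / real (Suc n)))) *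
      (\<integral>\<^sup>+p. indicator {0<..} p * ennreal (p ^ Suc n) * g p \<partial>lborel)"
    by (simp only: mult.assoc)
  also have "ennreal (pi ^ card J / fact n) * (ennreal pi * ennreal (1 / real (Suc n))) = ennreal (pi ^ card (insert i J) / fact (card (insert i J) - 1))"
    using insert.hyps cJ by (simp flip: ennreal_mult' add: field_simps)
  finally show ?case using insert.hyps cJ by simp
qed

text \<open>Matches the storage convention of \<open>herm_of\<close>: a position above the diagonal
  holds the real part and its mirror image the imaginary part. Disjointness from the mirror image
  excludes diagonal positions.\<close>

lemma nn_integral_leb_complex_real:
  fixes F :: "(nat \<times> nat \<Rightarrow> real) \<Rightarrow> ennreal"
  assumes "finite A" "A \<inter> prod.swap ` A = {}" "F \<in> borel_measurable (leb (A \<union> prod.swap ` A))"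
  shows "(\<integral>\<^sup>+x. F x \<partial>leb (A \<union> prod.swap ` A)) =
    (\<integral>\<^sup>+w. F (\<lambda>e\<in>A \<union> prod.swap ` A. if e \<in> A then Re (w e) else Im (w (prod.swap e))) \<partial>leb A)"
  using assms
proof (induction A arbitrary: F rule: finite_induct)
  case empty
  show ?case
    by (simp add: PiM_empty nn_integral_count_space_finite restrict_def)
next
  case (insert i A)
  let ?s = "prod.swap :: nat \<times> nat \<Rightarrow> nat \<times> nat"
  let ?B = "A \<union> ?s ` A"
  have eq: "insert i A \<union> ?s ` insert i A = insert i (insert (?s i) ?B)" by auto
  have ni: "i \<notin> insert (?s i) ?B" "?s i \<notin> ?B" "A \<inter> ?s ` A = {}" "?s i \<notin> A" "i \<noteq> ?s i"
    using insert.prems(1) insert.hyps(2) by (auto simp: image_iff) (metis swap_simp swap_swap)+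
  have fB: "finite ?B" "finite (insert (?s i) ?B)" using insert.hyps by auto
  have [measurable]: "F \<in> borel_measurable (leb (insert i (insert (?s i) ?B)))"
    using insert.prems(2) unfolding eq .
  have "(\<integral>\<^sup>+x. F x \<partial>leb (insert i (insert (?s i) ?B))) =
      (\<integral>\<^sup>+x. (\<integral>\<^sup>+a. F (x(i := a)) \<partial>lborel) \<partial>leb (insert (?s i) ?B))"
    by (rule lb.product_nn_integral_insert) (use fB ni in auto)
  also have "\<dots> = (\<integral>\<^sup>+x. (\<integral>\<^sup>+b. \<integral>\<^sup>+a. F (x(?s i := b, i := a)) \<partial>lborel \<partial>lborel) \<partial>leb ?B)"
    by (rule lb.product_nn_integral_insert) (use fB ni in auto)
  also have "\<dots> = (\<integral>\<^sup>+x. (\<integral>\<^sup>+z. F (x(?s i := Im z, i := Re z)) \<partial>lborel) \<partial>leb ?B)"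
  proof (rule nn_integral_cong)
    fix x :: "nat \<times> nat \<Rightarrow> real" assume [measurable]: "x \<in> space (leb ?B)"
    have "(\<integral>\<^sup>+b. \<integral>\<^sup>+a. F (x(?s i := b, i := a)) \<partial>lborel \<partial>lborel) = (\<integral>\<^sup>+a. \<integral>\<^sup>+b. F (x(?s i := b, i := a)) \<partial>lborel \<partial>lborel)"
      by (rule lborel_pair.Fubini') measurable
    also have "\<dots> = (\<integral>\<^sup>+z. F (x(?s i := Im z, i := Re z)) \<partial>lborel)"
      by (subst nn_integral_complex) auto
    finally show "(\<integral>\<^sup>+b. \<integral>\<^sup>+a. F (x(?s i := b, i := a)) \<partial>lborel \<partial>lborel) = (\<integral>\<^sup>+z. F (x(?s i := Im z, i := Re z)) \<partial>lborel)" .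
  qed
  also have "\<dots> = (\<integral>\<^sup>+w. (\<integral>\<^sup>+z. F ((\<lambda>e\<in>?B. if e \<in> A then Re (w e) else Im (w (?s e)))(?s i := Im z, i := Re z)) \<partial>lborel) \<partial>leb A)"
    by (rule insert.IH[OF ni(3)]) measurable
  also have "\<dots> = (\<integral>\<^sup>+w. (\<integral>\<^sup>+z. F (\<lambda>e\<in>insert i A \<union> ?s ` insert i A. if e \<in> insert i A then Re ((w(i := z)) e) else Im ((w(i := z)) (?s e))) \<partial>lborel) \<partial>leb A)"
    unfolding eq using ni insert.hyps(2)
    by (intro nn_integral_cong arg_cong[of _ _ F] ext) auto
  also have "\<dots> = (\<integral>\<^sup>+w. F (\<lambda>e\<in>insert i A \<union> ?s ` insert i A. if e \<in> insert i A then Re (w e) else Im (w (?s e))) \<partial>leb (insert i A))"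
  proof -
    have "(\<lambda>w. \<lambda>e\<in>insert i (insert (?s i) ?B). if e \<in> insert i A then Re (w e) else Im (w (?s e)))
        \<in> leb (insert i A) \<rightarrow>\<^sub>M leb (insert i (insert (?s i) ?B))"
    proof (rule measurable_restrict)
      fix e assume e: "e \<in> insert i (insert (?s i) ?B)"
      show "(\<lambda>w. if e \<in> insert i A then Re (w e) else Im (w (?s e))) \<in> leb (insert i A) \<rightarrow>\<^sub>M lborel"
        using e by (cases "e \<in> insert i A") auto
    qed
    hence "(\<lambda>w. F (\<lambda>e\<in>insert i (insert (?s i) ?B). if e \<in> insert i A then Re (w e) else Im (w (?s e))))
        \<in> borel_measurable (leb (insert i A))"
      by measurable
    thus ?thesis unfolding eq
      by (subst lb.product_nn_integral_insert) (use insert.hyps in simp_all)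
  qed
  finally show ?case unfolding eq .
qed

subsection \<open>Gram matrices and positive definite matrices\<close>

abbreviation sq :: "nat \<Rightarrow> (nat \<times> nat) set" where "sq k \<equiv> {..<k} \<times> {..<k}"
abbreviation lastcol :: "nat \<Rightarrow> (nat \<times> nat) set" where "lastcol k \<equiv> {..<k} \<times> {k}"
text \<open>All indices are kept, so matrices of every size share one measurable space;
  \<open>gram\<close>, \<open>hmat\<close> and \<open>blk\<close> are 0 outside their block, which
  makes equality of matrices equality of functions.\<close>

abbreviation matM :: "(nat \<times> nat \<Rightarrow> complex) measure" where "matM \<equiv> PiM UNIV (\<lambda>_. borel)"

definition gram :: "nat \<Rightarrow> (nat \<times> nat \<Rightarrow> complex) \<Rightarrow> nat \<times> nat \<Rightarrow> complex" where
  "gram k Y = (\<lambda>(i, j). if i < k \<and> j < k then \<Sum>l<k. Y (i, l) * cnj (Y (j, l)) else 0)"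

definition hmat :: "nat \<Rightarrow> (nat \<times> nat \<Rightarrow> real) \<Rightarrow> nat \<times> nat \<Rightarrow> complex" where
  "hmat k x = (\<lambda>(i, j). if i < k \<and> j < k then herm_of x (i, j) else 0)"

text \<open>The Hermitian matrix with last column \<open>w\<close> and corner \<open>p\<close> whose Schur complement is \<open>S\<close>.\<close>
definition blk :: "nat \<Rightarrow> (nat \<times> nat \<Rightarrow> complex) \<Rightarrow> (nat \<times> nat \<Rightarrow> complex) \<Rightarrow> real \<Rightarrow> nat \<times> nat \<Rightarrow> complex" where
  "blk k S w p = (\<lambda>(i, j).
     if i < k \<and> j < k then S (i, j) + w (i, k) * cnj (w (j, k)) / of_real p
     else if i < k \<and> j = k then w (i, k)
     else if i = k \<and> j < k then cnj (w (j, k))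
     else if i = k \<and> j = k then of_real p else 0)"

lemma measurable_matM:
  assumes "\<And>i j. (\<lambda>x. f x (i, j)) \<in> borel_measurable N"
  shows "f \<in> N \<rightarrow>\<^sub>M matM"
  by (rule measurable_PiM_single') (use assms in \<open>auto simp: space_PiM\<close>)

lemma measurable_PiM_comp:
  assumes "X \<in> N \<rightarrow>\<^sub>M PiM J M" "e \<in> J"
  shows "(\<lambda>x. X x e) \<in> N \<rightarrow>\<^sub>M M e"
  using assms by measurable

lemma measurable_cnj [measurable (raw)]:
  "f \<in> borel_measurable M \<Longrightarrow> (\<lambda>x. cnj (f x)) \<in> borel_measurable M"
  by (rule measurable_compose[OF _ borel_measurable_continuous_onI]) (auto intro: continuous_intros)

lemma measurable_gram [measurable (raw)]:
  assumes X: "X \<in> N \<rightarrow>\<^sub>M leb (sq k)"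
  shows "(\<lambda>x. gram k (X x)) \<in> N \<rightarrow>\<^sub>M matM"
proof (rule measurable_matM)
  have [measurable]: "(\<lambda>x. X x (i, j)) \<in> borel_measurable N" if "i < k" "j < k" for i j
    using measurable_PiM_comp[OF X, of "(i, j)"] that by simp
  show "(\<lambda>x. gram k (X x) (i, j)) \<in> borel_measurable N" for i j
    unfolding gram_def by (cases "i < k \<and> j < k") (auto intro!: borel_measurable_sum borel_measurable_times)
qed

lemma measurable_hmat [measurable (raw)]:
  assumes X: "X \<in> N \<rightarrow>\<^sub>M leb (sq k)"
  shows "(\<lambda>x. hmat k (X x)) \<in> N \<rightarrow>\<^sub>M matM"
proof (rule measurable_matM)
  have [measurable]: "(\<lambda>x. X x (i, j)) \<in> borel_measurable N" if "i < k" "j < k" for i j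
    using measurable_PiM_comp[OF X, of "(i, j)"] that by simp
  show "(\<lambda>x. hmat k (X x) (i, j)) \<in> borel_measurable N" for i j
    unfolding hmat_def herm_of_def
    by (cases "i < k \<and> j < k"; cases i j rule: linorder_cases) (auto intro!: measurable_Complex)
qed

lemma measurable_blk [measurable (raw)]:
  assumes S: "S \<in> N \<rightarrow>\<^sub>M matM" and w: "w \<in> N \<rightarrow>\<^sub>M leb (lastcol k)" and [measurable]: "p \<in> borel_measurable N"
  shows "(\<lambda>x. blk k (S x) (w x) (p x)) \<in> N \<rightarrow>\<^sub>M matM"
proof (rule measurable_matM)
  have [measurable]: "(\<lambda>x. w x (i, k)) \<in> borel_measurable N" if "i < k" for i
    using measurable_PiM_comp[OF w, of "(i, k)"] that by simp
  have [measurable]: "(\<lambda>x. S x (i, j)) \<in> borel_measurable N" for i j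
    using measurable_PiM_comp[OF S, of "(i, j)"] by simp
  show "(\<lambda>x. blk k (S x) (w x) (p x) (i, j)) \<in> borel_measurable N" for i j
    unfolding blk_def
    by (cases "i < k"; cases "j < k"; cases "i = k"; cases "j = k") auto
qed

text \<open>The definition quantifies over uncountably many vectors; the pivot criterion reduces it
  to finitely many inequalities between measurable functions.\<close>

lemma pred_posdef:
  assumes "\<And>i j. i < k \<Longrightarrow> j < k \<Longrightarrow> (\<lambda>x. A x (i, j)) \<in> borel_measurable N"
    and "\<And>x. x \<in> space N \<Longrightarrow> hermitian k (A x)"
  shows "Measurable.pred N (\<lambda>x. posdef k (A x))"
  using assms
proof (induction k arbitrary: A)
  case (Suc k)
  have [measurable]: "(\<lambda>x. A x (i, j)) \<in> borel_measurable N" if "i \<le> k" "j \<le> k" for i j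
    using Suc.prems(1)[of i j] that by simp
  have [measurable]: "Measurable.pred N (\<lambda>x. posdef k (schur k (A x)))"
    by (rule Suc.IH) (use Suc.prems in \<open>auto simp: schur_def hermitian_schur[unfolded schur_def]\<close>)
  have "Measurable.pred N (\<lambda>x. 0 < Re (A x (k, k)) \<and> posdef k (schur k (A x)))"
    by measurable
  thus ?case
    by (rule measurable_cong[THEN iffD1, rotated]) (use Suc.prems(2) in \<open>simp add: posdef_Suc\<close>)
qed simp

lemma hermitian_hmat: "hermitian k (hmat k x)"
  unfolding hermitian_def hmat_def herm_of_def by (auto simp: complex_eq_iff)

lemma pred_posdef_hmat [measurable (raw)]:
  assumes X: "X \<in> N \<rightarrow>\<^sub>M leb (sq k)"
  shows "Measurable.pred N (\<lambda>x. posdef k (hmat k (X x)))"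
proof (rule pred_posdef)
  show "(\<lambda>x. hmat k (X x) (i, j)) \<in> borel_measurable N" for i j
    using measurable_PiM_comp[OF measurable_hmat[OF X], of "(i, j)"] by simp
qed (rule hermitian_hmat)

lemma measurable_nn_integral_leb:
  assumes "finite J" "case_prod f \<in> borel_measurable (N \<Otimes>\<^sub>M leb J)"
  shows "(\<lambda>x. \<integral>\<^sup>+y. f x y \<partial>leb J) \<in> borel_measurable N"
  by (rule sigma_finite_measure.borel_measurable_nn_integral[OF lb.sigma_finite[OF assms(1)] assms(2)])

lemmas measurable_nn_integral_sq [measurable (raw)] =
  measurable_nn_integral_leb[where J = "sq k" for k, OF finite_cartesian_product[OF finite_lessThan finite_lessThan]]

lemmas measurable_nn_integral_lastcol [measurable (raw)] =
  measurable_nn_integral_leb[where J = "lastcol k" for k, OF finite_cartesian_product[OF finite_lessThan finite.insertI[OF finite.emptyI]]]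

text \<open>Column rotations of a row need a nonzero last entry, and this discards only a null
  set.\<close>

lemma AE_leb_nonzero:
  assumes "finite J" "e \<in> J"
  shows "AE v in leb J. v e \<noteq> (0 :: 'a :: euclidean_space)"
proof -
  have J: "J = insert e (J - {e})" using assms by auto
  have "(\<integral>\<^sup>+v. indicator {0 :: 'a} (v e) \<partial>leb (insert e (J - {e}))) =
     (\<integral>\<^sup>+v. (\<integral>\<^sup>+y. indicator {0 :: 'a} ((v(e := y)) e) \<partial>lborel) \<partial>leb (J - {e}))"
    by (rule lb.product_nn_integral_insert) (use assms in auto)
  also have "\<dots> = 0" by simp
  finally have "(\<integral>\<^sup>+v. indicator {0 :: 'a} (v e) \<partial>leb J) = 0"
    using assms(2) by (simp add: insert_absorb)
  hence "AE v in leb J. indicator {0 :: 'a} (v e) = (0 :: ennreal)"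
    by (subst (asm) nn_integral_0_iff_AE) (use assms in auto)
  thus ?thesis by eventually_elim (auto split: split_indicator_asm)
qed

section \<open>Clearing the last row by unitary column rotations\<close>

abbreviation lastrow :: "nat \<Rightarrow> (nat \<times> nat) set" where "lastrow k \<equiv> {k} \<times> {..<Suc k}"
abbreviation toprows :: "nat \<Rightarrow> (nat \<times> nat) set" where "toprows k \<equiv> {..<k} \<times> {..<Suc k}"

definition join_row :: "nat \<Rightarrow> (nat \<times> nat \<Rightarrow> complex) \<Rightarrow> (nat \<times> nat \<Rightarrow> complex) \<Rightarrow> nat \<times> nat \<Rightarrow> complex" where
  "join_row k v X = (\<lambda>(i, j). if i = k then v (i, j) else X (i, j))"

lemma measurable_gram_join_row [measurable (raw)]:
  assumes v: "\<And>l. l \<le> k \<Longrightarrow> (\<lambda>x. v x (k, l)) \<in> borel_measurable N" and X: "X \<in> N \<rightarrow>\<^sub>M leb (toprows k)"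
  shows "(\<lambda>x. gram (Suc k) (join_row k (v x) (X x))) \<in> N \<rightarrow>\<^sub>M matM"
proof (rule measurable_matM)
  have [measurable]: "(\<lambda>x. X x (i, l)) \<in> borel_measurable N" if "i < k" "l \<le> k" for i l
    using measurable_PiM_comp[OF X, of "(i, l)"] that by simp
  have [measurable]: "(\<lambda>x. join_row k (v x) (X x) (i, l)) \<in> borel_measurable N" if "i \<le> k" "l \<le> k" for i l
    using that v by (cases "i = k") (auto simp: join_row_def)
  show "(\<lambda>x. gram (Suc k) (join_row k (v x) (X x)) (i, j)) \<in> borel_measurable N" for i j
    unfolding gram_def by (cases "i < Suc k \<and> j < Suc k") (auto intro!: borel_measurable_sum borel_measurable_times)
qed

text \<open>A unitary rotation of the columns \<open>j\<close> and \<open>k\<close>, applied to all rows, preserves the Gram matrix and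
  Lebesgue measure on the other rows, and can be chosen to clear the entry \<open>j\<close> of the last row.\<close>
lemma gram_rotate:
  assumes j: "j < k" and a: "a = v (k, j)" and b: "b = v (k, k)" "b \<noteq> 0"
    and r: "r = sqrt ((cmod a)\<^sup>2 + (cmod b)\<^sup>2)"
    and f [measurable]: "f \<in> borel_measurable matM"
  shows "(\<integral>\<^sup>+X. f (gram (Suc k) (join_row k v X)) \<partial>leb (toprows k)) =
    (\<integral>\<^sup>+X. f (gram (Suc k) (join_row k (v((k, j) := 0, (k, k) := of_real r)) X)) \<partial>leb (toprows k))"
proof -
  \<comment> \<open>\<open>R n\<close> rotates only the first \<open>n\<close> rows, so that
    invariance of the measure follows by induction with one planar rotation per row.\<close>
  define R where "R n X = (\<lambda>(i, l). if i < n \<and> l = k then (cnj a * X (i, j) + cnj b * X (i, k)) / of_real r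
     else if i < n \<and> l = j then (b * X (i, j) - a * X (i, k)) / of_real r else X (i, l))" for n and X :: "nat \<times> nat \<Rightarrow> complex"
  have r0: "r > 0" unfolding r using b by (auto intro!: add_nonneg_pos)
  have r2: "of_real r * of_real r = a * cnj a + b * cnj b"
    unfolding r by (simp add: complex_norm_square[symmetric] flip: of_real_mult)
  have inv: "(\<integral>\<^sup>+X. F (R n X) \<partial>leb (toprows k)) = (\<integral>\<^sup>+X. F X \<partial>leb (toprows k))"
    if "n \<le> k" "F \<in> borel_measurable (leb (toprows k))" for n F
    using that
  proof (induction n arbitrary: F)
    case 0
    thus ?case by (simp add: R_def)
  next
    case (Suc n)
    note [measurable] = Suc.prems(2)
    define T where "T x = x((n, j) := (b * x (n, j) - a * x (n, k)) / of_real r, (n, k) := (cnj a * x (n, j) + cnj b * x (n, k)) / of_real r)"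
      for x :: "nat \<times> nat \<Rightarrow> complex"
    have [measurable]: "T \<in> leb (toprows k) \<rightarrow>\<^sub>M leb (toprows k)"
    proof (rule measurable_PiM_single')
      fix e assume e: "e \<in> toprows k"
      have [measurable]: "(\<lambda>x. x (n, j)) \<in> borel_measurable (leb (toprows k))" "(\<lambda>x. x (n, k)) \<in> borel_measurable (leb (toprows k))"
        "(\<lambda>x. x e) \<in> borel_measurable (leb (toprows k))"
        using Suc.prems(1) j e by auto
      show "(\<lambda>x. T x e) \<in> leb (toprows k) \<rightarrow>\<^sub>M lborel"
        unfolding T_def by (cases "e = (n, k)"; cases "e = (n, j)") auto
    qed (use Suc.prems(1) j in \<open>auto simp: T_def space_PiM PiE_iff extensional_def\<close>)
    have RT: "R (Suc n) X = T (R n X)" for X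
      unfolding R_def T_def using j by (auto simp: fun_eq_iff less_Suc_eq)
    have "(\<integral>\<^sup>+X. F (R (Suc n) X) \<partial>leb (toprows k)) = (\<integral>\<^sup>+X. F (T X) \<partial>leb (toprows k))"
      unfolding RT by (rule Suc.IH) (use Suc.prems in auto)
    also have "\<dots> = (\<integral>\<^sup>+X. F X \<partial>leb (toprows k))"
      unfolding T_def by (rule nn_integral_leb_rotate) (use Suc.prems j b r in auto)
    finally show ?case .
  qed
  define v' where "v' = v((k, j) := 0, (k, k) := of_real r)"
  \<comment> \<open>The formula holds for the row \<open>i = k\<close> too: rotating (a, b) gives
    (0, r), which is how \<open>v'\<close> was defined.\<close>
  have row: "join_row k v' (R k X) (i, l) =
      (if l = k then (cnj a * join_row k v X (i, j) + cnj b * join_row k v X (i, k)) / of_real r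
       else if l = j then (b * join_row k v X (i, j) - a * join_row k v X (i, k)) / of_real r
       else join_row k v X (i, l))" if "i \<le> k" for X i l
    using that j a b r0 r2 by (auto simp: join_row_def v'_def R_def field_simps)
  have gr: "gram (Suc k) (join_row k v' (R k X)) = gram (Suc k) (join_row k v X)" for X
  proof -
    have "(\<Sum>l<Suc k. join_row k v' (R k X) (i, l) * cnj (join_row k v' (R k X) (i', l))) =
        (\<Sum>l<Suc k. join_row k v X (i, l) * cnj (join_row k v X (i', l)))" if "i \<le> k" "i' \<le> k" for i i'
    proof -
      have split: "(\<Sum>l<Suc k. g l) = (\<Sum>l\<in>{..<k} - {j}. g l) + (g j + g k)" for g :: "nat \<Rightarrow> complex"
        using j by (simp add: sum.remove[of "{..<k}" j] add.commute add.left_commute)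
      define s where "s = join_row k v X (i, j)"
      define t where "t = join_row k v X (i, k)"
      define s' where "s' = join_row k v X (i', j)"
      define t' where "t' = join_row k v X (i', k)"
      have "((b * s - a * t) * cnj (b * s' - a * t') + (cnj a * s + cnj b * t) * cnj (cnj a * s' + cnj b * t'))
          = (s * cnj s' + t * cnj t') * (of_real r * of_real r)"
        unfolding r2 by (simp add: algebra_simps)
      hence "(b * s - a * t) / of_real r * cnj ((b * s' - a * t') / of_real r) +
         (cnj a * s + cnj b * t) / of_real r * cnj ((cnj a * s' + cnj b * t') / of_real r) = s * cnj s' + t * cnj t'"
        using r0 by (simp add: nonzero_divide_eq_eq flip: add_divide_distrib)
      hence "join_row k v' (R k X) (i, j) * cnj (join_row k v' (R k X) (i', j)) + join_row k v' (R k X) (i, k) * cnj (join_row k v' (R k X) (i', k))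
         = join_row k v X (i, j) * cnj (join_row k v X (i', j)) + join_row k v X (i, k) * cnj (join_row k v X (i', k))"
        using j that by (simp add: row s_def t_def s'_def t'_def)
      moreover have "(\<Sum>l\<in>{..<k} - {j}. join_row k v' (R k X) (i, l) * cnj (join_row k v' (R k X) (i', l))) =
         (\<Sum>l\<in>{..<k} - {j}. join_row k v X (i, l) * cnj (join_row k v X (i', l)))"
        using that by (intro sum.cong) (auto simp: row)
      ultimately show ?thesis unfolding split by simp
    qed
    thus ?thesis by (auto simp: gram_def fun_eq_iff less_Suc_eq_le)
  qed
  have "(\<integral>\<^sup>+X. f (gram (Suc k) (join_row k v X)) \<partial>leb (toprows k)) =
     (\<integral>\<^sup>+X. f (gram (Suc k) (join_row k v' (R k X))) \<partial>leb (toprows k))"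
    by (simp only: gr)
  also have "\<dots> = (\<integral>\<^sup>+X. f (gram (Suc k) (join_row k v' X)) \<partial>leb (toprows k))"
    by (rule inv) (simp, measurable)
  finally show ?thesis unfolding v'_def .
qed


lemma sum_lastrow: "(\<Sum>e\<in>lastrow k. g e) = (\<Sum>l<Suc k. g (k, l))"
  by (rule sum.reindex_bij_witness[of _ "\<lambda>l. (k, l)" snd]) auto

text \<open>One rotation per cleared column. Each keeps the squared length of the row and replaces
  its last entry by a positive number, so the next rotation is admissible.\<close>

lemma join_row_clear_aux:
  assumes f: "f \<in> borel_measurable matM" and "v (k, k) \<noteq> 0" "m \<le> k"
  shows "\<exists>v'. v' (k, k) \<noteq> 0 \<and> (\<forall>l<m. v' (k, l) = 0) \<and>
    (\<Sum>e\<in>lastrow k. (cmod (v' e))\<^sup>2) = (\<Sum>e\<in>lastrow k. (cmod (v e))\<^sup>2) \<and>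
    (\<integral>\<^sup>+X. f (gram (Suc k) (join_row k v X)) \<partial>leb (toprows k)) =
    (\<integral>\<^sup>+X. f (gram (Suc k) (join_row k v' X)) \<partial>leb (toprows k))"
  using assms(3)
proof (induction m)
  case 0
  thus ?case using assms by blast
next
  case (Suc m)
  then obtain v' where v': "v' (k, k) \<noteq> 0" "\<forall>l<m. v' (k, l) = 0"
    "(\<Sum>e\<in>lastrow k. (cmod (v' e))\<^sup>2) = (\<Sum>e\<in>lastrow k. (cmod (v e))\<^sup>2)"
    "(\<integral>\<^sup>+X. f (gram (Suc k) (join_row k v X)) \<partial>leb (toprows k)) =
     (\<integral>\<^sup>+X. f (gram (Suc k) (join_row k v' X)) \<partial>leb (toprows k))"
    by auto
  define r where "r = sqrt ((cmod (v' (k, m)))\<^sup>2 + (cmod (v' (k, k)))\<^sup>2)"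
  have r0: "r > 0" unfolding r_def using v'(1) by (auto intro!: add_nonneg_pos)
  define u where "u = v'((k, m) := 0, (k, k) := of_real r)"
  have mk: "m < k" using Suc.prems by simp
  have split: "(\<Sum>l<Suc k. g l) = (\<Sum>l\<in>{..<k} - {m}. g l) + (g m + g k)" for g :: "nat \<Rightarrow> real"
    using mk by (simp add: sum.remove[of "{..<k}" m])
  have "(\<Sum>e\<in>lastrow k. (cmod (u e))\<^sup>2) = (\<Sum>e\<in>lastrow k. (cmod (v' e))\<^sup>2)"
    unfolding sum_lastrow split u_def using mk by (simp add: r_def)
  moreover have "(\<integral>\<^sup>+X. f (gram (Suc k) (join_row k v' X)) \<partial>leb (toprows k)) =
     (\<integral>\<^sup>+X. f (gram (Suc k) (join_row k u X)) \<partial>leb (toprows k))"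
    unfolding u_def by (rule gram_rotate[OF mk refl refl v'(1) r_def f])
  moreover have "u (k, k) \<noteq> 0" "\<forall>l<Suc m. u (k, l) = 0"
    using r0 v'(2) mk by (auto simp: u_def less_Suc_eq)
  ultimately show ?case using v'(3,4) by (intro exI[of _ u]) auto
qed

text \<open>After clearing, the last row is \<open>c\<close> in the last place with |c|^2 = p. The
  last column of the Gram matrix is then \<open>cnj c\<close> times the last column of
  \<open>X\<close>, and the other columns of \<open>X\<close> form a smaller square matrix.
  Rescaling the \<open>k\<close> entries of that column has Jacobian \<open>p ^ k\<close>.\<close>

lemma nn_integral_gram_join_row:
  assumes f [measurable]: "f \<in> borel_measurable matM" and v: "v (k, k) \<noteq> 0"
    and p: "p = (\<Sum>e\<in>lastrow k. (cmod (v e))\<^sup>2)"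
  shows "ennreal (p ^ k) * (\<integral>\<^sup>+X. f (gram (Suc k) (join_row k v X)) \<partial>leb (toprows k)) =
    (\<integral>\<^sup>+w. \<integral>\<^sup>+X. f (blk k (gram k X) w p) \<partial>leb (sq k) \<partial>leb (lastcol k))"
proof -
  obtain v' where v': "v' (k, k) \<noteq> 0" "\<forall>l<k. v' (k, l) = 0" "(\<Sum>e\<in>lastrow k. (cmod (v' e))\<^sup>2) = p"
    and eq: "(\<integral>\<^sup>+X. f (gram (Suc k) (join_row k v X)) \<partial>leb (toprows k)) =
     (\<integral>\<^sup>+X. f (gram (Suc k) (join_row k v' X)) \<partial>leb (toprows k))"
    using join_row_clear_aux[where f = f and v = v and k = k and m = k] f v p by auto
  define c where "c = v' (k, k)"
  have pc: "p = (cmod c)\<^sup>2"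
    using v'(2) unfolding v'(3)[symmetric] sum_lastrow by (simp add: c_def)
  have pc': "complex_of_real p = c * cnj c"
    unfolding pc by (rule complex_norm_square)
  have p0: "p > 0" using v'(1) by (simp add: pc c_def)
  have rows: "toprows k = lastcol k \<union> sq k" by auto
  have m: "(\<lambda>X. f (gram (Suc k) (join_row k v' X))) \<in> borel_measurable (leb (toprows k))"
    by measurable
  have "(\<integral>\<^sup>+X. f (gram (Suc k) (join_row k v' X)) \<partial>leb (toprows k)) =
    (\<integral>\<^sup>+y. \<integral>\<^sup>+X. f (gram (Suc k) (join_row k v' (merge (lastcol k) (sq k) (y, X)))) \<partial>leb (sq k) \<partial>leb (lastcol k))"
    unfolding rows
    by (rule lb.product_nn_integral_fold) (use m[unfolded rows] in auto)
  also have "\<dots> = (\<integral>\<^sup>+y. \<integral>\<^sup>+X. f (blk k (gram k X) (\<lambda>e\<in>lastcol k. cnj c * y e) p) \<partial>leb (sq k) \<partial>leb (lastcol k))"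
  proof (intro nn_integral_cong arg_cong[of _ _ f] ext)
    fix y X :: "nat \<times> nat \<Rightarrow> complex" and e :: "nat \<times> nat"
    obtain i j where e: "e = (i, j)" by (cases e)
    show "gram (Suc k) (join_row k v' (merge (lastcol k) (sq k) (y, X))) e =
       blk k (gram k X) (\<lambda>e\<in>lastcol k. cnj c * y e) p e"
      using v'(1,2) p0 unfolding e
      by (auto simp: gram_def blk_def join_row_def merge_def pc' c_def[symmetric] less_Suc_eq)
  qed
  finally have 1: "(\<integral>\<^sup>+X. f (gram (Suc k) (join_row k v' X)) \<partial>leb (toprows k)) =
    (\<integral>\<^sup>+y. \<integral>\<^sup>+X. f (blk k (gram k X) (\<lambda>e\<in>lastcol k. cnj c * y e) p) \<partial>leb (sq k) \<partial>leb (lastcol k))" .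
  have "(\<integral>\<^sup>+w. \<integral>\<^sup>+X. f (blk k (gram k X) w p) \<partial>leb (sq k) \<partial>leb (lastcol k)) =
    ennreal ((cmod (cnj c))\<^sup>2) ^ card (lastcol k) *
      (\<integral>\<^sup>+y. \<integral>\<^sup>+X. f (blk k (gram k X) (\<lambda>e\<in>lastcol k. cnj c * y e) p) \<partial>leb (sq k) \<partial>leb (lastcol k))"
    by (rule nn_integral_leb_scale_complex) (use v'(1) in \<open>auto simp: c_def\<close>)
  thus ?thesis
    unfolding eq 1 using p0 by (simp add: pc ennreal_power)
qed

proposition nn_integral_gram_Suc:
  assumes f [measurable]: "f \<in> borel_measurable matM"
  shows "(\<integral>\<^sup>+Y. f (gram (Suc k) Y) \<partial>leb (sq (Suc k))) = ennreal (pi ^ Suc k / fact k) *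
    (\<integral>\<^sup>+p. indicator {0<..} p * (\<integral>\<^sup>+w. \<integral>\<^sup>+X. f (blk k (gram k X) w p) \<partial>leb (sq k) \<partial>leb (lastcol k)) \<partial>lborel)"
proof -
  define \<Phi> where "\<Phi> p = (\<integral>\<^sup>+w. \<integral>\<^sup>+X. f (blk k (gram k X) w p) \<partial>leb (sq k) \<partial>leb (lastcol k))" for p
  have [measurable]: "\<Phi> \<in> borel_measurable borel"
    unfolding \<Phi>_def by measurable
  have rows: "sq (Suc k) = lastrow k \<union> toprows k" by auto
  have "(\<integral>\<^sup>+Y. f (gram (Suc k) Y) \<partial>leb (sq (Suc k))) =
    (\<integral>\<^sup>+v. \<integral>\<^sup>+X. f (gram (Suc k) (merge (lastrow k) (toprows k) (v, X))) \<partial>leb (toprows k) \<partial>leb (lastrow k))"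
    unfolding rows by (rule lb.product_nn_integral_fold) (auto simp: rows[symmetric])
  also have "\<dots> = (\<integral>\<^sup>+v. \<integral>\<^sup>+X. f (gram (Suc k) (join_row k v X)) \<partial>leb (toprows k) \<partial>leb (lastrow k))"
    by (intro nn_integral_cong arg_cong[of _ _ f] ext)
       (auto simp: gram_def merge_def join_row_def less_Suc_eq intro!: sum.cong)
  also have "\<dots> = (\<integral>\<^sup>+v. (\<lambda>p. ennreal (1 / p ^ k) * \<Phi> p) (\<Sum>e\<in>lastrow k. (cmod (v e))\<^sup>2) \<partial>leb (lastrow k))"
  proof (rule nn_integral_cong_AE, rule AE_mp[OF AE_leb_nonzero[of "lastrow k" "(k, k)"]], simp_all, intro AE_I2 impI)
    fix v :: "nat \<times> nat \<Rightarrow> complex" assume v: "v (k, k) \<noteq> 0"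
    define p where "p = (\<Sum>e\<in>lastrow k. (cmod (v e))\<^sup>2)"
    have "p > 0" unfolding p_def sum_lastrow using v
      by (intro sum_pos2[of "{..<Suc k}" k]) auto
    hence "1 = ennreal (1 / p ^ k) * ennreal (p ^ k)"
      by (subst ennreal_mult'[symmetric]) auto
    hence "(\<integral>\<^sup>+X. f (gram (Suc k) (join_row k v X)) \<partial>leb (toprows k)) = ennreal (1 / p ^ k) * \<Phi> p"
      unfolding \<Phi>_def nn_integral_gram_join_row[OF f v p_def, symmetric] mult.assoc[symmetric] by simp
    thus "(\<integral>\<^sup>+X. f (gram (Suc k) (join_row k v X)) \<partial>leb (toprows k)) =
      ennreal (1 / (\<Sum>e\<in>lastrow k. (cmod (v e))\<^sup>2) ^ k) * \<Phi> (\<Sum>e\<in>lastrow k. (cmod (v e))\<^sup>2)"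
      by (simp only: p_def)
  qed
  also have "\<dots> = ennreal (pi ^ Suc k / fact k) * (\<integral>\<^sup>+p. indicator {0<..} p * ennreal (p ^ k) * (ennreal (1 / p ^ k) * \<Phi> p) \<partial>lborel)"
    by (subst nn_integral_leb_radial) (auto simp: card_cartesian_product)
  \<comment> \<open>The radial density \<open>p ^ k\<close> of a row of length \<open>k + 1\<close>
    cancels the Jacobian \<open>p ^ k\<close> of the column rescaling. This balance is special to
    square matrices and leaves no power of the determinant behind.\<close>
  also have "(\<integral>\<^sup>+p. indicator {0<..} p * ennreal (p ^ k) * (ennreal (1 / p ^ k) * \<Phi> p) \<partial>lborel) = (\<integral>\<^sup>+p. indicator {0<..} p * \<Phi> p \<partial>lborel)"
  proof (rule nn_integral_cong)
    fix p :: real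
    show "indicator {0<..} p * ennreal (p ^ k) * (ennreal (1 / p ^ k) * \<Phi> p) = indicator {0<..} p * \<Phi> p"
    proof (cases "p > 0")
      case True
      hence "ennreal (p ^ k) * ennreal (1 / p ^ k) = 1"
        by (subst ennreal_mult'[symmetric]) auto
      thus ?thesis by (simp add: mult.assoc[symmetric]) (simp add: mult.assoc)
    qed simp
  qed
  finally show ?thesis unfolding \<Phi>_def .
qed

section \<open>Schur coordinates on the Hermitian side\<close>

lemma schur_blk: "p \<noteq> 0 \<Longrightarrow> i < k \<Longrightarrow> j < k \<Longrightarrow> schur k (blk k S w p) (i, j) = S (i, j)"
  by (simp add: schur_def blk_def)

lemma hermitian_blk: "hermitian k S \<Longrightarrow> hermitian (Suc k) (blk k S w p)"
  unfolding hermitian_def[of "Suc k"] by (auto simp: blk_def less_Suc_eq hermitianD)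

lemma posdef_blk:
  assumes "hermitian k S"
  shows "posdef (Suc k) (blk k S w p) \<longleftrightarrow> 0 < p \<and> posdef k S"
proof -
  have "posdef k (schur k (blk k S w p)) \<longleftrightarrow> posdef k S" if "p > 0"
    by (rule posdef_cong) (use that in \<open>simp add: schur_blk\<close>)
  moreover have "blk k S w p (k, k) = of_real p" by (simp add: blk_def)
  ultimately show ?thesis unfolding posdef_Suc[OF hermitian_blk[OF assms]] by auto
qed

lemma cdet_blk:
  assumes "p \<noteq> 0"
  shows "cdet (Suc k) (blk k S w p) = of_real p * cdet k S"
proof -
  have "blk k S w p (k, k) = of_real p" by (simp add: blk_def)
  moreover have "cdet k (schur k (blk k S w p)) = cdet k S"
    by (rule cdet_cong) (use assms in \<open>simp add: schur_blk\<close>)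
  ultimately show ?thesis using cdet_schur[of "blk k S w p" k] assms by simp
qed

text \<open>For fixed \<open>w\<close> and \<open>p > 0\<close>, replacing the top left block by the
  Schur complement is a translation, so Lebesgue measure is unchanged. For \<open>p \<le> 0\<close>
  no such block matrix is positive definite and both sides vanish.\<close>

lemma nn_integral_hmat_blk:
  assumes F [measurable]: "F \<in> borel_measurable matM"
    and F0: "\<And>S. hermitian (Suc k) S \<Longrightarrow> \<not> posdef (Suc k) S \<Longrightarrow> F S = 0"
    and w: "w \<in> space (leb (lastcol k))"
  shows "(\<integral>\<^sup>+x. F (blk k (\<lambda>e. hmat k x e - w (fst e, k) * cnj (w (snd e, k)) / of_real p) w p) \<partial>leb (sq k)) =
    indicator {0<..} p * (\<integral>\<^sup>+x. F (blk k (hmat k x) w p) \<partial>leb (sq k))"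
proof (cases "p > 0")
  case True
  \<comment> \<open>The translation by the rank one matrix of \<open>w\<close>, divided by
    \<open>p\<close>, in the real coordinates of \<open>herm_of\<close>: real parts on and above the
    diagonal, imaginary parts of the mirrored entry below.\<close>
  define t :: "nat \<times> nat \<Rightarrow> real" where
    "t = (\<lambda>(i, j). if i \<le> j then Re (w (i, k) * cnj (w (j, k))) / p else Im (w (j, k) * cnj (w (i, k))) / p)"
  have h: "hmat k (\<lambda>e\<in>sq k. t e + 1 * x e) (i, j) = hmat k x (i, j) + w (i, k) * cnj (w (j, k)) / of_real p"
    if "i < k" "j < k" for x i j
    using that
    by (cases i j rule: linorder_cases)
      (auto simp: hmat_def herm_of_def t_def complex_eq_iff Re_divide_of_real Im_divide_of_real
        diff_divide_distrib add_divide_distrib mult.commute)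
  let ?G = "\<lambda>x. F (blk k (\<lambda>e. hmat k x e - w (fst e, k) * cnj (w (snd e, k)) / of_real p) w p)"
  have [measurable]: "w \<in> space (leb (lastcol k))" by (rule w)
  have [measurable]: "(\<lambda>x e. hmat k x e - w (fst e, k) * cnj (w (snd e, k)) / of_real p) \<in> leb (sq k) \<rightarrow>\<^sub>M matM"
  proof (rule measurable_matM)
    have [measurable]: "(\<lambda>x. hmat k x e) \<in> borel_measurable (leb (sq k))" for e
      using measurable_PiM_comp[OF measurable_hmat[OF measurable_ident], of e k] by simp
    show "(\<lambda>x. hmat k x (i, j) - w (fst (i, j), k) * cnj (w (snd (i, j), k)) / of_real p) \<in> borel_measurable (leb (sq k))" for i j
      by measurable
  qed
  have "(\<integral>\<^sup>+x. ?G x \<partial>leb (sq k)) = ennreal \<bar>1\<bar> ^ card (sq k) * (\<integral>\<^sup>+x. ?G (\<lambda>e\<in>sq k. t e + 1 * x e) \<partial>leb (sq k))"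
    by (rule nn_integral_leb_affine_real) (simp_all, measurable)
  also have "(\<integral>\<^sup>+x. ?G (\<lambda>e\<in>sq k. t e + 1 * x e) \<partial>leb (sq k)) = (\<integral>\<^sup>+x. F (blk k (hmat k x) w p) \<partial>leb (sq k))"
    by (intro nn_integral_cong arg_cong[of _ _ F] ext) (auto simp only: blk_def h fst_conv snd_conv split: prod.splits if_splits; simp)
  finally show ?thesis using True by simp
next
  case False
  have hS: "hermitian k (\<lambda>e. hmat k x e - w (fst e, k) * cnj (w (snd e, k)) / of_real p)" for x
    unfolding hermitian_def by (auto simp: hermitianD[OF hermitian_hmat] mult.commute)
  from False show ?thesis
    by (subst F0) (auto simp: hermitian_blk[OF hS] posdef_blk[OF hS])
qed

text \<open>Fubini over the corner, the last column and the top left block. The result has the same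
  shape as the recursion for Gram matrices.\<close>

proposition nn_integral_hmat_Suc:
  assumes f [measurable]: "f \<in> borel_measurable matM"
  shows "(\<integral>\<^sup>+x. (if posdef (Suc k) (hmat (Suc k) x) then f (hmat (Suc k) x) else 0) \<partial>leb (sq (Suc k))) =
    (\<integral>\<^sup>+p. indicator {0<..} p * (\<integral>\<^sup>+w. \<integral>\<^sup>+x. (if posdef k (hmat k x) then f (blk k (hmat k x) w p) else 0)
      \<partial>leb (sq k) \<partial>leb (lastcol k)) \<partial>lborel)"
proof -
  define B where "B = lastcol k \<union> prod.swap ` lastcol k"
  let ?H = "\<lambda>x. if posdef (Suc k) (hmat (Suc k) x) then f (hmat (Suc k) x) else 0"
  have swap: "prod.swap ` lastcol k = {k} \<times> {..<k}" by auto
  have B: "B = lastcol k \<union> {k} \<times> {..<k}" unfolding B_def swap ..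
  have sqS: "sq (Suc k) = insert (k, k) (B \<union> sq k)" unfolding B by auto
  have fin: "finite B" unfolding B by simp
  have ni: "(k, k) \<notin> B \<union> sq k" "B \<inter> sq k = {}" unfolding B by auto
  have "?H \<in> borel_measurable (leb (sq (Suc k)))"
    by measurable
  hence [measurable]: "?H \<in> borel_measurable (leb (insert (k, k) (B \<union> sq k)))"
    by (simp only: sqS)
  have "(\<integral>\<^sup>+x. ?H x \<partial>leb (insert (k, k) (B \<union> sq k))) = (\<integral>\<^sup>+p. (\<integral>\<^sup>+x. ?H (x((k, k) := p)) \<partial>leb (B \<union> sq k)) \<partial>lborel)"
    by (rule lb.product_nn_integral_insert_rev) (use fin ni in auto)
  also have "\<dots> = (\<integral>\<^sup>+p. indicator {0<..} p * (\<integral>\<^sup>+w. \<integral>\<^sup>+x. (if posdef k (hmat k x) then f (blk k (hmat k x) w p) else 0)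
      \<partial>leb (sq k) \<partial>leb (lastcol k)) \<partial>lborel)"
  proof (rule nn_integral_cong)
    fix p :: real
    \<comment> \<open>Positive definiteness is known to be measurable only along Hermitian matrices,
      while \<open>F\<close> must be measurable on all matrices. Symmetrising from the upper
      triangle achieves this and changes nothing on Hermitian ones.\<close>
    define sym :: "(nat \<times> nat \<Rightarrow> complex) \<Rightarrow> nat \<times> nat \<Rightarrow> complex" where
      "sym S = (\<lambda>(i, j). if i < j then S (i, j) else if i = j then of_real (Re (S (i, i))) else cnj (S (j, i)))" for S
    define F where "F S = (if posdef (Suc k) (sym S) then f S else 0)" for S
    have sym: "posdef (Suc k) (sym S) \<longleftrightarrow> posdef (Suc k) S" if "hermitian (Suc k) S" for S
      by (rule posdef_cong) (use hermitianD[OF that] hermitian_diag_real[OF that] in \<open>auto simp: sym_def\<close>)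
    have "Measurable.pred matM (\<lambda>S. posdef (Suc k) (sym S))"
    proof (rule pred_posdef)
      have [measurable]: "(\<lambda>S. S e) \<in> borel_measurable matM" for e
        by measurable
      show "(\<lambda>S. sym S (i, j)) \<in> borel_measurable matM" for i j
        unfolding sym_def by (cases i j rule: linorder_cases) auto
      show "hermitian (Suc k) (sym S)" for S
        unfolding hermitian_def by (auto simp: sym_def)
    qed
    hence [measurable]: "F \<in> borel_measurable matM"
      unfolding F_def by measurable
    let ?U = "\<lambda>w. \<lambda>e\<in>B. if e \<in> lastcol k then Re (w e) else Im (w (prod.swap e))"
    have "(\<integral>\<^sup>+x. ?H (x((k, k) := p)) \<partial>leb (B \<union> sq k)) =
      (\<integral>\<^sup>+u. \<integral>\<^sup>+x. ?H ((merge B (sq k) (u, x))((k, k) := p)) \<partial>leb (sq k) \<partial>leb B)"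
      by (rule lb.product_nn_integral_fold) (use fin ni in auto)
    also have "\<dots> = (\<integral>\<^sup>+w. \<integral>\<^sup>+x. ?H ((merge B (sq k) (?U w, x))((k, k) := p)) \<partial>leb (sq k) \<partial>leb (lastcol k))"
    proof (rule nn_integral_leb_complex_real[of "lastcol k", folded B_def])
      have "(\<lambda>x. ?H (x((k, k) := p))) \<in> borel_measurable (leb (B \<union> sq k))"
        by measurable
      hence "(\<lambda>z. ?H ((merge B (sq k) z)((k, k) := p))) \<in> borel_measurable (leb B \<Otimes>\<^sub>M leb (sq k))"
        by (rule measurable_compose[OF measurable_merge])
      thus "(\<lambda>u. \<integral>\<^sup>+x. ?H ((merge B (sq k) (u, x))((k, k) := p)) \<partial>leb (sq k)) \<in> borel_measurable (leb B)"
        by (intro measurable_nn_integral_sq) (simp only: case_prod_beta' prod.collapse)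
    qed (auto simp: B_def)
    also have "\<dots> = (\<integral>\<^sup>+w. indicator {0<..} p * (\<integral>\<^sup>+x. (if posdef k (hmat k x) then f (blk k (hmat k x) w p) else 0) \<partial>leb (sq k)) \<partial>leb (lastcol k))"
    proof (rule nn_integral_cong)
      fix w :: "nat \<times> nat \<Rightarrow> complex" assume w: "w \<in> space (leb (lastcol k))"
      let ?S = "\<lambda>x e. hmat k x e - w (fst e, k) * cnj (w (snd e, k)) / of_real p"
      have eq: "hmat (Suc k) ((merge B (sq k) (?U w, x))((k, k) := p)) = blk k (?S x) w p" for x
        unfolding B
        by (rule ext) (auto simp: hmat_def blk_def merge_def herm_of_def less_Suc_eq complex_eq_iff)
      have "hermitian (Suc k) (blk k (?S x) w p)" for x
        using hermitian_hmat[of "Suc k"] unfolding eq[symmetric] .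
      hence "(\<integral>\<^sup>+x. ?H ((merge B (sq k) (?U w, x))((k, k) := p)) \<partial>leb (sq k)) =
          (\<integral>\<^sup>+x. F (blk k (?S x) w p) \<partial>leb (sq k))"
        unfolding eq by (simp add: F_def sym)
      also have "\<dots> = indicator {0<..} p * (\<integral>\<^sup>+x. F (blk k (hmat k x) w p) \<partial>leb (sq k))"
        by (rule nn_integral_hmat_blk[OF \<open>F \<in> borel_measurable matM\<close> _ w]) (auto simp: F_def sym)
      also have "\<dots> = indicator {0<..} p * (\<integral>\<^sup>+x. (if posdef k (hmat k x) then f (blk k (hmat k x) w p) else 0) \<partial>leb (sq k))"
      proof (cases "p > 0")
        case True
        have "F (blk k (hmat k x) w p) = (if posdef k (hmat k x) then f (blk k (hmat k x) w p) else 0)" for x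
          using True by (simp add: F_def sym hermitian_blk hermitian_hmat posdef_blk)
        thus ?thesis by simp
      qed simp
      finally show "(\<integral>\<^sup>+x. ?H ((merge B (sq k) (?U w, x))((k, k) := p)) \<partial>leb (sq k)) =
        indicator {0<..} p * (\<integral>\<^sup>+x. (if posdef k (hmat k x) then f (blk k (hmat k x) w p) else 0) \<partial>leb (sq k))" .
    qed
    also have "\<dots> = indicator {0<..} p * (\<integral>\<^sup>+w. \<integral>\<^sup>+x. (if posdef k (hmat k x) then f (blk k (hmat k x) w p) else 0)
      \<partial>leb (sq k) \<partial>leb (lastcol k))"
      by (rule nn_integral_cmult) measurable
    finally show "(\<integral>\<^sup>+x. ?H (x((k, k) := p)) \<partial>leb (B \<union> sq k)) = indicator {0<..} p * (\<integral>\<^sup>+w. \<integral>\<^sup>+x. (if posdef k (hmat k x) then f (blk k (hmat k x) w p) else 0)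
      \<partial>leb (sq k) \<partial>leb (lastcol k))" .
  qed
  finally show ?thesis unfolding sqS .
qed

text \<open>One radial constant per row: a row of \<open>j + 1\<close> complex entries contributes
  \<open>pi ^ Suc j / fact j\<close>.\<close>

definition wishart_const :: "nat \<Rightarrow> real" where
  "wishart_const k = (\<Prod>j<k. pi ^ Suc j / fact j)"

text \<open>The two recursions differ only by a constant. For fixed \<open>w\<close> and
  \<open>p\<close> the induction hypothesis is applied to \<open>f\<close> composed with the block
  construction.\<close>

theorem nn_integral_gram_eq_hmat:
  assumes "f \<in> borel_measurable matM"
  shows "(\<integral>\<^sup>+Y. f (gram k Y) \<partial>leb (sq k)) =
    ennreal (wishart_const k) * (\<integral>\<^sup>+x. (if posdef k (hmat k x) then f (hmat k x) else 0) \<partial>leb (sq k))"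
  using assms
proof (induction k arbitrary: f)
  case 0
  have "gram 0 Y = (\<lambda>_. 0)" "hmat 0 x = (\<lambda>_. 0)" for Y x by (auto simp: gram_def hmat_def)
  thus ?case by (simp add: PiM_empty nn_integral_count_space_finite wishart_const_def)
next
  case (Suc k)
  note [measurable] = Suc.prems
  let ?G = "\<lambda>p w. \<integral>\<^sup>+X. f (blk k (gram k X) w p) \<partial>leb (sq k)"
  let ?H = "\<lambda>p w. \<integral>\<^sup>+x. (if posdef k (hmat k x) then f (blk k (hmat k x) w p) else 0) \<partial>leb (sq k)"
  have "(\<integral>\<^sup>+Y. f (gram (Suc k) Y) \<partial>leb (sq (Suc k))) = ennreal (pi ^ Suc k / fact k) *
    (\<integral>\<^sup>+p. indicator {0<..} p * (\<integral>\<^sup>+w. ?G p w \<partial>leb (lastcol k)) \<partial>lborel)"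
    by (rule nn_integral_gram_Suc) measurable
  also have "(\<integral>\<^sup>+p. indicator {0<..} p * (\<integral>\<^sup>+w. ?G p w \<partial>leb (lastcol k)) \<partial>lborel) =
      (\<integral>\<^sup>+p. ennreal (wishart_const k) * (indicator {0<..} p * (\<integral>\<^sup>+w. ?H p w \<partial>leb (lastcol k))) \<partial>lborel)"
  proof (rule nn_integral_cong)
    fix p :: real
    have "(\<integral>\<^sup>+w. ?G p w \<partial>leb (lastcol k)) = (\<integral>\<^sup>+w. ennreal (wishart_const k) * ?H p w \<partial>leb (lastcol k))"
    proof (rule nn_integral_cong)
      fix w :: "nat \<times> nat \<Rightarrow> complex" assume [measurable]: "w \<in> space (leb (lastcol k))"
      show "?G p w = ennreal (wishart_const k) * ?H p w"
        by (rule Suc.IH[of "\<lambda>S. f (blk k S w p)"]) measurable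
    qed
    also have "\<dots> = ennreal (wishart_const k) * (\<integral>\<^sup>+w. ?H p w \<partial>leb (lastcol k))"
      by (rule nn_integral_cmult) measurable
    finally show "indicator {0<..} p * (\<integral>\<^sup>+w. ?G p w \<partial>leb (lastcol k)) =
       ennreal (wishart_const k) * (indicator {0<..} p * (\<integral>\<^sup>+w. ?H p w \<partial>leb (lastcol k)))"
      by (simp only: mult.left_commute)
  qed
  also have "\<dots> = ennreal (wishart_const k) * (\<integral>\<^sup>+p. indicator {0<..} p * (\<integral>\<^sup>+w. ?H p w \<partial>leb (lastcol k)) \<partial>lborel)"
    by (rule nn_integral_cmult) measurable
  also have "(\<integral>\<^sup>+p. indicator {0<..} p * (\<integral>\<^sup>+w. ?H p w \<partial>leb (lastcol k)) \<partial>lborel) =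
    (\<integral>\<^sup>+x. (if posdef (Suc k) (hmat (Suc k) x) then f (hmat (Suc k) x) else 0) \<partial>leb (sq (Suc k)))"
    by (rule nn_integral_hmat_Suc[symmetric]) measurable
  also have "ennreal (pi ^ Suc k / fact k) * (ennreal (wishart_const k) * z) = ennreal (wishart_const (Suc k)) * z" for z
    by (subst mult.assoc[symmetric], subst ennreal_mult[symmetric])
       (auto simp: wishart_const_def prod_nonneg mult.commute)
  finally show ?case .
qed

subsection \<open>Gaussian measures\<close>

definition ctrace :: "nat \<Rightarrow> (nat \<times> nat \<Rightarrow> complex) \<Rightarrow> real" where
  "ctrace k S = Re (\<Sum>i<k. S (i, i))"

lemma measurable_cdet:
  assumes "\<And>i j. i < k \<Longrightarrow> j < k \<Longrightarrow> (\<lambda>x. A x (i, j)) \<in> borel_measurable N"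
  shows "(\<lambda>x. cdet k (A x)) \<in> borel_measurable N"
  unfolding cdet_def
  by (intro borel_measurable_sum borel_measurable_times borel_measurable_prod borel_measurable_const assms)
     (use permutes_in_image in fastforce)+

lemma measurable_cdet_matM [measurable (raw)]:
  assumes "X \<in> N \<rightarrow>\<^sub>M matM"
  shows "(\<lambda>x. cdet k (X x)) \<in> borel_measurable N"
  by (rule measurable_cdet) (use measurable_PiM_comp[OF assms] in auto)

lemma measurable_ctrace [measurable (raw)]:
  assumes "X \<in> N \<rightarrow>\<^sub>M matM"
  shows "(\<lambda>x. ctrace k (X x)) \<in> borel_measurable N"
proof -
  have [measurable]: "(\<lambda>x. X x e) \<in> borel_measurable N" for e
    using measurable_PiM_comp[OF assms, of e] by auto
  show ?thesis unfolding ctrace_def by measurable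
qed

lemma nn_integral_power_exp:
  "(\<integral>\<^sup>+p. indicator {0<..} p * ennreal (p ^ n * exp (- p)) \<partial>lborel) = ennreal (fact n)"
proof -
  have "(\<integral>\<^sup>+p. indicator {0<..} p * ennreal (p ^ n * exp (- p)) \<partial>lborel) =
     (\<integral>\<^sup>+p. ennreal (p ^ n * exp (- p)) * indicator {0..} p \<partial>lborel)"
    using AE_lborel_singleton[of 0]
    by (intro nn_integral_cong_AE, eventually_elim) (auto simp: indicator_def)
  thus ?thesis by (simp add: nn_intergal_power_times_exp_Ici)
qed

lemma nn_integral_complex_gauss:
  assumes p: "p > 0"
  shows "(\<integral>\<^sup>+z. ennreal (exp (- (cmod z)\<^sup>2 / p)) \<partial>lborel) = ennreal (pi * p)"
proof -
  have "(\<integral>\<^sup>+z. ennreal (exp (- (cmod z)\<^sup>2 / p)) \<partial>lborel) =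
     ennreal pi * (\<integral>\<^sup>+t. indicator {0<..} t * ennreal (exp (- t / p)) \<partial>lborel)"
    by (rule nn_integral_complex_radial) measurable
  also have "(\<integral>\<^sup>+t. indicator {0<..} t * ennreal (exp (- t / p)) \<partial>lborel) =
     ennreal p * (\<integral>\<^sup>+t. indicator {0<..} t * ennreal (t ^ 0 * exp (- t)) \<partial>lborel)"
    using p
    by (subst nn_integral_real_affine[where c = p and t = 0])
       (auto intro!: arg_cong2[of _ _ _ _ "(*)"] nn_integral_cong simp: indicator_def zero_less_mult_iff)
  finally show ?thesis unfolding nn_integral_power_exp using p by (simp flip: ennreal_mult')
qed

lemma ctrace_blk:
  assumes "p \<noteq> 0"
  shows "ctrace (Suc k) (blk k S w p) = ctrace k S + p + (\<Sum>e\<in>lastcol k. (cmod (w e))\<^sup>2 / p)"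
proof -
  have "(\<Sum>e\<in>lastcol k. (cmod (w e))\<^sup>2 / p) = (\<Sum>i<k. (cmod (w (i, k)))\<^sup>2 / p)"
    by (rule sum.reindex_bij_witness[of _ "\<lambda>i. (i, k)" fst]) auto
  moreover have "Re (w (i, k) * cnj (w (i, k)) / of_real p) = (cmod (w (i, k)))\<^sup>2 / p" for i
    by (simp add: complex_norm_square[symmetric] flip: of_real_power)
  ultimately show ?thesis
    using assms by (simp add: ctrace_def blk_def sum.distrib)
qed

text \<open>The complex matrix gamma integral. In Schur coordinates the determinant is
  \<open>p\<close> times the smaller one and the trace gains \<open>p\<close> plus the squared norm
  of \<open>w\<close> divided by \<open>p\<close>. The Gaussian integral over \<open>w\<close> gives
  \<open>(pi * p) ^ k\<close>, and the one over \<open>p\<close> then gives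
  \<open>fact (N + k)\<close>.\<close>

lemma nn_integral_posdef_det_exp:
  "(\<integral>\<^sup>+x. (if posdef k (hmat k x) then ennreal (Re (cdet k (hmat k x)) ^ N * exp (- ctrace k (hmat k x))) else 0) \<partial>leb (sq k))
    = ennreal (\<Prod>j<k. pi ^ j * fact (N + j))"
proof (induction k)
  case 0
  thus ?case by (simp add: PiM_empty nn_integral_count_space_finite ctrace_def)
next
  case (Suc k)
  define J where "J = ennreal (\<Prod>j<k. pi ^ j * fact (N + j))"
  have "(\<integral>\<^sup>+x. (if posdef (Suc k) (hmat (Suc k) x) then ennreal (Re (cdet (Suc k) (hmat (Suc k) x)) ^ N * exp (- ctrace (Suc k) (hmat (Suc k) x))) else 0) \<partial>leb (sq (Suc k)))
    = (\<integral>\<^sup>+p. indicator {0<..} p * (\<integral>\<^sup>+w. \<integral>\<^sup>+x. (if posdef k (hmat k x) then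
       ennreal (Re (cdet (Suc k) (blk k (hmat k x) w p)) ^ N * exp (- ctrace (Suc k) (blk k (hmat k x) w p))) else 0)
      \<partial>leb (sq k) \<partial>leb (lastcol k)) \<partial>lborel)"
    by (rule nn_integral_hmat_Suc) measurable
  also have "\<dots> = (\<integral>\<^sup>+p. ennreal (pi ^ k) * J * (indicator {0<..} p * ennreal (p ^ (N + k) * exp (- p))) \<partial>lborel)"
  proof (rule nn_integral_cong)
    fix p :: real
    show "indicator {0<..} p * (\<integral>\<^sup>+w. \<integral>\<^sup>+x. (if posdef k (hmat k x) then
       ennreal (Re (cdet (Suc k) (blk k (hmat k x) w p)) ^ N * exp (- ctrace (Suc k) (blk k (hmat k x) w p))) else 0)
      \<partial>leb (sq k) \<partial>leb (lastcol k)) = ennreal (pi ^ k) * J * (indicator {0<..} p * ennreal (p ^ (N + k) * exp (- p)))"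
    proof (cases "p > 0")
      case p: True
      have "(\<integral>\<^sup>+x. (if posdef k (hmat k x) then
         ennreal (Re (cdet (Suc k) (blk k (hmat k x) w p)) ^ N * exp (- ctrace (Suc k) (blk k (hmat k x) w p))) else 0) \<partial>leb (sq k))
         = ennreal (p ^ N * exp (- p)) * J * (\<Prod>e\<in>lastcol k. ennreal (exp (- (cmod (w e))\<^sup>2 / p)))" for w
      proof -
        have "(if posdef k (hmat k x) then
         ennreal (Re (cdet (Suc k) (blk k (hmat k x) w p)) ^ N * exp (- ctrace (Suc k) (blk k (hmat k x) w p))) else 0)
         = ennreal (p ^ N * exp (- p) * (\<Prod>e\<in>lastcol k. exp (- (cmod (w e))\<^sup>2 / p))) *
           (if posdef k (hmat k x) then ennreal (Re (cdet k (hmat k x)) ^ N * exp (- ctrace k (hmat k x))) else 0)" for x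
        proof -
          have "(\<Prod>e\<in>lastcol k. exp (- (cmod (w e))\<^sup>2 / p)) = exp (- (\<Sum>e\<in>lastcol k. (cmod (w e))\<^sup>2 / p))"
            by (simp add: exp_sum flip: sum_negf)
          moreover have "exp (- ctrace (Suc k) (blk k (hmat k x) w p)) =
              exp (- ctrace k (hmat k x)) * exp (- p) * exp (- (\<Sum>e\<in>lastcol k. (cmod (w e))\<^sup>2 / p))"
            using p by (simp add: ctrace_blk flip: exp_add)
          moreover have "Re (cdet (Suc k) (blk k (hmat k x) w p)) ^ N = p ^ N * Re (cdet k (hmat k x)) ^ N"
            using p by (simp add: cdet_blk power_mult_distrib)
          ultimately show ?thesis
            using p cdet_posdef[OF hermitian_hmat, of k x] by (auto simp: mult_ac simp flip: ennreal_mult)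
        qed
        hence "(\<integral>\<^sup>+x. (if posdef k (hmat k x) then
         ennreal (Re (cdet (Suc k) (blk k (hmat k x) w p)) ^ N * exp (- ctrace (Suc k) (blk k (hmat k x) w p))) else 0) \<partial>leb (sq k))
         = (\<integral>\<^sup>+x. ennreal (p ^ N * exp (- p) * (\<Prod>e\<in>lastcol k. exp (- (cmod (w e))\<^sup>2 / p))) *
           (if posdef k (hmat k x) then ennreal (Re (cdet k (hmat k x)) ^ N * exp (- ctrace k (hmat k x))) else 0) \<partial>leb (sq k))"
          by simp
        also have "\<dots> = ennreal (p ^ N * exp (- p) * (\<Prod>e\<in>lastcol k. exp (- (cmod (w e))\<^sup>2 / p))) * J"
          unfolding J_def Suc.IH[symmetric] by (rule nn_integral_cmult) measurable
        also have "\<dots> = ennreal (p ^ N * exp (- p)) * J * (\<Prod>e\<in>lastcol k. ennreal (exp (- (cmod (w e))\<^sup>2 / p)))"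
          using p by (simp add: ennreal_mult prod_nonneg prod_ennreal mult_ac)
        finally show ?thesis .
      qed
      hence "(\<integral>\<^sup>+w. \<integral>\<^sup>+x. (if posdef k (hmat k x) then
         ennreal (Re (cdet (Suc k) (blk k (hmat k x) w p)) ^ N * exp (- ctrace (Suc k) (blk k (hmat k x) w p))) else 0) \<partial>leb (sq k) \<partial>leb (lastcol k)) =
         (\<integral>\<^sup>+w. ennreal (p ^ N * exp (- p)) * J * (\<Prod>e\<in>lastcol k. ennreal (exp (- (cmod (w e))\<^sup>2 / p))) \<partial>leb (lastcol k))"
        by simp
      also have "\<dots> = ennreal (p ^ N * exp (- p)) * J * (\<integral>\<^sup>+w. (\<Prod>e\<in>lastcol k. ennreal (exp (- (cmod (w e))\<^sup>2 / p))) \<partial>leb (lastcol k))"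
        by (rule nn_integral_cmult) measurable
      also have "(\<integral>\<^sup>+w. (\<Prod>e\<in>lastcol k. ennreal (exp (- (cmod (w e))\<^sup>2 / p))) \<partial>leb (lastcol k)) = ennreal ((pi * p) ^ k)"
        by (subst lb.product_nn_integral_prod)
           (use p nn_integral_complex_gauss[OF p] in \<open>auto simp: card_cartesian_product ennreal_power\<close>)
      also have "ennreal (p ^ N * exp (- p)) * J * ennreal ((pi * p) ^ k) = ennreal (pi ^ k) * J * ennreal (p ^ (N + k) * exp (- p))"
        using p by (simp add: power_mult_distrib power_add ennreal_mult mult_ac)
      finally show ?thesis using p by simp
    qed simp
  qed
  also have "\<dots> = ennreal (pi ^ k) * J * ennreal (fact (N + k))"
    by (subst nn_integral_cmult) (auto simp: nn_integral_power_exp)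
  finally show ?case
    by (simp add: J_def prod_nonneg mult_ac flip: ennreal_mult)
qed

section \<open>Gaussian matrices and the law of their Gram matrix\<close>

lemma prob_space_std_cgauss: "prob_space std_cgauss"
proof (rule prob_spaceI)
  have "emeasure std_cgauss (space std_cgauss) = (\<integral>\<^sup>+z. ennreal (1 / pi) * ennreal (exp (- (cmod z)\<^sup>2 / 1)) \<partial>lborel)"
    by (simp add: std_cgauss_def emeasure_density flip: ennreal_mult')
  also have "\<dots> = ennreal (1 / pi) * ennreal (pi * 1)"
    using nn_integral_complex_gauss[of 1] by (subst nn_integral_cmult) auto
  also have "\<dots> = 1" by (simp flip: ennreal_mult')
  finally show "emeasure std_cgauss (space std_cgauss) = 1" .
qed

interpretation cg: prob_space std_cgauss by (rule prob_space_std_cgauss)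
interpretation cgp: product_sigma_finite "\<lambda>_. std_cgauss" by standard

lemma sets_std_cgauss [measurable_cong, simp]: "sets std_cgauss = sets borel"
  by (simp add: std_cgauss_def)

lemma nn_integral_PiM_std_cgauss:
  fixes F :: "('i \<Rightarrow> complex) \<Rightarrow> ennreal"
  assumes "finite J" "F \<in> borel_measurable (leb J)"
  shows "(\<integral>\<^sup>+x. F x \<partial>PiM J (\<lambda>_. std_cgauss)) =
    (\<integral>\<^sup>+x. (\<Prod>e\<in>J. ennreal (exp (- (cmod (x e))\<^sup>2) / pi)) * F x \<partial>leb J)"
  using assms
proof (induction J arbitrary: F rule: finite_induct)
  case empty
  thus ?case by (simp add: PiM_empty)
next
  case (insert i J)
  have sets: "sets (PiM J' (\<lambda>_. std_cgauss)) = sets (leb J')" for J' :: "'i set"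
    by (rule sets_PiM_cong) auto
  note [measurable] = insert.prems
  have mF: "F \<in> borel_measurable (PiM (insert i J) (\<lambda>_. std_cgauss))"
    using insert.prems by (simp cong: measurable_cong_sets add: sets measurable_cong_sets[OF sets refl])
  have "(\<integral>\<^sup>+x. F x \<partial>PiM (insert i J) (\<lambda>_. std_cgauss)) = (\<integral>\<^sup>+x. \<integral>\<^sup>+y. F (x(i := y)) \<partial>std_cgauss \<partial>PiM J (\<lambda>_. std_cgauss))"
    by (rule cgp.product_nn_integral_insert) (use insert mF in auto)
  also have "\<dots> = (\<integral>\<^sup>+x. \<integral>\<^sup>+y. ennreal (exp (- (cmod y)\<^sup>2) / pi) * F (x(i := y)) \<partial>lborel \<partial>PiM J (\<lambda>_. std_cgauss))"
  proof (rule nn_integral_cong)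
    fix x :: "'i \<Rightarrow> complex" assume "x \<in> space (PiM J (\<lambda>_. std_cgauss))"
    hence [measurable]: "x \<in> space (leb J)" by (simp add: space_PiM std_cgauss_def)
    show "(\<integral>\<^sup>+y. F (x(i := y)) \<partial>std_cgauss) = (\<integral>\<^sup>+y. ennreal (exp (- (cmod y)\<^sup>2) / pi) * F (x(i := y)) \<partial>lborel)"
      unfolding std_cgauss_def by (rule nn_integral_density) measurable
  qed
  also have "\<dots> = (\<integral>\<^sup>+x. (\<Prod>e\<in>J. ennreal (exp (- (cmod (x e))\<^sup>2) / pi)) *
     (\<integral>\<^sup>+y. ennreal (exp (- (cmod y)\<^sup>2) / pi) * F (x(i := y)) \<partial>lborel) \<partial>leb J)"
    by (rule insert.IH) measurable
  also have "\<dots> = (\<integral>\<^sup>+x. (\<integral>\<^sup>+y. (\<Prod>e\<in>J. ennreal (exp (- (cmod (x e))\<^sup>2) / pi)) *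
     (ennreal (exp (- (cmod y)\<^sup>2) / pi) * F (x(i := y))) \<partial>lborel) \<partial>leb J)"
    by (intro nn_integral_cong nn_integral_cmult[symmetric]) measurable
  also have "\<dots> = (\<integral>\<^sup>+x. (\<integral>\<^sup>+y. (\<Prod>e\<in>insert i J. ennreal (exp (- (cmod ((x(i := y)) e))\<^sup>2) / pi)) * F (x(i := y)) \<partial>lborel) \<partial>leb J)"
  proof -
    have "(\<Prod>e\<in>insert i J. ennreal (exp (- (cmod ((x(i := y)) e))\<^sup>2) / pi)) =
       (\<Prod>e\<in>J. ennreal (exp (- (cmod (x e))\<^sup>2) / pi)) * ennreal (exp (- (cmod y)\<^sup>2) / pi)" for x :: "'i \<Rightarrow> complex" and y
    proof -
      have "(\<Prod>e\<in>J. ennreal (exp (- (cmod ((x(i := y)) e))\<^sup>2) / pi)) = (\<Prod>e\<in>J. ennreal (exp (- (cmod (x e))\<^sup>2) / pi))"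
        using insert.hyps by (intro prod.cong) auto
      thus ?thesis by (simp only: prod.insert[OF insert.hyps(1,2)] fun_upd_same mult.commute)
    qed
    thus ?thesis by (simp only: mult.assoc)
  qed
  also have "\<dots> = (\<integral>\<^sup>+x. (\<Prod>e\<in>insert i J. ennreal (exp (- (cmod (x e))\<^sup>2) / pi)) * F x \<partial>leb (insert i J))"
    by (rule lb.product_nn_integral_insert[symmetric]) (use insert.hyps in \<open>auto simp del: prod.insert\<close>)
  finally show ?case .
qed

lemma ctrace_gram: "ctrace k (gram k X) = (\<Sum>e\<in>sq k. (cmod (X e))\<^sup>2)"
proof -
  show ?thesis
    by (simp add: ctrace_def gram_def sum.cartesian_product case_prod_beta cmod_power2)
      (simp add: power2_eq_square)
qed

text \<open>The Gaussian density depends on \<open>X\<close> only through the trace of its Gram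
  matrix, so it can be carried along as part of the integrand.\<close>

theorem nn_integral_gauss_gram:
  assumes [measurable]: "f \<in> borel_measurable matM"
  shows "(\<integral>\<^sup>+X. f (gram k X) \<partial>PiM (sq k) (\<lambda>_. std_cgauss)) = ennreal (wishart_const k / pi ^ (k * k)) *
    (\<integral>\<^sup>+x. (if posdef k (hmat k x) then ennreal (exp (- ctrace k (hmat k x))) * f (hmat k x) else 0) \<partial>leb (sq k))"
proof -
  have "(\<integral>\<^sup>+X. f (gram k X) \<partial>PiM (sq k) (\<lambda>_. std_cgauss)) =
      (\<integral>\<^sup>+X. (\<Prod>e\<in>sq k. ennreal (exp (- (cmod (X e))\<^sup>2) / pi)) * f (gram k X) \<partial>leb (sq k))"
    by (rule nn_integral_PiM_std_cgauss) simp_all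
  also have "\<dots> = (\<integral>\<^sup>+X. ennreal (1 / pi ^ (k * k)) * (ennreal (exp (- ctrace k (gram k X))) * f (gram k X)) \<partial>leb (sq k))"
    by (intro nn_integral_cong)
       (simp add: prod_ennreal prod_dividef card_cartesian_product ctrace_gram exp_sum[symmetric] sum_negf mult.assoc[symmetric]
         flip: ennreal_mult')
  also have "\<dots> = ennreal (1 / pi ^ (k * k)) * (\<integral>\<^sup>+X. ennreal (exp (- ctrace k (gram k X))) * f (gram k X) \<partial>leb (sq k))"
    by (rule nn_integral_cmult) measurable
  also have "(\<integral>\<^sup>+X. ennreal (exp (- ctrace k (gram k X))) * f (gram k X) \<partial>leb (sq k)) = ennreal (wishart_const k) *
    (\<integral>\<^sup>+x. (if posdef k (hmat k x) then ennreal (exp (- ctrace k (hmat k x))) * f (hmat k x) else 0) \<partial>leb (sq k))"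
    by (rule nn_integral_gram_eq_hmat[where f = "\<lambda>S. ennreal (exp (- ctrace k S)) * f S"]) measurable
  finally show ?thesis
    by (simp add: mult.assoc[symmetric] wishart_const_def prod_nonneg flip: ennreal_mult)
qed

subsection \<open>Wick's formula\<close>

lemma nn_integral_cgauss_power:
  "(\<integral>\<^sup>+z. ennreal (cmod z ^ (2 * n)) \<partial>std_cgauss) = ennreal (fact n)"
proof -
  have "(\<integral>\<^sup>+z. ennreal (cmod z ^ (2 * n)) \<partial>std_cgauss) =
     (\<integral>\<^sup>+z. ennreal (1 / pi) * ennreal (((cmod z)\<^sup>2) ^ n * exp (- (cmod z)\<^sup>2)) \<partial>lborel)"
    unfolding std_cgauss_def power_mult
    by (subst nn_integral_density) (auto intro!: nn_integral_cong simp: mult_ac simp flip: ennreal_mult')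
  also have "\<dots> = ennreal (1 / pi) * (\<integral>\<^sup>+z. ennreal (((cmod z)\<^sup>2) ^ n * exp (- (cmod z)\<^sup>2)) \<partial>lborel)"
    by (rule nn_integral_cmult) measurable
  also have "(\<integral>\<^sup>+z. ennreal (((cmod z)\<^sup>2) ^ n * exp (- (cmod z)\<^sup>2)) \<partial>lborel) = ennreal pi * ennreal (fact n)"
    by (subst nn_integral_complex_radial[of "\<lambda>t. ennreal (t ^ n * exp (- t))"]) (simp_all add: nn_integral_power_exp)
  finally show ?thesis by (simp add: mult.assoc[symmetric] flip: ennreal_mult')
qed

lemma integrable_cgauss_monomial:
  "integrable std_cgauss (\<lambda>z. z ^ n * cnj z ^ m)"
proof (rule integrableI_bounded)
  have "(\<integral>\<^sup>+z. ennreal (norm (z ^ n * cnj z ^ m)) \<partial>std_cgauss) \<le>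
     (\<integral>\<^sup>+z. ennreal (cmod z ^ (2 * 0)) + ennreal (cmod z ^ (2 * (n + m))) \<partial>std_cgauss)"
  proof (intro nn_integral_mono)
    fix z :: complex
    have "cmod z ^ (n + m) \<le> 1 + cmod z ^ (2 * (n + m))"
    proof (cases "cmod z \<le> 1")
      case True
      thus ?thesis using power_le_one[of "cmod z" "n + m"] by (auto intro: add_increasing2)
    next
      case False
      hence "cmod z ^ (n + m) \<le> cmod z ^ (2 * (n + m))" by (intro power_increasing) auto
      thus ?thesis by simp
    qed
    hence "ennreal (norm (z ^ n * cnj z ^ m)) \<le> ennreal (1 + cmod z ^ (2 * (n + m)))"
      by (intro ennreal_leI) (simp add: norm_mult norm_power power_add)
    also have "\<dots> = ennreal 1 + ennreal (cmod z ^ (2 * (n + m)))"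
      by (rule ennreal_plus) auto
    finally show "ennreal (norm (z ^ n * cnj z ^ m)) \<le> ennreal (cmod z ^ (2 * 0)) + ennreal (cmod z ^ (2 * (n + m)))"
      by simp
  qed
  also have "\<dots> = ennreal (fact 0) + ennreal (fact (n + m))"
    by (subst nn_integral_add) (simp_all only: nn_integral_cgauss_power, measurable)
  also have "\<dots> < \<infinity>" by simp
  finally show "(\<integral>\<^sup>+z. ennreal (norm (z ^ n * cnj z ^ m)) \<partial>std_cgauss) < \<infinity>" .
qed measurable

lemma std_cgauss_rotate:
  assumes u: "cmod u = 1"
  shows "distr std_cgauss borel ((*) u) = std_cgauss"
proof (rule measure_eqI)
  fix A assume "A \<in> sets (distr std_cgauss borel ((*) u))"
  hence A [measurable]: "A \<in> sets borel" by simp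
  have u0: "u \<noteq> 0" using u by auto
  have "emeasure (distr std_cgauss borel ((*) u)) A = (\<integral>\<^sup>+z. indicator A (u * z) \<partial>std_cgauss)"
    by (simp add: nn_integral_distr flip: nn_integral_indicator)
  also have "\<dots> = (\<integral>\<^sup>+z. ennreal (exp (- (cmod (u * z))\<^sup>2) / pi) * indicator A (u * z) \<partial>lborel)"
    unfolding std_cgauss_def by (subst nn_integral_density) (auto simp: norm_mult u)
  also have "\<dots> = (\<integral>\<^sup>+z. ennreal (exp (- (cmod z)\<^sup>2) / pi) * indicator A z \<partial>lborel)"
    by (subst (2) nn_integral_complex_affine[OF _ u0, of _ 0]) (simp_all add: u)
  also have "\<dots> = emeasure std_cgauss A"
    unfolding std_cgauss_def by (rule emeasure_density[symmetric]) auto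
  finally show "emeasure (distr std_cgauss borel ((*) u)) A = emeasure std_cgauss A" .
qed simp

definition wick :: "nat \<Rightarrow> nat \<Rightarrow> complex" where
  "wick n m = (if n = m then fact n else 0)"

lemma integral_cgauss_monomial:
  "(\<integral>z. z ^ n * cnj z ^ m \<partial>std_cgauss) = wick n m"
proof (cases "n = m")
  case True
  have "(\<integral>z. z ^ n * cnj z ^ n \<partial>std_cgauss) = (\<integral>z. complex_of_real (cmod z ^ (2 * n)) \<partial>std_cgauss)"
    by (simp only: power_mult power_mult_distrib[symmetric] complex_norm_square[symmetric] of_real_power)
  also have "\<dots> = of_real (\<integral>z. cmod z ^ (2 * n) \<partial>std_cgauss)"
    by (rule integral_complex_of_real)
  also have "(\<integral>z. cmod z ^ (2 * n) \<partial>std_cgauss) = fact n"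
    by (subst integral_eq_nn_integral) (simp_all add: nn_integral_cgauss_power)
  finally show ?thesis using True by (simp add: wick_def)
next
  case False
  define d where "d = real n - real m"
  have d: "d \<noteq> 0" using False by (simp add: d_def)
  \<comment> \<open>The angle is chosen so that \<open>u ^ n * cnj u ^ m = -1\<close>; rotation
    invariance then equates the integral with its negative.\<close>
  define u where "u = cis (pi / d)"
  let ?I = "\<integral>z. z ^ n * cnj z ^ m \<partial>std_cgauss"
  have "cis (pi / d) ^ n * cnj (cis (pi / d)) ^ m = cis (real n * (pi / d)) * cis (real m * (- (pi / d)))"
    by (simp only: cis_cnj Complex.DeMoivre)
  also have "\<dots> = cis pi"
  proof -
    have "real n * x + real m * (- x) = d * x" for x
      by (simp add: d_def algebra_simps)
    from this[of "pi / d"] show ?thesis unfolding cis_mult using d by (simp only:) simp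
  qed
  finally have u: "u ^ n * cnj u ^ m = -1" by (simp add: u_def)
  have "?I = (\<integral>z. z ^ n * cnj z ^ m \<partial>distr std_cgauss borel ((*) u))"
    by (subst std_cgauss_rotate) (simp_all add: u_def)
  also have "\<dots> = (\<integral>z. (u * z) ^ n * cnj (u * z) ^ m \<partial>std_cgauss)"
    by (rule integral_distr) measurable
  also have "\<dots> = (\<integral>z. (u ^ n * cnj u ^ m) * (z ^ n * cnj z ^ m) \<partial>std_cgauss)"
    by (simp add: power_mult_distrib mult_ac)
  also have "\<dots> = - ?I"
    unfolding u by simp
  finally have "?I = 0" by (simp add: eq_neg_iff_add_eq_0)
  thus ?thesis using False by (simp add: wick_def)
qed

text \<open>Wick contractions: \<open>E\<close> indexes the plain factors, \<open>F\<close> the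
  conjugated ones, and \<open>c\<close> and \<open>d\<close> name the Gaussian variable that a
  factor reads. Extensional functions make each matching a single element of the set.\<close>

definition pairings :: "'a set \<Rightarrow> 'b set \<Rightarrow> ('a \<Rightarrow> 'i) \<Rightarrow> ('b \<Rightarrow> 'i) \<Rightarrow> ('a \<Rightarrow> 'b) set" where
  "pairings E F c d = {M \<in> E \<rightarrow>\<^sub>E F. bij_betw M E F \<and> (\<forall>e\<in>E. d (M e) = c e)}"

lemma finite_pairings: "finite E \<Longrightarrow> finite F \<Longrightarrow> finite (pairings E F c d)"
  unfolding pairings_def by (rule finite_subset[OF _ finite_PiE]) auto

text \<open>A pairing is determined by the partner of \<open>e\<close> and by what it does on the
  rest.\<close>

lemma card_pairings_insert:
  assumes E: "finite E" "e \<notin> E" and F: "finite F"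
  shows "card (pairings (insert e E) F c d) = (\<Sum>f\<in>{f \<in> F. d f = c e}. card (pairings E (F - {f}) c d))"
proof -
  have "card (pairings (insert e E) F c d) = card (SIGMA f:{f \<in> F. d f = c e}. pairings E (F - {f}) c d)"
  proof (rule bij_betw_same_card[of "\<lambda>M. (M e, restrict M E)"], rule bij_betw_byWitness[where f' = "\<lambda>(f, M). M(e := f)"])
    show "\<forall>M\<in>pairings (insert e E) F c d. (case (M e, restrict M E) of (f, M) \<Rightarrow> M(e := f)) = M"
      using E by (auto simp: pairings_def fun_eq_iff PiE_def extensional_def)
    show "\<forall>x\<in>SIGMA f:{f \<in> F. d f = c e}. pairings E (F - {f}) c d.
       (\<lambda>M. (M e, restrict M E)) (case x of (f, M) \<Rightarrow> M(e := f)) = x"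
      using E by (auto simp: pairings_def fun_eq_iff PiE_def extensional_def)
    show "(\<lambda>M. (M e, restrict M E)) ` pairings (insert e E) F c d \<subseteq> (SIGMA f:{f \<in> F. d f = c e}. pairings E (F - {f}) c d)"
    proof safe
      fix M assume M: "M \<in> pairings (insert e E) F c d"
      hence b: "bij_betw M (insert e E) F" and d: "\<forall>x\<in>insert e E. d (M x) = c x"
        by (auto simp: pairings_def)
      show "M e \<in> F" using b by (auto simp: bij_betw_def)
      show "d (M e) = c e" using d by simp
      have "bij_betw M E (F - {M e})"
        using b E unfolding bij_betw_def by (auto simp: inj_on_def)
      thus "restrict M E \<in> pairings E (F - {M e}) c d"
        using d by (auto simp: pairings_def bij_betw_def inj_on_def)
    qed
    show "(\<lambda>(f, M). M(e := f)) ` (SIGMA f:{f \<in> F. d f = c e}. pairings E (F - {f}) c d) \<subseteq> pairings (insert e E) F c d"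
    proof safe
      fix f M assume f: "f \<in> F" "d f = c e" and M: "M \<in> pairings E (F - {f}) c d"
      hence b: "bij_betw M E (F - {f})" and ME: "M \<in> E \<rightarrow>\<^sub>E F - {f}" and d: "\<forall>x\<in>E. d (M x) = c x"
        by (auto simp: pairings_def)
      have "bij_betw (M(e := f)) E (F - {f})"
        using b by (rule bij_betw_cong[THEN iffD1, rotated]) (use E in auto)
      hence "bij_betw (M(e := f)) (insert e E) (insert f (F - {f}))"
        using E unfolding bij_betw_def by (auto simp: inj_on_def)
      moreover have "insert f (F - {f}) = F" using f by auto
      moreover have "M(e := f) \<in> insert e E \<rightarrow>\<^sub>E F"
        using ME f by (auto simp: PiE_def extensional_def)
      ultimately show "M(e := f) \<in> pairings (insert e E) F c d"
        using d f E by (auto simp: pairings_def)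
    qed
  qed
  also have "\<dots> = (\<Sum>f\<in>{f \<in> F. d f = c e}. card (pairings E (F - {f}) c d))"
    using E F by (subst card_SigmaI) (auto intro: finite_pairings)
  finally show ?thesis .
qed

text \<open>One plain factor has \<open>m\<close> possible conjugated partners. At
  \<open>m = 0\<close> the truncated difference is harmless, since the factor
  \<open>of_nat m\<close> vanishes.\<close>

lemma wick_Suc: "wick (Suc n) m = of_nat m * wick n (m - 1)"
  by (cases m) (auto simp: wick_def)

text \<open>Both sides obey the same recursion in \<open>E\<close>: removing \<open>e\<close> and
  its partner lowers both exponents of the variable \<open>c e\<close> by one and leaves the other
  variables alone.\<close>

lemma prod_wick_eq_card_pairings:
  assumes "finite E" "finite F" "finite J" "c ` E \<subseteq> J" "d ` F \<subseteq> J"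
  shows "(\<Prod>j\<in>J. wick (card {e \<in> E. c e = j}) (card {f \<in> F. d f = j})) = of_nat (card (pairings E F c d))"
  using assms
proof (induction E arbitrary: F rule: finite_induct)
  case empty
  show ?case
  proof (cases "F = {}")
    case True
    have "pairings {} {} c d = {\<lambda>_. undefined}" by (auto simp: pairings_def bij_betw_def)
    thus ?thesis using True by (simp add: wick_def)
  next
    case False
    then obtain f where f: "f \<in> F" by auto
    have "pairings {} F c d = {}" using False by (auto simp: pairings_def bij_betw_def)
    moreover have "card {f' \<in> F. d f' = d f} \<noteq> 0"
      using f empty.prems by (auto simp: card_eq_0_iff)
    hence "wick (card {e \<in> {}. c e = d f}) (card {f' \<in> F. d f' = d f}) = 0"
      by (simp add: wick_def)
    ultimately show ?thesis using f empty.prems by (auto intro!: prod_zero)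
  qed
next
  case (insert e E)
  define j where "j = c e"
  have j: "j \<in> J" using insert.prems by (auto simp: j_def)
  let ?n = "\<lambda>E i. card {e \<in> E. c e = i}" and ?m = "\<lambda>F i. card {f \<in> F. d f = i}"
  have n: "?n (insert e E) i = (if i = j then Suc (?n E i) else ?n E i)" for i
  proof (cases "i = j")
    case True
    have "{x \<in> insert e E. c x = i} = insert e {x \<in> E. c x = i}" using True by (auto simp: j_def)
    thus ?thesis using True insert.hyps by simp
  next
    case False
    hence "{x \<in> insert e E. c x = i} = {x \<in> E. c x = i}" by (auto simp: j_def)
    thus ?thesis using False by simp
  qed
  have m: "?m (F - {f}) i = (if i = j then ?m F i - 1 else ?m F i)" if "f \<in> F" "d f = j" for f i
  proof (cases "i = j")
    case True
    have "{x \<in> F - {f}. d x = i} = {x \<in> F. d x = i} - {f}" by auto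
    thus ?thesis using True that insert.prems by simp
  next
    case False
    hence "{x \<in> F - {f}. d x = i} = {x \<in> F. d x = i}" using that by auto
    thus ?thesis using False by simp
  qed
  define R where "R = (\<Prod>i\<in>J - {j}. wick (?n E i) (?m F i))"
  have "(\<Prod>i\<in>J. wick (?n (insert e E) i) (?m F i)) = wick (Suc (?n E j)) (?m F j) * R"
    unfolding R_def n using insert.prems j by (subst prod.remove[of J j]) (auto intro!: prod.cong)
  also have "\<dots> = (\<Sum>f\<in>{f \<in> F. d f = j}. wick (?n E j) (?m F j - 1) * R)"
    by (simp add: wick_Suc)
  also have "\<dots> = (\<Sum>f\<in>{f \<in> F. d f = j}. \<Prod>i\<in>J. wick (?n E i) (?m (F - {f}) i))"
  proof (rule sum.cong[OF refl])
    fix f assume "f \<in> {f \<in> F. d f = j}"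
    hence f: "f \<in> F" "d f = j" by auto
    show "wick (?n E j) (?m F j - 1) * R = (\<Prod>i\<in>J. wick (?n E i) (?m (F - {f}) i))"
      unfolding R_def m[OF f] using insert.prems j by (subst prod.remove[of J j]) (auto intro!: prod.cong)
  qed
  also have "\<dots> = (\<Sum>f\<in>{f \<in> F. d f = j}. of_nat (card (pairings E (F - {f}) c d)))"
    by (intro sum.cong refl insert.IH) (use insert.prems in auto)
  also have "\<dots> = of_nat (card (pairings (insert e E) F c d))"
    by (subst card_pairings_insert) (use insert in \<open>auto simp: j_def\<close>)
  finally show ?case .
qed

text \<open>Factors reading the same variable are collected into a monomial; independence of the
  coordinates then reduces the claim to one-variable moments.\<close>

lemma wick_formula:
  assumes "finite E" "finite F" "finite J" "c ` E \<subseteq> J" "d ` F \<subseteq> J"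
  shows "integrable (PiM J (\<lambda>_. std_cgauss)) (\<lambda>x. (\<Prod>e\<in>E. x (c e)) * (\<Prod>f\<in>F. cnj (x (d f))))" (is ?A)
    and "(\<integral>x. (\<Prod>e\<in>E. x (c e)) * (\<Prod>f\<in>F. cnj (x (d f))) \<partial>PiM J (\<lambda>_. std_cgauss)) =
      of_nat (card (pairings E F c d))" (is ?B)
proof -
  have eq: "(\<Prod>e\<in>E. x (c e)) * (\<Prod>f\<in>F. cnj (x (d f))) =
     (\<Prod>j\<in>J. x j ^ card {e \<in> E. c e = j} * cnj (x j) ^ card {f \<in> F. d f = j})" for x :: "'c \<Rightarrow> complex"
  proof -
    have "(\<Prod>e\<in>E. x (c e)) = (\<Prod>j\<in>J. \<Prod>e\<in>{e \<in> E. c e = j}. x (c e))"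
      by (rule prod.group[symmetric]) (use assms in auto)
    moreover have "(\<Prod>f\<in>F. cnj (x (d f))) = (\<Prod>j\<in>J. \<Prod>f\<in>{f \<in> F. d f = j}. cnj (x (d f)))"
      by (rule prod.group[symmetric]) (use assms in auto)
    ultimately show ?thesis by (simp add: prod.distrib)
  qed
  show ?A unfolding eq
    by (rule cgp.product_integrable_prod[where f = "\<lambda>j z. z ^ card {e \<in> E. c e = j} * cnj z ^ card {f \<in> F. d f = j}"])
       (use assms in \<open>auto intro: integrable_cgauss_monomial\<close>)
  have "(\<integral>x. (\<Prod>e\<in>E. x (c e)) * (\<Prod>f\<in>F. cnj (x (d f))) \<partial>PiM J (\<lambda>_. std_cgauss)) =
     (\<Prod>j\<in>J. \<integral>z. z ^ card {e \<in> E. c e = j} * cnj z ^ card {f \<in> F. d f = j} \<partial>std_cgauss)"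
    unfolding eq
    by (rule cgp.product_integral_prod[where f = "\<lambda>j z. z ^ card {e \<in> E. c e = j} * cnj z ^ card {f \<in> F. d f = j}"])
       (use assms in \<open>auto intro: integrable_cgauss_monomial\<close>)
  thus ?B by (simp only: integral_cgauss_monomial prod_wick_eq_card_pairings[OF assms])
qed

subsection \<open>The duality between matrix dimension and moment order\<close>

text \<open>Determinants over an arbitrary index set, because the minors below are indexed by
  subsets of a product of two intervals.\<close>

definition sdet :: "'a set \<Rightarrow> ('a \<Rightarrow> 'a \<Rightarrow> complex) \<Rightarrow> complex" where
  "sdet E M = (\<Sum>p\<in>{p. p permutes E}. of_int (sign p) * (\<Prod>e\<in>E. M e (p e)))"

lemma cdet_eq_sdet: "cdet n A = sdet {..<n} (\<lambda>i j. A (i, j))"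
  by (simp add: cdet_def sdet_def)

lemma sum_permutes_image:
  assumes h: "inj_on h E" and E: "finite E"
  shows "(\<Sum>Q\<in>{Q. Q permutes h ` E}. g Q) = (\<Sum>p\<in>{p. p permutes E}. g (map_permutation E h p))"
proof (rule sum.reindex_bij_witness[of _ "map_permutation E h" "map_permutation (h ` E) (inv_into E h)"])
  have b: "bij_betw h E (h ` E)" using h by (rule inj_on_imp_bij_betw)
  have b': "bij_betw (inv_into E h) (h ` E) E" using b by (rule bij_betw_inv_into)
  show "map_permutation E h (map_permutation (h ` E) (inv_into E h) Q) = Q" if "Q \<in> {Q. Q permutes h ` E}" for Q
    using that by (intro map_permutation_compose_inv[OF b']) (auto simp: f_inv_into_f)
  show "map_permutation (h ` E) (inv_into E h) (map_permutation E h p) = p" if "p \<in> {p. p permutes E}" for p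
    using that h by (intro map_permutation_compose_inv[OF b]) auto
  show "map_permutation (h ` E) (inv_into E h) Q \<in> {p. p permutes E}" if "Q \<in> {Q. Q permutes h ` E}" for Q
    using that b' by (auto intro: map_permutation_permutes)
  show "map_permutation E h p \<in> {Q. Q permutes h ` E}" if "p \<in> {p. p permutes E}" for p
    using that b by (auto intro: map_permutation_permutes)
  show "g (map_permutation E h (map_permutation (h ` E) (inv_into E h) Q)) = g Q" if "Q \<in> {Q. Q permutes h ` E}" for Q
    using that by (subst map_permutation_compose_inv[OF b']) (auto simp: f_inv_into_f)
qed

lemma sdet_image:
  assumes h: "inj_on h E" and E: "finite E"
  shows "sdet (h ` E) M = sdet E (\<lambda>e f. M (h e) (h f))"
  unfolding sdet_def sum_permutes_image[OF assms]
proof (rule sum.cong[OF refl])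
  fix p assume "p \<in> {p. p permutes E}"
  hence p: "p permutes E" by simp
  have "(\<Prod>e\<in>h ` E. M e (map_permutation E h p e)) = (\<Prod>e\<in>E. M (h e) (h (p e)))"
    by (subst prod.reindex[OF h]) (auto intro!: prod.cong simp: map_permutation_apply[OF h])
  thus "of_int (sign (map_permutation E h p)) * (\<Prod>e\<in>h ` E. M e (map_permutation E h p e)) =
    of_int (sign p) * (\<Prod>e\<in>E. M (h e) (h (p e)))"
    by (simp add: sign_map_permutation[OF h p E])
qed

lemma sdet_cong:
  assumes "\<And>e f. e \<in> E \<Longrightarrow> f \<in> E \<Longrightarrow> M e f = M' e f"
  shows "sdet E M = sdet E M'"
  unfolding sdet_def
  by (intro sum.cong refl arg_cong2[of _ _ _ _ "(*)"] prod.cong assms) (auto simp: permutes_in_image)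

text \<open>A permutation with a nonzero term cannot lead from \<open>X\<close> to \<open>Y\<close>;
  by finiteness it then preserves both parts and splits into two commuting factors.\<close>

lemma sdet_Un:
  assumes fin: "finite X" "finite Y" and disj: "X \<inter> Y = {}"
    and z: "\<And>x y. x \<in> X \<Longrightarrow> y \<in> Y \<Longrightarrow> M x y = 0"
  shows "sdet (X \<union> Y) M = sdet X M * sdet Y M"
proof -
  let ?P = "\<lambda>E. {p. p permutes E}"
  let ?t = "\<lambda>p. of_int (sign p) * (\<Prod>e\<in>X \<union> Y. M e (p e)) :: complex"
  have "sdet (X \<union> Y) M = (\<Sum>p\<in>{p \<in> ?P (X \<union> Y). p ` X \<subseteq> X}. ?t p)"
    unfolding sdet_def
  proof (rule sum.mono_neutral_right)
    show "\<forall>p\<in>?P (X \<union> Y) - {p \<in> ?P (X \<union> Y). p ` X \<subseteq> X}. ?t p = 0"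
    proof
      fix p assume "p \<in> ?P (X \<union> Y) - {p \<in> ?P (X \<union> Y). p ` X \<subseteq> X}"
      then obtain x where x: "p permutes X \<union> Y" "x \<in> X" "p x \<notin> X" by auto
      hence "p x \<in> Y" using permutes_in_image[OF x(1), of x] by auto
      hence "M x (p x) = 0" using z x by auto
      thus "?t p = 0" using x fin by (auto intro!: prod_zero)
    qed
  qed (use fin in \<open>auto intro: finite_permutations\<close>)
  also have "\<dots> = (\<Sum>(p, q)\<in>?P X \<times> ?P Y. ?t (p \<circ> q))"
  proof (rule sum.reindex_bij_witness[of _ "\<lambda>(p, q). p \<circ> q" "\<lambda>p. (restrict_id p X, restrict_id p Y)"])
    fix p assume p: "p \<in> {p \<in> ?P (X \<union> Y). p ` X \<subseteq> X}"
    hence pp: "p permutes X \<union> Y" and pX: "p ` X \<subseteq> X" by auto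
    have inj: "inj_on p S" for S using permutes_inj_on[OF pp] .
    have bX: "bij_betw p X X"
      using pX inj fin(1) by (simp add: bij_betw_def endo_inj_surj)
    have "p ` (X \<union> Y) = X \<union> Y" using permutes_image[OF pp] .
    hence "p ` Y \<subseteq> Y"
      using bX disj inj[of "X \<union> Y"] unfolding bij_betw_def inj_on_def
      by (smt (verit) IntI UnE UnI1 UnI2 emptyE image_iff image_subset_iff)
    hence bY: "bij_betw p Y Y"
      using inj fin(2) by (simp add: bij_betw_def endo_inj_surj)
    have eq: "restrict_id p X \<circ> restrict_id p Y = p"
      using disj \<open>p ` Y \<subseteq> Y\<close> pp by (auto simp: fun_eq_iff restrict_id_def permutes_def)
    thus "(case (restrict_id p X, restrict_id p Y) of (p, q) \<Rightarrow> p \<circ> q) = p" by simp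
    show "(restrict_id p X, restrict_id p Y) \<in> ?P X \<times> ?P Y"
      using bX bY by (auto intro: permutes_restrict_id)
    show "(case (restrict_id p X, restrict_id p Y) of (p, q) \<Rightarrow> ?t (p \<circ> q)) = ?t p"
      by (simp only: prod.case eq)
  next
    fix pq assume "pq \<in> ?P X \<times> ?P Y"
    then obtain p q where pq: "pq = (p, q)" "p permutes X" "q permutes Y" by auto
    have v: "(p \<circ> q) x = (if x \<in> X then p x else if x \<in> Y then q x else x)" for x
      using pq disj permutes_in_image[OF pq(3), of x] permutes_not_in[OF pq(3), of x] permutes_not_in[OF pq(2), of x]
        permutes_not_in[OF pq(2), of "q x"]
      by (auto split: if_splits)
    show "(restrict_id (case pq of (p, q) \<Rightarrow> p \<circ> q) X, restrict_id (case pq of (p, q) \<Rightarrow> p \<circ> q) Y) = pq"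
      unfolding pq using disj permutes_not_in[OF pq(2)] permutes_not_in[OF pq(3)]
      by (auto simp: fun_eq_iff restrict_id_def v simp del: o_apply)
    show "(case pq of (p, q) \<Rightarrow> p \<circ> q) \<in> {p \<in> ?P (X \<union> Y). p ` X \<subseteq> X}"
      unfolding pq using pq permutes_in_image[OF pq(2)]
      by (auto simp: v simp del: o_apply intro!: permutes_compose intro: permutes_subset)
  qed
  also have "\<dots> = (\<Sum>(p, q)\<in>?P X \<times> ?P Y. (of_int (sign p) * (\<Prod>e\<in>X. M e (p e))) * (of_int (sign q) * (\<Prod>e\<in>Y. M e (q e))))"
  proof (rule sum.cong[OF refl], safe)
    fix p q assume pq: "p permutes X" "q permutes Y"
    have v: "(p \<circ> q) x = (if x \<in> X then p x else if x \<in> Y then q x else x)" for x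
      using pq disj permutes_in_image[OF pq(2), of x] permutes_not_in[OF pq(2), of x] permutes_not_in[OF pq(1), of x]
        permutes_not_in[OF pq(1), of "q x"]
      by (auto split: if_splits)
    have "sign (p \<circ> q) = sign p * sign q"
      using pq fin by (intro sign_compose) (auto intro: permutes_imp_permutation)
    moreover have "(\<Prod>e\<in>X \<union> Y. M e ((p \<circ> q) e)) = (\<Prod>e\<in>X. M e (p e)) * (\<Prod>e\<in>Y. M e (q e))"
      using fin disj by (subst prod.union_disjoint) (auto intro!: prod.cong arg_cong2[of _ _ _ _ "(*)"] simp: v simp del: o_apply)
    ultimately show "?t (p \<circ> q) = (of_int (sign p) * (\<Prod>e\<in>X. M e (p e))) * (of_int (sign q) * (\<Prod>e\<in>Y. M e (q e)))"
      by simp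
  qed
  also have "\<dots> = sdet X M * sdet Y M"
    by (simp add: sdet_def sum_product sum.cartesian_product)
  finally show ?thesis .
qed

text \<open>The power is the determinant of a block diagonal matrix with \<open>k\<close> copies of
  \<open>A\<close>. The variant that follows exchanges the two coordinates, so powers of both kinds
  of determinant live on one index set.\<close>

lemma cdet_power_eq_sdet:
  "cdet n A ^ k = sdet ({..<n} \<times> {..<k}) (\<lambda>e f. if snd e = snd f then A (fst e, fst f) else 0)"
proof (induction k)
  case 0
  have "{p. p permutes ({} :: (nat \<times> nat) set)} = {id}" by auto
  thus ?case by (simp add: sdet_def)
next
  case (Suc k)
  let ?M = "\<lambda>e f. if snd e = snd f then A (fst e, fst f) else 0"
  have "{..<n} \<times> {..<Suc k} = {..<n} \<times> {..<k} \<union> (\<lambda>i. (i, k)) ` {..<n}" by auto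
  moreover have "sdet ({..<n} \<times> {..<k} \<union> (\<lambda>i. (i, k)) ` {..<n}) ?M = sdet ({..<n} \<times> {..<k}) ?M * sdet ((\<lambda>i. (i, k)) ` {..<n}) ?M"
    by (rule sdet_Un) auto
  ultimately have "sdet ({..<n} \<times> {..<Suc k}) ?M = sdet ({..<n} \<times> {..<k}) ?M * sdet ((\<lambda>i. (i, k)) ` {..<n}) ?M"
    by (rule ssubst)
  also have "sdet ((\<lambda>i. (i, k)) ` {..<n}) ?M = cdet n A"
    by (subst sdet_image) (auto simp: inj_on_def cdet_eq_sdet)
  finally show ?case using Suc.IH by simp
qed

lemma cdet_power_eq_sdet':
  "cdet k A ^ n = sdet ({..<n} \<times> {..<k}) (\<lambda>e f. if fst e = fst f then A (snd e, snd f) else 0)"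
proof -
  have "{..<n} \<times> {..<k} = prod.swap ` ({..<k} \<times> {..<n})" by auto
  thus ?thesis
    unfolding cdet_power_eq_sdet
    by (simp only:) (subst sdet_image, auto simp: prod.swap_def intro!: sdet_cong)
qed

text \<open>Expansion in principal minors: each row outside \<open>E\<close> takes its entry from
  the scalar part, so a surviving permutation fixes the complement of \<open>E\<close>.\<close>

lemma sdet_add_diag:
  assumes U: "finite U"
  shows "sdet U (\<lambda>e f. M e f + (if e = f then c else 0)) = (\<Sum>E\<in>Pow U. c ^ card (U - E) * sdet E M)"
proof -
  have "sdet U (\<lambda>e f. M e f + (if e = f then c else 0)) =
    (\<Sum>p\<in>{p. p permutes U}. \<Sum>E\<in>Pow U. of_int (sign p) * ((\<Prod>e\<in>E. M e (p e)) * (\<Prod>e\<in>U - E. if e = p e then c else 0)))"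
    unfolding sdet_def prod_add[OF U] sum_distrib_left ..
  also have "\<dots> = (\<Sum>E\<in>Pow U. \<Sum>p\<in>{p. p permutes U}. of_int (sign p) * ((\<Prod>e\<in>E. M e (p e)) * (\<Prod>e\<in>U - E. if e = p e then c else 0)))"
    by (rule sum.swap)
  also have "\<dots> = (\<Sum>E\<in>Pow U. c ^ card (U - E) * sdet E M)"
  proof (rule sum.cong[OF refl])
    fix E assume "E \<in> Pow U"
    hence E: "E \<subseteq> U" by simp
    have "(\<Sum>p\<in>{p. p permutes U}. of_int (sign p) * ((\<Prod>e\<in>E. M e (p e)) * (\<Prod>e\<in>U - E. if e = p e then c else 0)))
      = (\<Sum>p\<in>{p. p permutes E}. of_int (sign p) * ((\<Prod>e\<in>E. M e (p e)) * (\<Prod>e\<in>U - E. if e = p e then c else 0)))"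
    proof (rule sum.mono_neutral_right)
      show "\<forall>p\<in>{p. p permutes U} - {p. p permutes E}.
        of_int (sign p) * ((\<Prod>e\<in>E. M e (p e)) * (\<Prod>e\<in>U - E. if e = p e then c else 0)) = 0"
      proof
        fix p assume p: "p \<in> {p. p permutes U} - {p. p permutes E}"
        have "\<exists>e\<in>U - E. p e \<noteq> e"
          using p permutes_superset[of p U E] by auto
        thus "of_int (sign p) * ((\<Prod>e\<in>E. M e (p e)) * (\<Prod>e\<in>U - E. if e = p e then c else 0)) = 0"
          using U by (auto intro!: prod_zero)
      qed
    qed (use U E in \<open>auto intro: finite_permutations permutes_subset\<close>)
    also have "\<dots> = (\<Sum>p\<in>{p. p permutes E}. of_int (sign p) * ((\<Prod>e\<in>E. M e (p e)) * c ^ card (U - E)))"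
    proof (rule sum.cong[OF refl])
      fix p assume "p \<in> {p. p permutes E}"
      hence "(\<Prod>e\<in>U - E. if e = p e then c else 0) = (\<Prod>e\<in>U - E. c)"
        by (intro prod.cong) (auto simp: permutes_not_in)
      thus "of_int (sign p) * ((\<Prod>e\<in>E. M e (p e)) * (\<Prod>e\<in>U - E. if e = p e then c else 0)) =
        of_int (sign p) * ((\<Prod>e\<in>E. M e (p e)) * c ^ card (U - E))" by simp
    qed
    finally show "(\<Sum>p\<in>{p. p permutes U}. of_int (sign p) * ((\<Prod>e\<in>E. M e (p e)) * (\<Prod>e\<in>U - E. if e = p e then c else 0)))
      = c ^ card (U - E) * sdet E M"
      by (simp add: sdet_def sum_distrib_left mult_ac)
  qed
  finally show ?thesis .
qed

section \<open>Signed permutation sums arising from Wick pairings\<close>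

lemma prod_if_zero:
  assumes "finite E"
  shows "(\<Prod>e\<in>E. if b e then x e else 0) = of_bool (\<forall>e\<in>E. b e) * (\<Prod>e\<in>E. x e :: complex)"
  using assms by (induction E rule: finite_induct) auto

lemma card_eq_sum_of_bool: "finite S \<Longrightarrow> of_nat (card {x \<in> S. P x}) = (\<Sum>x\<in>S. of_bool (P x) :: complex)"
  by (simp add: of_bool_def sum.If_cases Int_def)

lemma card_pairings_self:
  assumes E: "finite E"
  shows "of_nat (card (pairings E E c d)) = (\<Sum>\<rho>\<in>{\<rho>. \<rho> permutes E}. of_bool (\<forall>e\<in>E. d (\<rho> e) = c e) :: complex)"
proof -
  have "card (pairings E E c d) = card {\<rho> \<in> {\<rho>. \<rho> permutes E}. \<forall>e\<in>E. d (\<rho> e) = c e}"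
  proof (rule bij_betw_same_card[of "\<lambda>M. restrict_id M E"], rule bij_betw_byWitness[where f' = "\<lambda>\<rho>. restrict \<rho> E"])
    show "\<forall>M\<in>pairings E E c d. restrict (restrict_id M E) E = M"
      by (auto simp: pairings_def fun_eq_iff PiE_def extensional_def restrict_id_def)
    show "\<forall>\<rho>\<in>{\<rho> \<in> {\<rho>. \<rho> permutes E}. \<forall>e\<in>E. d (\<rho> e) = c e}. restrict_id (restrict \<rho> E) E = \<rho>"
      by (auto simp: fun_eq_iff restrict_id_def permutes_not_in)
    show "(\<lambda>M. restrict_id M E) ` pairings E E c d \<subseteq> {\<rho> \<in> {\<rho>. \<rho> permutes E}. \<forall>e\<in>E. d (\<rho> e) = c e}"
      by (auto simp: pairings_def intro: permutes_restrict_id)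
    show "(\<lambda>\<rho>. restrict \<rho> E) ` {\<rho> \<in> {\<rho>. \<rho> permutes E}. \<forall>e\<in>E. d (\<rho> e) = c e} \<subseteq> pairings E E c d"
    proof safe
      fix \<rho> assume r: "\<rho> permutes E" "\<forall>e\<in>E. d (\<rho> e) = c e"
      have "bij_betw (restrict \<rho> E) E E"
        using permutes_imp_bij[OF r(1)] by (rule bij_betw_cong[THEN iffD1, rotated]) auto
      thus "restrict \<rho> E \<in> pairings E E c d"
        using r by (auto simp: pairings_def permutes_in_image)
    qed
  qed
  thus ?thesis using card_eq_sum_of_bool[OF finite_permutations[OF E]] by simp
qed

abbreviation row_match ::
  "(nat \<times> nat) set \<Rightarrow> (nat \<times> nat \<Rightarrow> nat \<times> nat) \<Rightarrow> (nat \<times> nat \<Rightarrow> nat) \<Rightarrow> (nat \<times> nat \<Rightarrow> nat \<times> nat) \<Rightarrow> bool" where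
  "row_match E P \<sigma> \<rho> \<equiv> (\<forall>e\<in>E. fst (\<rho> e) = fst (P e)) \<and> (\<forall>e\<in>E. \<sigma> (\<rho> e) = \<sigma> e)"

text \<open>The common combinatorial form of the two sides of the duality. On the Hermitian side \<open>P\<close> is the
  composition of a fibrewise permutation with the Wick pairing \<open>\<rho>\<close>; on the Ginibre side \<open>\<rho>\<close> is a
  permutation of the conjugate factor pulled back along the Wick pairing \<open>e \<mapsto> (fst e, \<sigma> e)\<close>.\<close>
definition dual_sum :: "nat \<Rightarrow> (nat \<times> nat) set \<Rightarrow> complex" where
  "dual_sum k E = (\<Sum>\<sigma>\<in>E \<rightarrow>\<^sub>E {..<k}. \<Sum>P\<in>{P. P permutes E}. \<Sum>\<rho>\<in>{\<rho>. \<rho> permutes E}.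
     of_int (sign P * sign \<rho>) * of_bool ((\<forall>e\<in>E. snd (P e) = snd e) \<and>
       row_match E P \<sigma> \<rho>))"

lemma integral_sdet_gram:
  assumes E: "E \<subseteq> {..<N} \<times> {..<k}"
  defines "f \<equiv> \<lambda>X. sdet E (\<lambda>e f. if fst e = fst f then gram k X (snd e, snd f) else 0)"
  shows "integrable (PiM (sq k) (\<lambda>_. std_cgauss)) f" and "(\<integral>X. f X \<partial>PiM (sq k) (\<lambda>_. std_cgauss)) = dual_sum k E"
proof -
  let ?P = "{p. p permutes E}"
  have fin: "finite E" using E finite_subset by blast
  have sE: "snd e < k" if "e \<in> E" for e using E that by auto
  \<comment> \<open>\<open>\<sigma> e\<close> is the summation index picked from the Gram entry in
    row \<open>e\<close> when the product of sums is multiplied out.\<close>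
  have f: "f X = (\<Sum>\<pi>\<in>?P. \<Sum>\<sigma>\<in>E \<rightarrow>\<^sub>E {..<k}. of_int (sign \<pi>) * of_bool (\<forall>e\<in>E. fst e = fst (\<pi> e)) *
      ((\<Prod>e\<in>E. X (snd e, \<sigma> e)) * (\<Prod>e\<in>E. cnj (X (snd (\<pi> e), \<sigma> e)))))" for X
    unfolding f_def sdet_def prod_if_zero[OF fin]
  proof (rule sum.cong[OF refl])
    fix \<pi> assume "\<pi> \<in> ?P"
    hence p: "\<pi> permutes E" by simp
    have "(\<Prod>e\<in>E. gram k X (snd e, snd (\<pi> e))) = (\<Prod>e\<in>E. \<Sum>l<k. X (snd e, l) * cnj (X (snd (\<pi> e), l)))"
      by (intro prod.cong) (auto simp: gram_def sE permutes_in_image[OF p])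
    also have "\<dots> = (\<Sum>\<sigma>\<in>E \<rightarrow>\<^sub>E {..<k}. \<Prod>e\<in>E. X (snd e, \<sigma> e) * cnj (X (snd (\<pi> e), \<sigma> e)))"
      by (rule prod_sum_PiE) (use fin in auto)
    finally show "of_int (sign \<pi>) * (of_bool (\<forall>e\<in>E. fst e = fst (\<pi> e)) * (\<Prod>e\<in>E. gram k X (snd e, snd (\<pi> e)))) =
       (\<Sum>\<sigma>\<in>E \<rightarrow>\<^sub>E {..<k}. of_int (sign \<pi>) * of_bool (\<forall>e\<in>E. fst e = fst (\<pi> e)) *
      ((\<Prod>e\<in>E. X (snd e, \<sigma> e)) * (\<Prod>e\<in>E. cnj (X (snd (\<pi> e), \<sigma> e)))))"
      by (simp add: prod.distrib sum_distrib_left)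
  qed
  have wick: "integrable (PiM (sq k) (\<lambda>_. std_cgauss)) (\<lambda>X. (\<Prod>e\<in>E. X (snd e, \<sigma> e)) * (\<Prod>e\<in>E. cnj (X (snd (\<pi> e), \<sigma> e)))) \<and>
    (\<integral>X. (\<Prod>e\<in>E. X (snd e, \<sigma> e)) * (\<Prod>e\<in>E. cnj (X (snd (\<pi> e), \<sigma> e))) \<partial>PiM (sq k) (\<lambda>_. std_cgauss))
      = of_nat (card (pairings E E (\<lambda>e. (snd e, \<sigma> e)) (\<lambda>e. (snd (\<pi> e), \<sigma> e))))"
    if "\<pi> \<in> ?P" "\<sigma> \<in> E \<rightarrow>\<^sub>E {..<k}" for \<pi> \<sigma>
  proof -
    have "(\<lambda>e. (snd e, \<sigma> e)) ` E \<subseteq> sq k" "(\<lambda>e. (snd (\<pi> e), \<sigma> e)) ` E \<subseteq> sq k"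
      using that sE sE[of "\<pi> _"] permutes_in_image[of \<pi> E] by (auto simp: PiE_iff image_subset_iff)
    from wick_formula[OF fin fin _ this] show ?thesis by simp
  qed
  note wick = wick[THEN conjunct1] wick[THEN conjunct2]
  show "integrable (PiM (sq k) (\<lambda>_. std_cgauss)) f"
    unfolding f by (intro Bochner_Integration.integrable_sum integrable_mult_right wick) auto
  have "(\<integral>X. f X \<partial>PiM (sq k) (\<lambda>_. std_cgauss)) =
     (\<Sum>\<pi>\<in>?P. \<Sum>\<sigma>\<in>E \<rightarrow>\<^sub>E {..<k}. of_int (sign \<pi>) * of_bool (\<forall>e\<in>E. fst e = fst (\<pi> e)) *
       of_nat (card (pairings E E (\<lambda>e. (snd e, \<sigma> e)) (\<lambda>e. (snd (\<pi> e), \<sigma> e)))))"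
    unfolding f
    by (subst Bochner_Integration.integral_sum; (intro Bochner_Integration.integrable_sum integrable_mult_right wick sum.cong refl)?)
       (auto simp: Bochner_Integration.integral_sum wick intro!: sum.cong)
  also have "\<dots> = (\<Sum>\<pi>\<in>?P. \<Sum>\<sigma>\<in>E \<rightarrow>\<^sub>E {..<k}. \<Sum>\<rho>\<in>?P. of_int (sign \<pi>) *
       of_bool ((\<forall>e\<in>E. fst e = fst (\<pi> e)) \<and> (\<forall>e\<in>E. (snd (\<pi> (\<rho> e)), \<sigma> (\<rho> e)) = (snd e, \<sigma> e))))"
    unfolding card_pairings_self[OF fin] sum_distrib_left
    by (simp only: of_bool_conj mult.assoc)
  also have "\<dots> = (\<Sum>\<sigma>\<in>E \<rightarrow>\<^sub>E {..<k}. \<Sum>\<rho>\<in>?P. \<Sum>\<pi>\<in>?P. of_int (sign \<pi>) *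
       of_bool ((\<forall>e\<in>E. fst e = fst (\<pi> e)) \<and> (\<forall>e\<in>E. (snd (\<pi> (\<rho> e)), \<sigma> (\<rho> e)) = (snd e, \<sigma> e))))"
    by (subst sum.swap, rule sum.cong[OF refl], rule sum.swap)
  also have "\<dots> = (\<Sum>\<sigma>\<in>E \<rightarrow>\<^sub>E {..<k}. \<Sum>\<rho>\<in>?P. \<Sum>P\<in>?P. of_int (sign P * sign \<rho>) * of_bool ((\<forall>e\<in>E. snd (P e) = snd e) \<and>
       row_match E P \<sigma> \<rho>))"
  \<comment> \<open>With \<open>P\<close> the composition of \<open>\<pi>\<close> after
    \<open>\<rho>\<close>, the sign of \<open>\<pi>\<close> is the product of the signs of
    \<open>P\<close> and \<open>\<rho>\<close>. Transporting the condition on first coordinates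
    along the bijection \<open>\<rho>\<close> gives the first half of
    \<open>row_match\<close>.\<close>
  proof (rule sum.cong[OF refl], rule sum.cong[OF refl])
    fix \<sigma> \<rho> assume "\<rho> \<in> ?P"
    hence r: "\<rho> permutes E" by simp
    have bij: "(\<forall>e\<in>E. Q (\<rho> e)) \<longleftrightarrow> (\<forall>e\<in>E. Q e)" for Q
      using permutes_image[OF r] by (metis imageE image_eqI)
    have "(\<Sum>P\<in>?P. of_int (sign P * sign \<rho>) * of_bool ((\<forall>e\<in>E. snd (P e) = snd e) \<and>
       row_match E P \<sigma> \<rho>)) =
      (\<Sum>\<pi>\<in>?P. of_int (sign (\<pi> \<circ> \<rho>) * sign \<rho>) * of_bool ((\<forall>e\<in>E. snd ((\<pi> \<circ> \<rho>) e) = snd e) \<and>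
       (\<forall>e\<in>E. fst (\<rho> e) = fst ((\<pi> \<circ> \<rho>) e)) \<and> (\<forall>e\<in>E. \<sigma> (\<rho> e) = \<sigma> e)) :: complex)"
      by (rule sum_permutations_compose_right[OF r])
    also have "\<dots> = (\<Sum>\<pi>\<in>?P. of_int (sign \<pi>) *
       of_bool ((\<forall>e\<in>E. fst e = fst (\<pi> e)) \<and> (\<forall>e\<in>E. (snd (\<pi> (\<rho> e)), \<sigma> (\<rho> e)) = (snd e, \<sigma> e))))"
    proof (intro sum.cong refl arg_cong2[of _ _ _ _ "(*)"] arg_cong[of _ _ of_bool])
      fix \<pi> assume "\<pi> \<in> ?P"
      hence "sign (\<pi> \<circ> \<rho>) = sign \<pi> * sign \<rho>"
        using r fin by (intro sign_compose) (auto intro: permutes_imp_permutation)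
      thus "complex_of_int (sign (\<pi> \<circ> \<rho>) * sign \<rho>) = of_int (sign \<pi>)" by (simp add: mult.assoc)
      show "((\<forall>e\<in>E. snd ((\<pi> \<circ> \<rho>) e) = snd e) \<and> (\<forall>e\<in>E. fst (\<rho> e) = fst ((\<pi> \<circ> \<rho>) e)) \<and> (\<forall>e\<in>E. \<sigma> (\<rho> e) = \<sigma> e)) =
        ((\<forall>e\<in>E. fst e = fst (\<pi> e)) \<and> (\<forall>e\<in>E. (snd (\<pi> (\<rho> e)), \<sigma> (\<rho> e)) = (snd e, \<sigma> e)))"
        using bij[of "\<lambda>e. fst e = fst (\<pi> e)"] by auto
    qed
    finally show "(\<Sum>\<pi>\<in>?P. of_int (sign \<pi>) *
       of_bool ((\<forall>e\<in>E. fst e = fst (\<pi> e)) \<and> (\<forall>e\<in>E. (snd (\<pi> (\<rho> e)), \<sigma> (\<rho> e)) = (snd e, \<sigma> e)))) =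
     (\<Sum>P\<in>?P. of_int (sign P * sign \<rho>) * of_bool ((\<forall>e\<in>E. snd (P e) = snd e) \<and>
       row_match E P \<sigma> \<rho>) :: complex)" ..
  qed
  also have "\<dots> = dual_sum k E"
    unfolding dual_sum_def by (intro sum.cong refl sum.swap)
  finally show "(\<integral>X. f X \<partial>PiM (sq k) (\<lambda>_. std_cgauss)) = dual_sum k E" .
qed

text \<open>If \<open>e \<mapsto> (fst e, \<sigma> e)\<close> identifies two points, composing with their transposition is a
  sign-reversing involution on the remaining permutations.\<close>
lemma signed_sum_eq_0:
  assumes E: "finite E" and ninj: "\<not> inj_on (\<lambda>e. (fst e, \<sigma> e)) E"
  shows "(\<Sum>\<rho>\<in>{\<rho>. \<rho> permutes E}. of_int (sign \<rho>) *
    of_bool (row_match E P \<sigma> \<rho>) :: complex) = 0" (is "?S = 0")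
proof -
  obtain x y where xy: "x \<in> E" "y \<in> E" "x \<noteq> y" "fst x = fst y" "\<sigma> x = \<sigma> y"
    using ninj unfolding inj_on_def by auto
  let ?t = "Transposition.transpose x y"
  have t: "?t permutes E" using xy by (intro permutes_swap_id)
  have inv: "fst (?t e) = fst e" "\<sigma> (?t e) = \<sigma> e" for e
    using xy by (auto simp: Transposition.transpose_def)
  have "?S = (\<Sum>\<rho>\<in>{\<rho>. \<rho> permutes E}. of_int (sign (?t \<circ> \<rho>)) *
    of_bool ((\<forall>e\<in>E. fst ((?t \<circ> \<rho>) e) = fst (P e)) \<and> (\<forall>e\<in>E. \<sigma> ((?t \<circ> \<rho>) e) = \<sigma> e)))"
    by (rule setum_permutations_compose_left[OF t])
  also have "\<dots> = (\<Sum>\<rho>\<in>{\<rho>. \<rho> permutes E}. - (of_int (sign \<rho>) *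
    of_bool (row_match E P \<sigma> \<rho>)))"
  proof (rule sum.cong[OF refl])
    fix \<rho> assume "\<rho> \<in> {\<rho>. \<rho> permutes E}"
    hence "sign (?t \<circ> \<rho>) = sign ?t * sign \<rho>"
      using t E by (intro sign_compose) (auto intro: permutes_imp_permutation)
    hence "sign (?t \<circ> \<rho>) = - sign \<rho>" using xy by (simp add: sign_swap_id)
    thus "of_int (sign (?t \<circ> \<rho>)) * of_bool ((\<forall>e\<in>E. fst ((?t \<circ> \<rho>) e) = fst (P e)) \<and> (\<forall>e\<in>E. \<sigma> ((?t \<circ> \<rho>) e) = \<sigma> e)) =
      - (of_int (sign \<rho>) * of_bool (row_match E P \<sigma> \<rho>) :: complex)"
      by (simp add: inv)
  qed
  also have "\<dots> = - ?S" by (simp add: sum_negf)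
  finally show ?thesis by (simp add: eq_neg_iff_add_eq_0)
qed

text \<open>Injectivity of \<open>e \<mapsto> (fst e, \<sigma> e)\<close> holds automatically on the
  Ginibre side, where this map is a Wick pairing; on the Hermitian side it results from the
  cancellation just shown.\<close>

lemma dual_sum_injective:
  assumes E: "finite E"
  shows "dual_sum k E = (\<Sum>P\<in>{P. P permutes E}. of_int (sign P) * of_bool (\<forall>e\<in>E. snd (P e) = snd e) *
    (\<Sum>\<sigma>\<in>{\<sigma> \<in> E \<rightarrow>\<^sub>E {..<k}. inj_on (\<lambda>e. (fst e, \<sigma> e)) E}. \<Sum>\<rho>\<in>{\<rho>. \<rho> permutes E}. of_int (sign \<rho>) *
      of_bool (row_match E P \<sigma> \<rho>)))"
proof -
  let ?P = "{P. P permutes E}"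
  have "dual_sum k E = (\<Sum>\<sigma>\<in>E \<rightarrow>\<^sub>E {..<k}. \<Sum>P\<in>?P. of_int (sign P) * of_bool (\<forall>e\<in>E. snd (P e) = snd e) *
     (\<Sum>\<rho>\<in>?P. of_int (sign \<rho>) * of_bool (row_match E P \<sigma> \<rho>)))"
    unfolding dual_sum_def sum_distrib_left
    by (intro sum.cong refl) (simp only: of_bool_conj of_int_mult mult_ac)
  also have "\<dots> = (\<Sum>P\<in>?P. \<Sum>\<sigma>\<in>E \<rightarrow>\<^sub>E {..<k}. of_int (sign P) * of_bool (\<forall>e\<in>E. snd (P e) = snd e) *
     (\<Sum>\<rho>\<in>?P. of_int (sign \<rho>) * of_bool (row_match E P \<sigma> \<rho>)))"
    by (rule sum.swap)
  also have "\<dots> = (\<Sum>P\<in>?P. \<Sum>\<sigma>\<in>{\<sigma> \<in> E \<rightarrow>\<^sub>E {..<k}. inj_on (\<lambda>e. (fst e, \<sigma> e)) E}. of_int (sign P) * of_bool (\<forall>e\<in>E. snd (P e) = snd e) *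
     (\<Sum>\<rho>\<in>?P. of_int (sign \<rho>) * of_bool (row_match E P \<sigma> \<rho>)))"
    using E
    by (intro sum.cong refl sum.mono_neutral_right finite_PiE) (auto simp: signed_sum_eq_0[OF E])
  finally show ?thesis by (simp only: sum_distrib_left)
qed

text \<open>The first half of the Wick condition for minors of the Ginibre matrix: paired factors
  come from the same row of \<open>G\<close>.\<close>

definition row_bijections :: "(nat \<times> nat) set \<Rightarrow> (nat \<times> nat) set \<Rightarrow> (nat \<times> nat \<Rightarrow> nat \<times> nat) set" where
  "row_bijections E F = {M \<in> E \<rightarrow>\<^sub>E F. bij_betw M E F \<and> (\<forall>e\<in>E. fst (M e) = fst e)}"

text \<open>Once all \<open>F\<close> are allowed, a row bijection is the same as an injective map
  \<open>e \<mapsto> (fst e, \<sigma> e)\<close>, with \<open>F\<close> recovered as its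
  image.\<close>

lemma sum_row_bijections:
  assumes E: "E \<subseteq> {..<N} \<times> {..<k}"
  shows "(\<Sum>F\<in>Pow ({..<N} \<times> {..<k}). \<Sum>M\<in>row_bijections E F. g (\<lambda>e\<in>E. snd (M e))) =
    (\<Sum>\<sigma>\<in>{\<sigma> \<in> E \<rightarrow>\<^sub>E {..<k}. inj_on (\<lambda>e. (fst e, \<sigma> e)) E}. g \<sigma>)"
proof -
  let ?U = "{..<N} \<times> {..<k}"
  have finE: "finite E" using E finite_subset by blast
  have finB: "finite (row_bijections E F)" if "F \<in> Pow ?U" for F
    unfolding row_bijections_def using that finE
    by (intro finite_subset[OF _ finite_PiE[of E "\<lambda>_. F"]]) (auto intro: finite_subset)
  have "(\<Sum>F\<in>Pow ?U. \<Sum>M\<in>row_bijections E F. g (\<lambda>e\<in>E. snd (M e))) =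
    (\<Sum>(F, M)\<in>(SIGMA F:Pow ?U. row_bijections E F). g (\<lambda>e\<in>E. snd (M e)))"
    by (rule sum.Sigma) (use finB in auto)
  also have "\<dots> = (\<Sum>\<sigma>\<in>{\<sigma> \<in> E \<rightarrow>\<^sub>E {..<k}. inj_on (\<lambda>e. (fst e, \<sigma> e)) E}. g \<sigma>)"
  proof (rule sum.reindex_bij_witness[of _
        "\<lambda>\<sigma>. ((\<lambda>e. (fst e, \<sigma> e)) ` E, \<lambda>e\<in>E. (fst e, \<sigma> e))" "\<lambda>(F, M). \<lambda>e\<in>E. snd (M e)"])
    fix FM assume "FM \<in> (SIGMA F:Pow ?U. row_bijections E F)"
    then obtain F M where FM: "FM = (F, M)" "F \<subseteq> ?U" and M: "M \<in> E \<rightarrow>\<^sub>E F" "bij_betw M E F" "\<forall>e\<in>E. fst (M e) = fst e"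
      by (auto simp: row_bijections_def)
    have eq: "(fst e, (\<lambda>e\<in>E. snd (M e)) e) = M e" if "e \<in> E" for e
      using M(3) that by (simp add: prod_eq_iff)
    have "(\<lambda>e. (fst e, (\<lambda>e\<in>E. snd (M e)) e)) ` E = F"
      using M(2) eq by (simp add: bij_betw_def cong: image_cong)
    moreover have "(\<lambda>e\<in>E. (fst e, (\<lambda>e\<in>E. snd (M e)) e)) = M"
      using eq M(1) by (auto simp: fun_eq_iff PiE_def extensional_def)
    ultimately show "((\<lambda>e. (fst e, (case FM of (F, M) \<Rightarrow> \<lambda>e\<in>E. snd (M e)) e)) ` E,
        \<lambda>e\<in>E. (fst e, (case FM of (F, M) \<Rightarrow> \<lambda>e\<in>E. snd (M e)) e)) = FM"
      by (simp only: FM prod.case)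
    have "inj_on (\<lambda>e. (fst e, (\<lambda>e\<in>E. snd (M e)) e)) E"
      using M(2) eq by (simp add: bij_betw_def cong: inj_on_cong)
    moreover have "(\<lambda>e\<in>E. snd (M e)) \<in> E \<rightarrow>\<^sub>E {..<k}"
      using M(1) FM(2) by (fastforce simp: PiE_iff)
    ultimately show "(case FM of (F, M) \<Rightarrow> \<lambda>e\<in>E. snd (M e)) \<in> {\<sigma> \<in> E \<rightarrow>\<^sub>E {..<k}. inj_on (\<lambda>e. (fst e, \<sigma> e)) E}"
      by (simp only: FM prod.case mem_Collect_eq)
    show "g (case FM of (F, M) \<Rightarrow> \<lambda>e\<in>E. snd (M e)) = (case FM of (F, M) \<Rightarrow> g (\<lambda>e\<in>E. snd (M e)))"
      by (simp only: FM prod.case)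
  next
    fix \<sigma> assume "\<sigma> \<in> {\<sigma> \<in> E \<rightarrow>\<^sub>E {..<k}. inj_on (\<lambda>e. (fst e, \<sigma> e)) E}"
    hence s: "\<sigma> \<in> E \<rightarrow>\<^sub>E {..<k}" "inj_on (\<lambda>e. (fst e, \<sigma> e)) E" by auto
    show "(case ((\<lambda>e. (fst e, \<sigma> e)) ` E, \<lambda>e\<in>E. (fst e, \<sigma> e)) of (F, M) \<Rightarrow> \<lambda>e\<in>E. snd (M e)) = \<sigma>"
      using s(1) by (auto simp: fun_eq_iff PiE_def extensional_def)
    have "bij_betw (\<lambda>e\<in>E. (fst e, \<sigma> e)) E ((\<lambda>e. (fst e, \<sigma> e)) ` E)"
      using inj_on_imp_bij_betw[OF s(2)] by (rule bij_betw_cong[THEN iffD1, rotated]) auto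
    moreover have "(\<lambda>e. (fst e, \<sigma> e)) ` E \<subseteq> ?U"
      using s(1) E by (auto simp: PiE_iff)
    ultimately show "((\<lambda>e. (fst e, \<sigma> e)) ` E, \<lambda>e\<in>E. (fst e, \<sigma> e)) \<in> (SIGMA F:Pow ?U. row_bijections E F)"
      by (auto simp: row_bijections_def)
  qed
  finally show ?thesis .
qed

text \<open>After Wick's formula the permutation of \<open>F\<close> is pulled back along the
  pairing \<open>M\<close> to a permutation \<open>\<rho>\<close> of \<open>E\<close>. The sign is
  preserved, and preservation of the second coordinate becomes invariance of \<open>\<sigma>\<close>
  under \<open>\<rho>\<close>.\<close>

lemma integral_sdet_ginibre_prod:
  fixes D
  assumes E: "E \<subseteq> {..<N} \<times> {..<k}" and F: "F \<subseteq> {..<N} \<times> {..<k}"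
  defines "D \<equiv> \<lambda>E G. sdet E (\<lambda>e f. if snd e = snd f then G (fst e, fst f) else 0 :: complex)"
  shows "integrable (ginibre N) (\<lambda>G. D E G * cnj (D F G))"
    and "(\<integral>G. D E G * cnj (D F G) \<partial>ginibre N) =
      (\<Sum>P\<in>{P. P permutes E}. of_int (sign P) * of_bool (\<forall>e\<in>E. snd (P e) = snd e) *
        (\<Sum>M\<in>row_bijections E F. \<Sum>\<rho>\<in>{\<rho>. \<rho> permutes E}. of_int (sign \<rho>) *
          of_bool (row_match E P (\<lambda>e\<in>E. snd (M e)) \<rho>)))"
proof -
  let ?P = "\<lambda>E. {p. p permutes E}"
  let ?b = "\<lambda>E p. of_bool (\<forall>e\<in>E. snd e = snd (p e)) :: complex"
  have finE: "finite E" and finF: "finite F" using E F finite_subset by blast+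
  have D: "D E G = (\<Sum>p\<in>?P E. of_int (sign p) * ?b E p * (\<Prod>e\<in>E. G (fst e, fst (p e))))"
    if "finite E" for E G
    unfolding D_def sdet_def prod_if_zero[OF that] by (simp only: mult.assoc)
  have DD: "D E G * cnj (D F G) = (\<Sum>P\<in>?P E. \<Sum>Q\<in>?P F. (of_int (sign P) * ?b E P * (of_int (sign Q) * ?b F Q)) *
      ((\<Prod>e\<in>E. G (fst e, fst (P e))) * (\<Prod>e\<in>F. cnj (G (fst e, fst (Q e))))))" for G
    unfolding D[OF finE] D[OF finF] cnj_sum sum_product
    by (intro sum.cong refl) (simp add: cnj_prod mult_ac)
  have wick: "integrable (ginibre N) (\<lambda>G. (\<Prod>e\<in>E. G (fst e, fst (P e))) * (\<Prod>e\<in>F. cnj (G (fst e, fst (Q e))))) \<and>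
    (\<integral>G. (\<Prod>e\<in>E. G (fst e, fst (P e))) * (\<Prod>e\<in>F. cnj (G (fst e, fst (Q e)))) \<partial>ginibre N)
      = of_nat (card (pairings E F (\<lambda>e. (fst e, fst (P e))) (\<lambda>e. (fst e, fst (Q e)))))"
    if "P \<in> ?P E" "Q \<in> ?P F" for P Q
  proof -
    have fE: "fst e < N" if "e \<in> E" for e using E that by auto
    have fF: "fst e < N" if "e \<in> F" for e using F that by auto
    have "(\<lambda>e. (fst e, fst (P e))) ` E \<subseteq> {..<N} \<times> {..<N}" "(\<lambda>e. (fst e, fst (Q e))) ` F \<subseteq> {..<N} \<times> {..<N}"
      using that fE fF permutes_in_image[of P E] permutes_in_image[of Q F] by (auto, (metis fst_conv)+)
    from wick_formula[OF finE finF _ this] show ?thesis by (simp add: ginibre_def)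
  qed
  note wick = wick[THEN conjunct1] wick[THEN conjunct2]
  show "integrable (ginibre N) (\<lambda>G. D E G * cnj (D F G))"
    unfolding DD by (intro Bochner_Integration.integrable_sum integrable_mult_right wick) auto
  have card: "of_nat (card (pairings E F (\<lambda>e. (fst e, fst (P e))) (\<lambda>e. (fst e, fst (Q e))))) =
     (\<Sum>M\<in>row_bijections E F. of_bool (\<forall>e\<in>E. fst (Q (M e)) = fst (P e)) :: complex)" for P Q
  proof -
    have "pairings E F (\<lambda>e. (fst e, fst (P e))) (\<lambda>e. (fst e, fst (Q e))) =
      {M \<in> row_bijections E F. \<forall>e\<in>E. fst (Q (M e)) = fst (P e)}"
      by (auto simp: pairings_def row_bijections_def)
    moreover have "finite (row_bijections E F)"
      unfolding row_bijections_def using finE finF by (intro finite_subset[OF _ finite_PiE[of E "\<lambda>_. F"]]) auto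
    ultimately show ?thesis by (simp only: card_eq_sum_of_bool)
  qed
  have "(\<integral>G. D E G * cnj (D F G) \<partial>ginibre N) = (\<Sum>P\<in>?P E. \<Sum>Q\<in>?P F. (of_int (sign P) * ?b E P * (of_int (sign Q) * ?b F Q)) *
      of_nat (card (pairings E F (\<lambda>e. (fst e, fst (P e))) (\<lambda>e. (fst e, fst (Q e))))))"
    unfolding DD
    by (subst Bochner_Integration.integral_sum; (intro Bochner_Integration.integrable_sum integrable_mult_right wick sum.cong refl)?)
       (auto simp: Bochner_Integration.integral_sum wick intro!: sum.cong)
  also have "\<dots> = (\<Sum>P\<in>?P E. of_int (sign P) * ?b E P *
      (\<Sum>M\<in>row_bijections E F. \<Sum>Q\<in>?P F. of_int (sign Q) * ?b F Q * of_bool (\<forall>e\<in>E. fst (Q (M e)) = fst (P e))))"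
    unfolding card
    by (simp only: sum_distrib_left mult.assoc) (intro sum.cong refl sum.swap)
  also have "\<dots> = (\<Sum>P\<in>?P E. of_int (sign P) * of_bool (\<forall>e\<in>E. snd (P e) = snd e) *
        (\<Sum>M\<in>row_bijections E F. \<Sum>\<rho>\<in>?P E. of_int (sign \<rho>) *
          of_bool (row_match E P (\<lambda>e\<in>E. snd (M e)) \<rho>)))"
  proof (rule sum.cong[OF refl], rule arg_cong2[of _ _ _ _ "(*)"], goal_cases)
    case (1 P)
    show ?case by (simp add: eq_commute)
  next
    case (2 P)
    show ?case
    proof (rule sum.cong[OF refl])
    fix M assume M: "M \<in> row_bijections E F"
    have inj: "inj_on M E" and FM: "F = M ` E" and fM: "\<And>e. e \<in> E \<Longrightarrow> fst (M e) = fst e"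
      using M by (auto simp: row_bijections_def bij_betw_def)
    have "(\<Sum>Q\<in>?P F. of_int (sign Q) * ?b F Q * of_bool (\<forall>e\<in>E. fst (Q (M e)) = fst (P e))) =
      (\<Sum>\<rho>\<in>?P E. of_int (sign (map_permutation E M \<rho>)) * ?b (M ` E) (map_permutation E M \<rho>) *
        of_bool (\<forall>e\<in>E. fst (map_permutation E M \<rho> (M e)) = fst (P e)))"
      unfolding FM by (rule sum_permutes_image[OF inj finE])
    also have "\<dots> = (\<Sum>\<rho>\<in>?P E. of_int (sign \<rho>) *
          of_bool (row_match E P (\<lambda>e\<in>E. snd (M e)) \<rho>))"
    proof (rule sum.cong[OF refl])
      fix \<rho> assume "\<rho> \<in> ?P E"
      hence r: "\<rho> permutes E" by simp
      have rE: "\<rho> e \<in> E" if "e \<in> E" for e using permutes_in_image[OF r] that by simp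
      have "(\<forall>e\<in>M ` E. snd e = snd (map_permutation E M \<rho> e)) \<longleftrightarrow> (\<forall>e\<in>E. (\<lambda>e\<in>E. snd (M e)) (\<rho> e) = (\<lambda>e\<in>E. snd (M e)) e)"
        using rE by (auto simp: map_permutation_apply[OF inj])
      moreover have "(\<forall>e\<in>E. fst (map_permutation E M \<rho> (M e)) = fst (P e)) \<longleftrightarrow> (\<forall>e\<in>E. fst (\<rho> e) = fst (P e))"
        using rE fM by (auto simp: map_permutation_apply[OF inj])
      ultimately show "of_int (sign (map_permutation E M \<rho>)) * ?b (M ` E) (map_permutation E M \<rho>) *
        of_bool (\<forall>e\<in>E. fst (map_permutation E M \<rho> (M e)) = fst (P e)) =
        of_int (sign \<rho>) *
          of_bool (row_match E P (\<lambda>e\<in>E. snd (M e)) \<rho>)"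
        by (simp only: sign_map_permutation[OF inj r finE] of_bool_conj mult_ac)
    qed
    finally show "(\<Sum>Q\<in>?P F. of_int (sign Q) * ?b F Q * of_bool (\<forall>e\<in>E. fst (Q (M e)) = fst (P e))) =
      (\<Sum>\<rho>\<in>?P E. of_int (sign \<rho>) *
          of_bool (row_match E P (\<lambda>e\<in>E. snd (M e)) \<rho>))" .
    qed
  qed
  finally show "(\<integral>G. D E G * cnj (D F G) \<partial>ginibre N) =
      (\<Sum>P\<in>{P. P permutes E}. of_int (sign P) * of_bool (\<forall>e\<in>E. snd (P e) = snd e) *
        (\<Sum>M\<in>row_bijections E F. \<Sum>\<rho>\<in>{\<rho>. \<rho> permutes E}. of_int (sign \<rho>) *
          of_bool (row_match E P (\<lambda>e\<in>E. snd (M e)) \<rho>)))" .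
qed

definition shift_diag :: "complex \<Rightarrow> (nat \<times> nat \<Rightarrow> complex) \<Rightarrow> nat \<times> nat \<Rightarrow> complex" where
  "shift_diag c A = (\<lambda>(i, j). A (i, j) + (if i = j then c else 0))"

text \<open>Both determinants are expanded in principal minors of the pure Gaussian part. Summing
  over the index set of the conjugated minor releases the image of the pairing, and each remaining
  coefficient is a \<open>dual_sum\<close>.\<close>

theorem ginibre_duality:
  shows "integrable (ginibre N) (\<lambda>G. cdet N (shift_diag z G) ^ k * cnj (cdet N (shift_diag z G) ^ k))"
    and "integrable (PiM (sq k) (\<lambda>_. std_cgauss)) (\<lambda>X. cdet k (shift_diag (of_real ((cmod z)\<^sup>2)) (gram k X)) ^ N)"
    and "(\<integral>G. cdet N (shift_diag z G) ^ k * cnj (cdet N (shift_diag z G) ^ k) \<partial>ginibre N) =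
      (\<integral>X. cdet k (shift_diag (of_real ((cmod z)\<^sup>2)) (gram k X)) ^ N \<partial>PiM (sq k) (\<lambda>_. std_cgauss))"
proof -
  let ?U = "{..<N} \<times> {..<k}"
  define s where "s = complex_of_real ((cmod z)\<^sup>2)"
  have s: "s = z * cnj z" unfolding s_def by (rule complex_norm_square)
  define D where "D = (\<lambda>(E :: (nat \<times> nat) set) G. sdet E (\<lambda>e f. if snd e = snd f then G (fst e, fst f) else 0 :: complex))"
  define C where "C = (\<lambda>(E :: (nat \<times> nat) set) X. sdet E (\<lambda>e f. if fst e = fst f then gram k X (snd e, snd f) else 0))"
  have L: "cdet N (shift_diag z G) ^ k = (\<Sum>E\<in>Pow ?U. z ^ card (?U - E) * D E G)" for G
    unfolding cdet_power_eq_sdet D_def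
    by (subst sdet_add_diag[symmetric]) (auto intro!: sdet_cong simp: shift_diag_def)
  have R: "cdet k (shift_diag s (gram k X)) ^ N = (\<Sum>E\<in>Pow ?U. s ^ card (?U - E) * C E X)" for X
    unfolding cdet_power_eq_sdet'[of k _ N] C_def
    by (subst sdet_add_diag[symmetric]) (auto intro!: sdet_cong simp: shift_diag_def)
  have LL: "cdet N (shift_diag z G) ^ k * cnj (cdet N (shift_diag z G) ^ k) =
     (\<Sum>E\<in>Pow ?U. \<Sum>F\<in>Pow ?U. (z ^ card (?U - E) * cnj z ^ card (?U - F)) * (D E G * cnj (D F G)))" for G
    unfolding L cnj_sum sum_product by (intro sum.cong refl) (simp add: mult_ac)
  have iD: "integrable (ginibre N) (\<lambda>G. D E G * cnj (D F G))" if "E \<in> Pow ?U" "F \<in> Pow ?U" for E F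
    unfolding D_def by (rule integral_sdet_ginibre_prod) (use that in auto)
  have iC: "integrable (PiM (sq k) (\<lambda>_. std_cgauss)) (C E)" "(\<integral>X. C E X \<partial>PiM (sq k) (\<lambda>_. std_cgauss)) = dual_sum k E"
    if "E \<in> Pow ?U" for E
    unfolding C_def using that by (auto intro!: integral_sdet_gram[of E N k])
  show "integrable (ginibre N) (\<lambda>G. cdet N (shift_diag z G) ^ k * cnj (cdet N (shift_diag z G) ^ k))"
    unfolding LL by (intro Bochner_Integration.integrable_sum integrable_mult_right iD)
  show "integrable (PiM (sq k) (\<lambda>_. std_cgauss)) (\<lambda>X. cdet k (shift_diag (of_real ((cmod z)\<^sup>2)) (gram k X)) ^ N)"
    unfolding s_def[symmetric] R by (intro Bochner_Integration.integrable_sum integrable_mult_right iC)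
  have "(\<integral>G. cdet N (shift_diag z G) ^ k * cnj (cdet N (shift_diag z G) ^ k) \<partial>ginibre N) =
    (\<Sum>E\<in>Pow ?U. \<Sum>F\<in>Pow ?U. (z ^ card (?U - E) * cnj z ^ card (?U - F)) * (\<integral>G. D E G * cnj (D F G) \<partial>ginibre N))"
    unfolding LL
    by (subst Bochner_Integration.integral_sum; (intro Bochner_Integration.integrable_sum integrable_mult_right iD sum.cong refl)?; assumption?)
       (auto simp: Bochner_Integration.integral_sum iD intro!: sum.cong)
  also have "\<dots> = (\<Sum>E\<in>Pow ?U. s ^ card (?U - E) * dual_sum k E)"
  proof (rule sum.cong[OF refl])
    fix E assume E: "E \<in> Pow ?U"
    let ?P = "{p. p permutes E}"
    define h where "h P \<sigma> = (\<Sum>\<rho>\<in>?P. of_int (sign \<rho>) *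
          of_bool (row_match E P \<sigma> \<rho>) :: complex)"
      for P :: "nat \<times> nat \<Rightarrow> nat \<times> nat" and \<sigma> :: "nat \<times> nat \<Rightarrow> nat"
    have finE: "finite E" using E finite_subset by blast
    have "(\<Sum>F\<in>Pow ?U. (z ^ card (?U - E) * cnj z ^ card (?U - F)) * (\<integral>G. D E G * cnj (D F G) \<partial>ginibre N)) =
      (\<Sum>F\<in>Pow ?U. s ^ card (?U - E) * (\<integral>G. D E G * cnj (D F G) \<partial>ginibre N))"
    proof (rule sum.cong[OF refl])
      fix F assume F: "F \<in> Pow ?U"
      show "(z ^ card (?U - E) * cnj z ^ card (?U - F)) * (\<integral>G. D E G * cnj (D F G) \<partial>ginibre N) =
        s ^ card (?U - E) * (\<integral>G. D E G * cnj (D F G) \<partial>ginibre N)"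
      \<comment> \<open>Minors of different sizes are uncorrelated, since no bijection pairs them;
        for equal sizes the powers of \<open>z\<close> and \<open>cnj z\<close> combine to a power
        of \<open>s\<close>.\<close>
      proof (cases "card F = card E")
        case True
        have "card (?U - F) = card (?U - E)"
          using E F True by (simp add: card_Diff_subset finite_subset)
        thus ?thesis by (simp add: s power_mult_distrib)
      next
        case False
        hence "row_bijections E F = {}" by (auto simp: row_bijections_def dest: bij_betw_same_card)
        hence "(\<integral>G. D E G * cnj (D F G) \<partial>ginibre N) = 0"
          unfolding D_def using E F by (subst integral_sdet_ginibre_prod[of E N k F]) auto
        thus ?thesis by simp
      qed
    qed
    also have "\<dots> = s ^ card (?U - E) * (\<Sum>F\<in>Pow ?U. \<Sum>P\<in>?P. of_int (sign P) * of_bool (\<forall>e\<in>E. snd (P e) = snd e) *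
        (\<Sum>M\<in>row_bijections E F. h P (\<lambda>e\<in>E. snd (M e))))"
      unfolding sum_distrib_left[symmetric] h_def D_def using E
      by (intro arg_cong2[of _ _ _ _ "(*)"] refl sum.cong integral_sdet_ginibre_prod[of E N k]) auto
    also have "(\<Sum>F\<in>Pow ?U. \<Sum>P\<in>?P. of_int (sign P) * of_bool (\<forall>e\<in>E. snd (P e) = snd e) *
        (\<Sum>M\<in>row_bijections E F. h P (\<lambda>e\<in>E. snd (M e)))) =
      (\<Sum>P\<in>?P. of_int (sign P) * of_bool (\<forall>e\<in>E. snd (P e) = snd e) *
        (\<Sum>F\<in>Pow ?U. \<Sum>M\<in>row_bijections E F. h P (\<lambda>e\<in>E. snd (M e))))"
      unfolding sum_distrib_left[of _ _ "Pow ?U"] by (rule sum.swap)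
    also have "\<dots> = dual_sum k E"
      unfolding dual_sum_injective[OF finE] h_def[symmetric] using E by (subst sum_row_bijections) auto
    finally show "(\<Sum>F\<in>Pow ?U. (z ^ card (?U - E) * cnj z ^ card (?U - F)) * (\<integral>G. D E G * cnj (D F G) \<partial>ginibre N)) =
      s ^ card (?U - E) * dual_sum k E" .
  qed
  also have "\<dots> = (\<integral>X. cdet k (shift_diag s (gram k X)) ^ N \<partial>PiM (sq k) (\<lambda>_. std_cgauss))"
    unfolding R
    by (subst Bochner_Integration.integral_sum) (auto intro!: sum.cong integrable_mult_right iC simp: iC)
  finally show "(\<integral>G. cdet N (shift_diag z G) ^ k * cnj (cdet N (shift_diag z G) ^ k) \<partial>ginibre N) =
      (\<integral>X. cdet k (shift_diag (of_real ((cmod z)\<^sup>2)) (gram k X)) ^ N \<partial>PiM (sq k) (\<lambda>_. std_cgauss))"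
    by (simp only: s_def)
qed

subsection \<open>The rescaled Hermitian integral\<close>

lemma cdet_scale: "cdet k (\<lambda>e. c * A e) = c ^ k * cdet k A"
  unfolding cdet_def by (simp add: prod.distrib sum_distrib_left mult_ac)

lemma qform_gram_nonneg: "0 \<le> Re (qform k (gram k X) v)"
proof -
  have "qform k (gram k X) v = (\<Sum>i<k. \<Sum>j<k. \<Sum>l<k. (cnj (v i) * X (i, l)) * cnj (cnj (v j) * X (j, l)))"
    unfolding qform_def
    by (intro sum.cong refl) (simp add: gram_def sum_distrib_left sum_distrib_right mult_ac)
  also have "\<dots> = (\<Sum>l<k. \<Sum>i<k. \<Sum>j<k. (cnj (v i) * X (i, l)) * cnj (cnj (v j) * X (j, l)))"
    by (subst (2) sum.swap, subst sum.swap, intro sum.cong refl)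
  also have "\<dots> = (\<Sum>l<k. (\<Sum>i<k. cnj (v i) * X (i, l)) * cnj (\<Sum>i<k. cnj (v i) * X (i, l)))"
    unfolding cnj_sum sum_product ..
  also have "\<dots> = of_real (\<Sum>l<k. (cmod (\<Sum>i<k. cnj (v i) * X (i, l)))\<^sup>2)"
    by (simp only: complex_norm_square of_real_sum)
  finally show ?thesis by (simp add: sum_nonneg)
qed

lemma hermitian_gram: "hermitian k (gram k X)"
  unfolding hermitian_def by (auto simp: gram_def mult.commute)

lemma hermitian_shift_diag: "hermitian k A \<Longrightarrow> hermitian k (shift_diag (of_real s) A)"
  unfolding hermitian_def[of k "shift_diag _ _"] by (auto simp: shift_diag_def hermitianD)

lemma qform_shift_diag:
  "Re (qform k (shift_diag (of_real s) A) v) = Re (qform k A v) + s * (\<Sum>i<k. (cmod (v i))\<^sup>2)"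
proof -
  have "shift_diag (of_real s) A = cshift s (\<lambda>e. - A e)"
    by (auto simp: fun_eq_iff shift_diag_def cshift_def)
  thus ?thesis by (simp add: qform_cshift) (simp add: qform_def sum_negf)
qed

lemma cdet_shift_gram_nonneg:
  assumes "s \<ge> 0"
  shows "cdet k (shift_diag (of_real s) (gram k X)) = of_real (Re (cdet k (shift_diag (of_real s) (gram k X))))"
    and "0 \<le> Re (cdet k (shift_diag (of_real s) (gram k X)))"
proof -
  have psd: "0 \<le> Re (qform k (shift_diag (of_real s) (gram k X)) v)" for v
    unfolding qform_shift_diag using assms qform_gram_nonneg[of k X v] by (auto intro!: add_nonneg_nonneg mult_nonneg_nonneg sum_nonneg)
  note h = hermitian_shift_diag[OF hermitian_gram]
  show "cdet k (shift_diag (of_real s) (gram k X)) = of_real (Re (cdet k (shift_diag (of_real s) (gram k X))))"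
    and "0 \<le> Re (cdet k (shift_diag (of_real s) (gram k X)))"
    using cdet_psd_nonneg[OF h psd] by auto
qed

lemma measurable_shift_diag [measurable (raw)]:
  assumes "X \<in> N \<rightarrow>\<^sub>M matM"
  shows "(\<lambda>x. shift_diag c (X x)) \<in> N \<rightarrow>\<^sub>M matM"
proof (rule measurable_matM)
  have [measurable]: "(\<lambda>x. X x e) \<in> borel_measurable N" for e
    using measurable_PiM_comp[OF assms, of e] by auto
  show "(\<lambda>x. shift_diag c (X x) (i, j)) \<in> borel_measurable N" for i j
    unfolding shift_diag_def by (cases "i = j") auto
qed

lemma measurable_cshift [measurable (raw)]:
  assumes "X \<in> N \<rightarrow>\<^sub>M matM"
  shows "(\<lambda>x. cshift c (X x)) \<in> N \<rightarrow>\<^sub>M matM"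
proof (rule measurable_matM)
  have [measurable]: "(\<lambda>x. X x e) \<in> borel_measurable N" for e
    using measurable_PiM_comp[OF assms, of e] by auto
  show "(\<lambda>x. cshift c (X x) (i, j)) \<in> borel_measurable N" for i j
    unfolding cshift_def by (cases "i = j") auto
qed

lemma pred_posdef_cshift [measurable (raw)]:
  assumes X: "X \<in> N \<rightarrow>\<^sub>M leb (sq k)"
  shows "Measurable.pred N (\<lambda>x. posdef k (cshift t (hmat k (X x))))"
proof (rule pred_posdef)
  show "(\<lambda>x. cshift t (hmat k (X x)) (i, j)) \<in> borel_measurable N" for i j
    using measurable_PiM_comp[OF measurable_cshift[OF measurable_hmat[OF X]], of "(i, j)"] by simp
qed (intro hermitian_cshift hermitian_hmat)

text \<open>The integrand after centring and scaling, normalised so that it tends to the GUE weight.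
  Its cutoff is the domain belonging to \<open>z = 0\<close>, which contains the domains of all
  other \<open>z\<close>.\<close>

definition phi :: "nat \<Rightarrow> nat \<Rightarrow> (nat \<times> nat \<Rightarrow> real) \<Rightarrow> real" where
  "phi k N y = (if posdef k (cshift (sqrt (real N)) (hmat k y))
     then Re (cdet k (\<lambda>e. cshift (sqrt (real N)) (hmat k y) e / of_real (sqrt (real N)))) ^ N
       * exp (sqrt (real N) * ctrace k (hmat k y)) else 0)"

lemma posdef_scale:
  assumes "c > 0"
  shows "posdef k (\<lambda>e. of_real c * A e) \<longleftrightarrow> posdef k A"
proof -
  have "qform k (\<lambda>e. of_real c * A e) v = of_real c * qform k A v" for v
    unfolding qform_def sum_distrib_left by (intro sum.cong refl) (simp add: mult_ac)
  thus ?thesis using assms by (simp add: posdef_def zero_less_mult_iff)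
qed

lemma phi_nonneg: "0 \<le> phi k N y"
proof (cases "N = 0")
  case False
  hence s: "0 < 1 / sqrt (real N)" by simp
  let ?A = "\<lambda>e. of_real (1 / sqrt (real N)) * cshift (sqrt (real N)) (hmat k y) e"
  show ?thesis
  proof (cases "posdef k (cshift (sqrt (real N)) (hmat k y))")
    case True
    hence "posdef k ?A" using posdef_scale[OF s] by simp
    moreover have "hermitian k ?A"
      using hermitianD[OF hermitian_cshift[OF hermitian_hmat]] unfolding hermitian_def by auto
    ultimately have "0 < Re (cdet k ?A)" using cdet_posdef by blast
    thus ?thesis using True by (simp add: phi_def)
  qed (simp add: phi_def)
qed (simp add: phi_def)

lemma measurable_phi [measurable]: "phi k N \<in> borel_measurable (leb (sq k))"
proof -
  have "(\<lambda>y. (\<lambda>e. cshift (sqrt (real N)) (hmat k y) e / of_real (sqrt (real N)))) \<in> leb (sq k) \<rightarrow>\<^sub>M matM"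
  proof (rule measurable_matM)
    have [measurable]: "(\<lambda>y. cshift (sqrt (real N)) (hmat k y) e) \<in> borel_measurable (leb (sq k))" for e
      using measurable_PiM_comp[OF measurable_cshift[OF measurable_hmat[OF measurable_ident]], of e _ k] by simp
    show "(\<lambda>y. cshift (sqrt (real N)) (hmat k y) (i, j) / of_real (sqrt (real N))) \<in> borel_measurable (leb (sq k))" for i j
      by measurable
  qed
  hence [measurable]: "(\<lambda>y. cdet k (\<lambda>e. cshift (sqrt (real N)) (hmat k y) e / of_real (sqrt (real N)))) \<in> borel_measurable (leb (sq k))"
    by (rule measurable_cdet_matM)
  show ?thesis unfolding phi_def by measurable
qed

text \<open>Stated for every \<open>r \<ge> 0\<close>, since it is used three times: with
  \<open>r\<close> the squared modulus of \<open>z\<close> for the moment, with \<open>r = 0\<close>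
  for the total mass, and with \<open>N = 1\<close> for a nullity argument. The Jacobian is sqrt N
  to the power k^2, and \<open>real N ^ (N * k)\<close> comes out of the determinant.\<close>

lemma nn_integral_det_exp_rescale:
  assumes N: "N \<ge> 1" and r: "r \<ge> 0"
  shows "(\<integral>\<^sup>+x. (if posdef k (hmat k x) then ennreal (exp (- ctrace k (hmat k x))) *
      ennreal (Re (cdet k (shift_diag (of_real (real N * r)) (hmat k x))) ^ N) else 0) \<partial>leb (sq k)) =
    ennreal (real N ^ (N * k) * sqrt (real N) ^ (k * k) * exp (- (real k * real N * (1 - r)))) *
      (\<integral>\<^sup>+y. (if posdef k (cshift (sqrt (real N) * (1 - r)) (hmat k y)) then ennreal (phi k N y) else 0) \<partial>leb (sq k))"
proof -
  define q where "q = sqrt (real N)"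
  have q: "q > 0" "q * q = real N" using N by (auto simp: q_def)
  let ?F = "\<lambda>x. if posdef k (hmat k x) then ennreal (exp (- ctrace k (hmat k x))) *
      ennreal (Re (cdet k (shift_diag (of_real (real N * r)) (hmat k x))) ^ N) else 0"
  \<comment> \<open>The shift to the saddle, which only moves diagonal coordinates; the factor
    \<open>- q\<close> reverses orientation so that positivity becomes an upper bound on the new
    matrix.\<close>
  define T :: "nat \<times> nat \<Rightarrow> real" where "T = (\<lambda>(i, j). if i = j then real N * (1 - r) else 0)"
  let ?T = "\<lambda>y. \<lambda>e\<in>sq k. T e + (- q) * y e"
  have h: "hmat k (?T y) (i, j) = of_real q * cshift (q * (1 - r)) (hmat k y) (i, j)" if "i < k" "j < k" for y i j
    using that by (cases i j rule: linorder_cases)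
      (auto simp: hmat_def herm_of_def cshift_def T_def complex_eq_iff algebra_simps q(2)[symmetric])
  have pd: "posdef k (hmat k (?T y)) \<longleftrightarrow> posdef k (cshift (q * (1 - r)) (hmat k y))" for y
    using posdef_scale[OF q(1), of k "cshift (q * (1 - r)) (hmat k y)"] posdef_cong[of k "hmat k (?T y)", OF h] by simp
  have tr: "ctrace k (hmat k (?T y)) = real k * real N * (1 - r) - q * ctrace k (hmat k y)" for y
  proof -
    have "ctrace k (hmat k (?T y)) = (\<Sum>i<k. q * (q * (1 - r) - Re (hmat k y (i, i))))"
      unfolding ctrace_def Re_sum
    proof (rule sum.cong[OF refl])
      fix i assume "i \<in> {..<k}"
      hence i: "i < k" by simp
      show "Re (hmat k (?T y) (i, i)) = q * (q * (1 - r) - Re (hmat k y (i, i)))"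
        unfolding h[OF i i] by (simp add: cshift_def)
    qed
    thus ?thesis
      by (simp add: ctrace_def right_diff_distrib sum_subtractf sum_distrib_left q(2)[symmetric])
  qed
  have det: "cdet k (shift_diag (of_real (real N * r)) (hmat k (?T y))) =
      of_real (real N) ^ k * cdet k (\<lambda>e. cshift q (hmat k y) e / of_real q)" for y
    unfolding cdet_scale[symmetric]
  proof (rule cdet_cong)
    fix i j assume ij: "i < k" "j < k"
    show "shift_diag (of_real (real N * r)) (hmat k (?T y)) (i, j) = of_real (real N) * (cshift q (hmat k y) (i, j) / of_real q)"
      using q(1) unfolding shift_diag_def prod.case h[OF ij] q(2)[symmetric]
      by (cases "i = j") (auto simp: cshift_def field_simps)
  qed
  have "(\<integral>\<^sup>+x. ?F x \<partial>leb (sq k)) = ennreal \<bar>- q\<bar> ^ card (sq k) * (\<integral>\<^sup>+y. ?F (?T y) \<partial>leb (sq k))"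
    by (rule nn_integral_leb_affine_real) (use q in auto)
  also have "(\<integral>\<^sup>+y. ?F (?T y) \<partial>leb (sq k)) = (\<integral>\<^sup>+y. ennreal (real N ^ (N * k) * exp (- (real k * real N * (1 - r)))) *
      (if posdef k (cshift (q * (1 - r)) (hmat k y)) then ennreal (phi k N y) else 0) \<partial>leb (sq k))"
  proof (rule nn_integral_cong)
    fix y
    show "?F (?T y) = ennreal (real N ^ (N * k) * exp (- (real k * real N * (1 - r)))) *
      (if posdef k (cshift (q * (1 - r)) (hmat k y)) then ennreal (phi k N y) else 0)"
    proof (cases "posdef k (cshift (q * (1 - r)) (hmat k y))")
      case True
      \<comment> \<open>Here \<open>r \<ge> 0\<close> enters: the domain for \<open>r\<close> lies
        inside the cutoff built into \<open>phi\<close>.\<close>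
      have "q * (1 - r) \<le> q" using q r by simp
      hence pq: "posdef k (cshift q (hmat k y))" by (rule posdef_cshift_mono[OF True])
      have "Re (cdet k (shift_diag (of_real (real N * r)) (hmat k (?T y)))) =
          real N ^ k * Re (cdet k (\<lambda>e. cshift q (hmat k y) e / of_real q))"
        unfolding det by (simp flip: of_real_power)
      hence "exp (- ctrace k (hmat k (?T y))) * Re (cdet k (shift_diag (of_real (real N * r)) (hmat k (?T y)))) ^ N =
        real N ^ (N * k) * exp (- (real k * real N * (1 - r))) * phi k N y"
        unfolding phi_def q_def[symmetric] tr
      proof -
        have "exp (- (real k * real N * (1 - r) - q * t)) = exp (- (real k * real N * (1 - r))) * exp (q * t)" for t
          by (simp flip: exp_add)
        thus "exp (- (real k * real N * (1 - r) - q * ctrace k (hmat k y))) *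
            Re (cdet k (shift_diag (of_real (real N * r)) (hmat k (?T y)))) ^ N =
          real N ^ (N * k) * exp (- (real k * real N * (1 - r))) *
            (if posdef k (cshift q (hmat k y)) then Re (cdet k (\<lambda>e. cshift q (hmat k y) e / of_real q)) ^ N
               * exp (q * ctrace k (hmat k y)) else 0)"
          using pq \<open>Re (cdet k (shift_diag _ (hmat k (?T y)))) = _\<close>
          by (simp only: power_mult_distrib power_mult[symmetric] mult.commute[of k N] if_True) (simp only: mult_ac)
      qed
      hence "ennreal (exp (- ctrace k (hmat k (?T y)))) * ennreal (Re (cdet k (shift_diag (of_real (real N * r)) (hmat k (?T y)))) ^ N) =
         ennreal (real N ^ (N * k) * exp (- (real k * real N * (1 - r)))) * ennreal (phi k N y)"
        by (simp flip: ennreal_mult')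
      thus ?thesis using True by (simp only: pd if_True)
    next
      case False
      thus ?thesis by (simp only: pd if_False mult_zero_right)
    qed
  qed
  also have "\<dots> = ennreal (real N ^ (N * k) * exp (- (real k * real N * (1 - r)))) *
      (\<integral>\<^sup>+y. (if posdef k (cshift (q * (1 - r)) (hmat k y)) then ennreal (phi k N y) else 0) \<partial>leb (sq k))"
    by (rule nn_integral_cmult) measurable
  also have "ennreal \<bar>- q\<bar> ^ card (sq k) * (ennreal (real N ^ (N * k) * exp (- (real k * real N * (1 - r)))) * J) =
      ennreal (real N ^ (N * k) * q ^ (k * k) * exp (- (real k * real N * (1 - r)))) * J" for J
  proof -
    have "ennreal \<bar>- q\<bar> ^ card (sq k) = ennreal (q ^ (k * k))"
      using q(1) by (simp add: card_cartesian_product ennreal_power)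
    moreover have "ennreal (q ^ (k * k)) * ennreal (real N ^ (N * k) * exp (- (real k * real N * (1 - r)))) =
        ennreal (real N ^ (N * k) * q ^ (k * k) * exp (- (real k * real N * (1 - r))))"
      using q(1) by (subst ennreal_mult'[symmetric]) (simp_all add: mult_ac)
    ultimately show ?thesis by (simp only: mult.assoc[symmetric])
  qed
  finally show ?thesis unfolding q_def .
qed

definition gauss_const :: "nat \<Rightarrow> real" where
  "gauss_const k = wishart_const k / pi ^ (k * k)"

lemma gauss_const_pos: "gauss_const k > 0"
  unfolding gauss_const_def wishart_const_def by (auto intro!: divide_pos_pos prod_pos)

text \<open>Nonnegativity is stated as well because the identity lives in the extended nonnegative
  reals and is later read back in the reals.\<close>

proposition ginibre_moment_eq:
  assumes N: "N \<ge> 1"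
  shows "ennreal (ginibre_moment N k z) =
    ennreal (gauss_const k * sqrt (real N) ^ (k * k) * exp (real N * real k * ((cmod z)\<^sup>2 - 1))) *
     (\<integral>\<^sup>+y. (if posdef k (cshift (sqrt (real N) * (1 - (cmod z)\<^sup>2)) (hmat k y)) then ennreal (phi k N y) else 0) \<partial>leb (sq k))"
    and "ginibre_moment N k z \<ge> 0"
proof -
  define q where "q = sqrt (real N)"
  have q: "q > 0" "q * q = real N" using N by (auto simp: q_def)
  \<comment> \<open>Pulling 1 / sqrt N out of the matrix turns the shift by \<open>- z\<close> into
    a shift by \<open>\<zeta>\<close> and costs the factor 1 / N^(N k), which the rescaling of the
    dual integral gives back.\<close>
  define \<zeta> where "\<zeta> = - (of_real q * z)"
  define s where "s = real N * (cmod z)\<^sup>2"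
  have s: "(cmod \<zeta>)\<^sup>2 = s" and s0: "s \<ge> 0"
    using q by (auto simp: \<zeta>_def s_def norm_mult power_mult_distrib power2_eq_square)
  let ?X = "\<lambda>X. Re (cdet k (shift_diag (of_real s) (gram k X))) ^ N"
  have det: "cdet N (\<lambda>(i, j). G (i, j) / of_real (sqrt (real N)) - (if i = j then z else 0)) =
      of_real (1 / q) ^ N * cdet N (shift_diag \<zeta> G)" for G
    unfolding cdet_scale[symmetric] q_def[symmetric]
    by (rule cdet_cong) (use q in \<open>auto simp: shift_diag_def \<zeta>_def field_simps\<close>)
  have pw: "cmod (cdet N (\<lambda>(i, j). G (i, j) / of_real (sqrt (real N)) - (if i = j then z else 0))) ^ (2 * k) =
     (1 / real N ^ (N * k)) * Re (cdet N (shift_diag \<zeta> G) ^ k * cnj (cdet N (shift_diag \<zeta> G) ^ k))" for G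
  proof -
    let ?w = "cdet N (shift_diag \<zeta> G)"
    have "Re (?w ^ k * cnj (?w ^ k)) = cmod ?w ^ (2 * k)"
      unfolding complex_norm_square[symmetric] by (simp add: norm_power power_mult[symmetric] mult.commute)
    moreover have "(1 / q) ^ (N * (2 * k)) = 1 / real N ^ (N * k)"
      unfolding q(2)[symmetric] by (simp add: power_divide power_mult_distrib power_mult[symmetric] mult_2 power_add distrib_left)
    ultimately show ?thesis
      unfolding det using q(1) by (simp add: norm_mult norm_power norm_divide power_mult_distrib power_mult[symmetric] power_divide)
  qed
  have "ginibre_moment N k z = (1 / real N ^ (N * k)) * (\<integral>G. Re (cdet N (shift_diag \<zeta> G) ^ k * cnj (cdet N (shift_diag \<zeta> G) ^ k)) \<partial>ginibre N)"
    unfolding ginibre_moment_def pw by simp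
  also have "(\<integral>G. Re (cdet N (shift_diag \<zeta> G) ^ k * cnj (cdet N (shift_diag \<zeta> G) ^ k)) \<partial>ginibre N) =
    Re (\<integral>G. cdet N (shift_diag \<zeta> G) ^ k * cnj (cdet N (shift_diag \<zeta> G) ^ k) \<partial>ginibre N)"
    by (rule integral_Re[OF ginibre_duality(1)])
  also have "\<dots> = Re (\<integral>X. cdet k (shift_diag (of_real s) (gram k X)) ^ N \<partial>PiM (sq k) (\<lambda>_. std_cgauss))"
    by (subst ginibre_duality(3)) (simp only: s)
  also have "\<dots> = (\<integral>X. Re (cdet k (shift_diag (of_real s) (gram k X)) ^ N) \<partial>PiM (sq k) (\<lambda>_. std_cgauss))"
    by (rule integral_Re[OF ginibre_duality(2)[where z = \<zeta>, unfolded s], symmetric])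
  also have "\<dots> = (\<integral>X. ?X X \<partial>PiM (sq k) (\<lambda>_. std_cgauss))"
  proof (rule Bochner_Integration.integral_cong[OF refl])
    fix X
    show "Re (cdet k (shift_diag (of_real s) (gram k X)) ^ N) = ?X X"
      by (subst cdet_shift_gram_nonneg(1)[OF s0]) (simp flip: of_real_power)
  qed
  finally have gm: "ginibre_moment N k z = (1 / real N ^ (N * k)) * (\<integral>X. ?X X \<partial>PiM (sq k) (\<lambda>_. std_cgauss))" .
  have int: "integrable (PiM (sq k) (\<lambda>_. std_cgauss)) ?X"
  proof -
    have "integrable (PiM (sq k) (\<lambda>_. std_cgauss)) (\<lambda>X. Re (cdet k (shift_diag (of_real s) (gram k X)) ^ N))"
      by (rule integrable_Re[OF ginibre_duality(2)[where z = \<zeta>, unfolded s]])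
    moreover have "Re (cdet k (shift_diag (of_real s) (gram k X)) ^ N) = ?X X" for X
      by (subst cdet_shift_gram_nonneg(1)[OF s0]) (simp flip: of_real_power)
    ultimately show ?thesis by simp
  qed
  have X0: "?X X \<ge> 0" for X using cdet_shift_gram_nonneg(2)[OF s0] by simp
  show "ginibre_moment N k z \<ge> 0"
    unfolding gm using X0 by (intro mult_nonneg_nonneg Bochner_Integration.integral_nonneg) auto
  have "ennreal (\<integral>X. ?X X \<partial>PiM (sq k) (\<lambda>_. std_cgauss)) = (\<integral>\<^sup>+X. ennreal (?X X) \<partial>PiM (sq k) (\<lambda>_. std_cgauss))"
    by (rule nn_integral_eq_integral[symmetric]) (use int X0 in auto)
  also have "\<dots> = ennreal (gauss_const k) * (\<integral>\<^sup>+x. (if posdef k (hmat k x) then ennreal (exp (- ctrace k (hmat k x))) *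
     ennreal (Re (cdet k (shift_diag (of_real s) (hmat k x))) ^ N) else 0) \<partial>leb (sq k))"
    unfolding gauss_const_def
    by (rule nn_integral_gauss_gram[where f = "\<lambda>S. ennreal (Re (cdet k (shift_diag (of_real s) S)) ^ N)"]) measurable
  also have "\<dots> = ennreal (gauss_const k) * (ennreal (real N ^ (N * k) * q ^ (k * k) * exp (- (real k * real N * (1 - (cmod z)\<^sup>2)))) *
      (\<integral>\<^sup>+y. (if posdef k (cshift (q * (1 - (cmod z)\<^sup>2)) (hmat k y)) then ennreal (phi k N y) else 0) \<partial>leb (sq k)))"
    unfolding s_def q_def by (subst nn_integral_det_exp_rescale[OF N]) auto
  finally have "ennreal (ginibre_moment N k z) = ennreal (1 / real N ^ (N * k)) * (ennreal (gauss_const k) * (ennreal (real N ^ (N * k) * q ^ (k * k) * exp (- (real k * real N * (1 - (cmod z)\<^sup>2)))) *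
      (\<integral>\<^sup>+y. (if posdef k (cshift (q * (1 - (cmod z)\<^sup>2)) (hmat k y)) then ennreal (phi k N y) else 0) \<partial>leb (sq k))))"
    unfolding gm by (subst ennreal_mult') (simp, simp only:)
  also have "\<dots> = (ennreal (1 / real N ^ (N * k)) * ennreal (gauss_const k) * ennreal (real N ^ (N * k) * q ^ (k * k) * exp (- (real k * real N * (1 - (cmod z)\<^sup>2))))) *
      (\<integral>\<^sup>+y. (if posdef k (cshift (q * (1 - (cmod z)\<^sup>2)) (hmat k y)) then ennreal (phi k N y) else 0) \<partial>leb (sq k))"
    by (simp only: mult.assoc)
  also have "ennreal (1 / real N ^ (N * k)) * ennreal (gauss_const k) * ennreal (real N ^ (N * k) * q ^ (k * k) * exp (- (real k * real N * (1 - (cmod z)\<^sup>2)))) =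
     ennreal (gauss_const k * q ^ (k * k) * exp (real N * real k * ((cmod z)\<^sup>2 - 1)))"
  proof -
    have "- (real k * real N * (1 - (cmod z)\<^sup>2)) = real N * real k * ((cmod z)\<^sup>2 - 1)"
      by (simp add: algebra_simps)
    thus ?thesis
      using gauss_const_pos[of k] N q(1) by (simp add: ennreal_mult'[symmetric] less_imp_le field_simps)
  qed
  finally show "ennreal (ginibre_moment N k z) =
    ennreal (gauss_const k * sqrt (real N) ^ (k * k) * exp (real N * real k * ((cmod z)\<^sup>2 - 1))) *
     (\<integral>\<^sup>+y. (if posdef k (cshift (sqrt (real N) * (1 - (cmod z)\<^sup>2)) (hmat k y)) then ennreal (phi k N y) else 0) \<partial>leb (sq k))"
    unfolding q_def .
qed

subsection \<open>Stirling's formula and the limiting mass\<close>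

lemma ln_one_minus_le:
  fixes u :: real
  assumes "0 \<le> u" "u < 1"
  shows "ln (1 - u) + u \<le> - u\<^sup>2 / 2"
proof -
  define f where "f = (\<lambda>u::real. - u\<^sup>2 / 2 - ln (1 - u) - u)"
  have "f 0 \<le> f u"
  proof (rule DERIV_nonneg_imp_nondecreasing[OF assms(1)])
    fix x :: real assume x: "0 \<le> x" "x \<le> u"
    hence x1: "1 - x > 0" using assms by simp
    have "(f has_real_derivative (- x + 1 / (1 - x) - 1)) (at x)"
      unfolding f_def using x1 by (auto intro!: derivative_eq_intros)
    moreover have "- x + 1 / (1 - x) - 1 = x\<^sup>2 / (1 - x)"
      using x1 by (simp add: field_simps power2_eq_square)
    ultimately show "\<exists>y. (f has_real_derivative y) (at x) \<and> 0 \<le> y"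
      using x1 by (intro exI[of _ "x\<^sup>2 / (1 - x)"]) auto
  qed
  thus ?thesis by (simp add: f_def)
qed

text \<open>The bound is quadratic near 0 and linear at infinity; the linear regime provides the
  exponential tail used for domination on the negative side.\<close>

lemma ln_one_plus_le:
  fixes t :: real
  assumes "0 \<le> t"
  shows "ln (1 + t) - t \<le> - (t\<^sup>2 / (2 * (1 + t)))"
proof -
  define f where "f = (\<lambda>t::real. t - t\<^sup>2 / (2 * (1 + t)) - ln (1 + t))"
  have "f 0 \<le> f t"
  proof (rule DERIV_nonneg_imp_nondecreasing[OF assms])
    fix x :: real assume x: "0 \<le> x" "x \<le> t"
    have "(f has_real_derivative (1 - (2 * x * (2 * (1 + x)) - x\<^sup>2 * 2) / (2 * (1 + x))\<^sup>2 - 1 / (1 + x))) (at x)"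
      unfolding f_def using x
      by (auto intro!: derivative_eq_intros simp: power2_eq_square)
    moreover have "1 - (2 * x * (2 * (1 + x)) - x\<^sup>2 * 2) / (2 * (1 + x))\<^sup>2 - 1 / (1 + x) = x\<^sup>2 / (2 * (1 + x)\<^sup>2)"
    proof -
      have nz: "1 + x \<noteq> 0" using x by simp
      show ?thesis using nz by (simp add: divide_simps) (simp add: power2_eq_square algebra_simps)
    qed
    ultimately show "\<exists>y. (f has_real_derivative y) (at x) \<and> 0 \<le> y"
      by (intro exI[of _ "x\<^sup>2 / (2 * (1 + x)\<^sup>2)"]) auto
  qed
  thus ?thesis by (simp add: f_def)
qed

text \<open>The case \<open>k = 1\<close> of \<open>phi\<close>, as a function of one real
  variable.\<close>

definition gauss_approx :: "nat \<Rightarrow> real \<Rightarrow> real" where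
  "gauss_approx n y = (if y < sqrt (real n) then (1 - y / sqrt (real n)) ^ n * exp (sqrt (real n) * y) else 0)"

lemma measurable_gauss_approx [measurable]: "gauss_approx n \<in> borel_measurable borel"
  unfolding gauss_approx_def by measurable

lemma gauss_approx_nonneg: "0 \<le> gauss_approx n y"
proof (cases "n = 0")
  case False
  thus ?thesis by (auto simp: gauss_approx_def field_simps)
qed (simp add: gauss_approx_def)

lemma gauss_approx_le:
  assumes n: "n \<ge> 1"
  shows "gauss_approx n y \<le> exp (1 / 2 - \<bar>y\<bar> / 2)"
proof (cases "y < sqrt (real n)")
  case True
  define q where "q = sqrt (real n)"
  have q: "q \<ge> 1" "q * q = real n" using n by (auto simp: q_def)
  define u where "u = y / q"
  have u1: "u < 1" using True q by (simp add: u_def q_def)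
  have yq: "q * u = y" using q by (simp add: u_def)
  have "gauss_approx n y = exp (real n * (ln (1 - u) + u))"
  proof -
    have "(1 - u) ^ n = exp (real n * ln (1 - u))"
      using u1 by (simp add: exp_of_nat_mult)
    moreover have "q * y = real n * u" using yq q by (metis mult.assoc)
    ultimately show ?thesis using True unfolding gauss_approx_def q_def[symmetric] u_def[symmetric]
      by (simp add: distrib_left exp_add)
  qed
  also have "real n * (ln (1 - u) + u) \<le> 1 / 2 - \<bar>y\<bar> / 2"
  proof (cases "u \<ge> 0")
    case u: True
    hence y: "y \<ge> 0" using q by (simp flip: yq)
    have "real n * (ln (1 - u) + u) \<le> real n * (- u\<^sup>2 / 2)"
      using ln_one_minus_le[OF u u1] by (intro mult_left_mono) auto
    also have "\<dots> = - y\<^sup>2 / 2"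
      unfolding yq[symmetric] q(2)[symmetric] by (simp add: power2_eq_square)
    also have "\<dots> \<le> 1 / 2 - \<bar>y\<bar> / 2"
      using y zero_le_power2[of "y - 1 / 2"] by (simp add: power2_eq_square algebra_simps)
    finally show ?thesis .
  next
    case False
    define w where "w = - y"
    have w: "w > 0" using False q unfolding w_def yq[symmetric] by (simp add: mult_pos_neg)
    have uw: "u = - (w / q)" by (simp add: u_def w_def)
    have "real n * (ln (1 - u) + u) \<le> real n * (- ((w / q)\<^sup>2 / (2 * (1 + w / q))))"
      using ln_one_plus_le[of "w / q"] w q unfolding uw by (intro mult_left_mono) auto
    also have "\<dots> = - (w\<^sup>2 / (2 * (1 + w / q)))"
    proof -
      have "q \<noteq> 0" using q by simp
      thus ?thesis unfolding q(2)[symmetric] by (simp add: power_divide power2_eq_square)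
    qed
    \<comment> \<open>Since \<open>q \<ge> 1\<close>, replacing \<open>w / q\<close> by
      \<open>w\<close> enlarges the denominator and removes the dependence on
      \<open>n\<close>.\<close>
    also have "\<dots> \<le> - (w\<^sup>2 / (2 * (1 + w)))"
    proof -
      have "w / q \<le> w" using w q by (simp add: divide_le_eq)
      moreover have "0 \<le> w / q" using w q by simp
      ultimately show ?thesis using w by (auto intro!: divide_left_mono mult_pos_pos add_pos_nonneg)
    qed
    \<comment> \<open>From w^2 \<ge> (w - 1) (w + 1); the constant 1 / 2 in the majorant originates
      here.\<close>
    also have "\<dots> \<le> 1 / 2 - w / 2"
      using w by (simp add: field_simps power2_eq_square)
    finally show ?thesis using w by (simp add: w_def)
  qed
  finally show ?thesis by simp
qed (simp add: gauss_approx_def)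

lemma integrable_exp_abs: "integrable lborel (\<lambda>y::real. exp (1 / 2 - \<bar>y\<bar> / 2))"
proof (rule integrableI_bounded)
  define g where "g y = indicator {0..} y * ennreal (exp (- y / 2))" for y :: real
  have [measurable]: "g \<in> borel_measurable borel" unfolding g_def by measurable
  have "(\<integral>\<^sup>+y. g y \<partial>lborel) = ennreal 2 * (\<integral>\<^sup>+y. g (0 + 2 * y) \<partial>lborel)"
    by (subst nn_integral_real_affine[where c = 2 and t = 0]) auto
  also have "(\<integral>\<^sup>+y. g (0 + 2 * y) \<partial>lborel) = (\<integral>\<^sup>+y. ennreal (y ^ 0 * exp (- y)) * indicator {0..} y \<partial>lborel)"
    by (intro nn_integral_cong) (auto simp: g_def indicator_def)
  also have "\<dots> = ennreal (fact 0)"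
    by (subst nn_intergal_power_times_exp_Ici) simp
  finally have g: "(\<integral>\<^sup>+y. g y \<partial>lborel) < \<infinity>" by (simp flip: ennreal_mult)
  have g': "(\<integral>\<^sup>+y. g (- y) \<partial>lborel) = (\<integral>\<^sup>+y. g y \<partial>lborel)"
    by (subst (2) nn_integral_real_affine[where c = "-1" and t = 0]) auto
  have "(\<integral>\<^sup>+y. ennreal (norm (exp (1 / 2 - \<bar>y\<bar> / 2 :: real))) \<partial>lborel) \<le>
      (\<integral>\<^sup>+y. ennreal (exp (1 / 2)) * (g y + g (- y)) \<partial>lborel)"
  proof (rule nn_integral_mono)
    fix y :: real
    have "exp (1 / 2 - \<bar>y\<bar> / 2) = exp (1 / 2) * exp (- \<bar>y\<bar> / 2)" by (simp flip: exp_add)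
    hence "ennreal (norm (exp (1 / 2 - \<bar>y\<bar> / 2))) = ennreal (exp (1 / 2)) * ennreal (exp (- \<bar>y\<bar> / 2))"
      by (simp add: ennreal_mult)
    also have "\<dots> \<le> ennreal (exp (1 / 2)) * (g y + g (- y))"
      by (intro mult_left_mono) (auto simp: g_def indicator_def)
    finally show "ennreal (norm (exp (1 / 2 - \<bar>y\<bar> / 2))) \<le> ennreal (exp (1 / 2)) * (g y + g (- y))" .
  qed
  also have "\<dots> = ennreal (exp (1 / 2)) * ((\<integral>\<^sup>+y. g y \<partial>lborel) + (\<integral>\<^sup>+y. g y \<partial>lborel))"
    by (subst nn_integral_cmult; (subst nn_integral_add)?) (simp_all add: g')
  also have "\<dots> < \<infinity>" using g by (simp add: ennreal_mult_less_top)
  finally show "(\<integral>\<^sup>+y. ennreal (norm (exp (1 / 2 - \<bar>y\<bar> / 2 :: real))) \<partial>lborel) < \<infinity>" .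
qed measurable

lemma gauss_approx_tendsto: "(\<lambda>n. gauss_approx n y) \<longlonglongrightarrow> exp (- y\<^sup>2 / 2)"
proof -
  define u where "u n = complex_of_real (- y / sqrt (real n))" for n
  have "(\<lambda>n. of_real (sqrt (real n)) * u n) \<longlonglongrightarrow> - of_real y"
  proof (rule Lim_transform_eventually[OF tendsto_const])
    show "\<forall>\<^sub>F n in sequentially. - complex_of_real y = of_real (sqrt (real n)) * u n"
      using eventually_gt_at_top[of 0] by eventually_elim (simp add: u_def)
  qed
  from power_times_exp_tendsto[OF this]
  have "(\<lambda>n. Re ((1 + u n) ^ n * exp (- (of_nat n * u n)))) \<longlonglongrightarrow> Re (exp (- (- complex_of_real y)\<^sup>2 / 2))"
    by (rule tendsto_Re)
  also have "exp (- (- complex_of_real y)\<^sup>2 / 2) = of_real (exp (- y\<^sup>2 / 2))"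
  proof -
    have "- (- complex_of_real y)\<^sup>2 / 2 = of_real (- y\<^sup>2 / 2)" by simp
    thus ?thesis by (simp only: exp_of_real)
  qed
  finally have lim: "(\<lambda>n. Re ((1 + u n) ^ n * exp (- (of_nat n * u n)))) \<longlonglongrightarrow> exp (- y\<^sup>2 / 2)" by simp
  show ?thesis
  proof (rule Lim_transform_eventually[OF lim])
    have "filterlim (\<lambda>n. sqrt (real n)) at_top sequentially" by real_asymp
    hence "\<forall>\<^sub>F n in sequentially. y < sqrt (real n)" by (simp add: filterlim_at_top_dense)
    with eventually_gt_at_top[of 0]
    show "\<forall>\<^sub>F n in sequentially. Re ((1 + u n) ^ n * exp (- (of_nat n * u n))) = gauss_approx n y"
    proof eventually_elim
      case (elim n)
      have "real n * (y / sqrt (real n)) = sqrt (real n) * y"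
        using elim(1) by (simp add: field_simps)
      moreover have "- (of_nat n * u n) = complex_of_real (real n * (y / sqrt (real n)))"
        by (simp add: u_def)
      ultimately have "exp (- (of_nat n * u n)) = of_real (exp (sqrt (real n) * y))"
        by (simp only: exp_of_real)
      moreover have "(1 + u n) ^ n = of_real ((1 - y / sqrt (real n)) ^ n)"
        by (simp add: u_def)
      ultimately show ?case using elim(2) by (simp add: gauss_approx_def flip: of_real_mult)
    qed
  qed
qed

text \<open>The gamma integral for \<open>fact n\<close> under the substitution
  \<open>p = n - sqrt n * y\<close>, which centres it at its maximum.\<close>

lemma nn_integral_gauss_approx:
  assumes n: "n \<ge> 1"
  shows "(\<integral>\<^sup>+y. ennreal (gauss_approx n y) \<partial>lborel) = ennreal (fact n * exp (real n) / (real n ^ n * sqrt (real n)))"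
proof -
  define q where "q = sqrt (real n)"
  have q: "q > 0" "q * q = real n" using n by (auto simp: q_def)
  define c where "c = real n ^ n * exp (- real n)"
  have c: "c > 0" using n by (simp add: c_def)
  have "ennreal (fact n) = (\<integral>\<^sup>+p. indicator {0<..} p * ennreal (p ^ n * exp (- p)) \<partial>lborel)"
    by (simp only: nn_integral_power_exp)
  also have "\<dots> = ennreal \<bar>- q\<bar> * (\<integral>\<^sup>+y. indicator {0<..} (real n + - q * y) * ennreal ((real n + - q * y) ^ n * exp (- (real n + - q * y))) \<partial>lborel)"
    by (rule nn_integral_real_affine) (use q in auto)
  also have "(\<integral>\<^sup>+y. indicator {0<..} (real n + - q * y) * ennreal ((real n + - q * y) ^ n * exp (- (real n + - q * y))) \<partial>lborel) =
     (\<integral>\<^sup>+y. ennreal c * ennreal (gauss_approx n y) \<partial>lborel)"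
  proof (rule nn_integral_cong)
    fix y
    have "real n + - q * y = q * (q - y)" by (simp add: q(2)[symmetric] algebra_simps)
    hence pos: "0 < real n + - q * y \<longleftrightarrow> y < q" using q by (simp add: zero_less_mult_iff)
    have fac: "real n + - q * y = real n * (1 - y / q)" unfolding q(2)[symmetric] using q by (simp add: field_simps)
    have "(real n + - q * y) ^ n * exp (- (real n + - q * y)) = c * ((1 - y / q) ^ n * exp (q * y))"
    proof -
      have "(real n + - q * y) ^ n = real n ^ n * (1 - y / q) ^ n"
        unfolding fac power_mult_distrib ..
      moreover have "exp (- (real n + - q * y)) = exp (- real n) * exp (q * y)"
        by (simp flip: exp_add)
      ultimately show ?thesis unfolding c_def by (simp only: mult_ac)
    qed
    thus "indicator {0<..} (real n + - q * y) * ennreal ((real n + - q * y) ^ n * exp (- (real n + - q * y))) = ennreal c * ennreal (gauss_approx n y)"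
      using pos c by (auto simp: gauss_approx_def q_def[symmetric] indicator_def simp flip: ennreal_mult')
  qed
  also have "\<dots> = ennreal c * (\<integral>\<^sup>+y. ennreal (gauss_approx n y) \<partial>lborel)"
    by (rule nn_integral_cmult) measurable
  finally have "ennreal (fact n) = ennreal (q * c) * (\<integral>\<^sup>+y. ennreal (gauss_approx n y) \<partial>lborel)"
    using q c by (simp add: ennreal_mult mult.assoc)
  hence "ennreal (1 / (q * c)) * ennreal (fact n) = ennreal (1 / (q * c)) * ennreal (q * c) * (\<integral>\<^sup>+y. ennreal (gauss_approx n y) \<partial>lborel)"
    by (simp add: mult.assoc)
  also have "ennreal (1 / (q * c)) * ennreal (q * c) = 1"
    using q c by (subst ennreal_mult'[symmetric]) auto
  finally have "(\<integral>\<^sup>+y. ennreal (gauss_approx n y) \<partial>lborel) = ennreal (1 / (q * c)) * ennreal (fact n)"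
    by (simp only: mult_1)
  also have "\<dots> = ennreal (1 / (q * c) * fact n)"
    using q c by (subst ennreal_mult'[symmetric]) auto
  finally have "(\<integral>\<^sup>+y. ennreal (gauss_approx n y) \<partial>lborel) = ennreal (1 / (q * c) * fact n)" .
  thus ?thesis by (simp add: c_def q_def exp_minus field_simps)
qed

lemma normal_gaussian:
  assumes "\<sigma> > 0"
  shows "integrable lborel (\<lambda>y. exp (- y\<^sup>2 / (2 * \<sigma>\<^sup>2)))"
    and "(\<integral>y. exp (- y\<^sup>2 / (2 * \<sigma>\<^sup>2)) \<partial>lborel) = sqrt (2 * pi * \<sigma>\<^sup>2)"
proof -
  have eq: "exp (- y\<^sup>2 / (2 * \<sigma>\<^sup>2)) = sqrt (2 * pi * \<sigma>\<^sup>2) * normal_density 0 \<sigma> y" for y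
    using assms by (simp add: normal_density_def)
  show "integrable lborel (\<lambda>y. exp (- y\<^sup>2 / (2 * \<sigma>\<^sup>2)))"
    unfolding eq using assms by (intro integrable_mult_right) simp
  show "(\<integral>y. exp (- y\<^sup>2 / (2 * \<sigma>\<^sup>2)) \<partial>lborel) = sqrt (2 * pi * \<sigma>\<^sup>2)"
    unfolding eq using assms by simp
qed

text \<open>Laplace's method: the quotient is the integral of \<open>gauss_approx n\<close>, which
  converges by domination to a Gaussian integral.\<close>

theorem stirling:
  "(\<lambda>n. fact n * exp (real n) / (real n ^ n * sqrt (real n))) \<longlonglongrightarrow> sqrt (2 * pi)"
\<comment> \<open>The majorant is available from \<open>n = 1\<close> on.\<close>
proof (rule LIMSEQ_imp_Suc)
  have "(\<lambda>n. \<integral>y. gauss_approx (Suc n) y \<partial>lborel) \<longlonglongrightarrow> (\<integral>y. exp (- y\<^sup>2 / 2) \<partial>lborel)"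
  proof (rule integral_dominated_convergence[where w = "\<lambda>y. exp (1 / 2 - \<bar>y\<bar> / 2)"])
    show "AE y in lborel. (\<lambda>n. gauss_approx (Suc n) y) \<longlonglongrightarrow> exp (- y\<^sup>2 / 2)"
      by (intro AE_I2 LIMSEQ_Suc gauss_approx_tendsto)
    show "AE y in lborel. norm (gauss_approx (Suc n) y) \<le> exp (1 / 2 - \<bar>y\<bar> / 2)" for n
      using gauss_approx_le[of "Suc n"] gauss_approx_nonneg by (intro AE_I2) auto
  qed (use integrable_exp_abs in auto)
  moreover have "(\<integral>y. gauss_approx (Suc n) y \<partial>lborel) = fact (Suc n) * exp (real (Suc n)) / (real (Suc n) ^ (Suc n) * sqrt (real (Suc n)))" for n
    by (subst integral_eq_nn_integral, measurable, (auto simp: gauss_approx_nonneg)[], subst nn_integral_gauss_approx, simp, rule enn2real_ennreal, intro divide_nonneg_nonneg mult_nonneg_nonneg, simp_all)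
  moreover have "(\<integral>y. exp (- y\<^sup>2 / 2) \<partial>lborel) = sqrt (2 * pi)"
    using normal_gaussian(2)[of 1] by simp
  ultimately show "(\<lambda>n. fact (Suc n) * exp (real (Suc n)) / (real (Suc n) ^ (Suc n) * sqrt (real (Suc n)))) \<longlonglongrightarrow> sqrt (2 * pi)"
    by simp
qed

section \<open>Masses of the rescaled and of the limiting density\<close>

lemma fact_add_asymp: "(\<lambda>N. fact (N + j) / (fact N * real N ^ j)) \<longlonglongrightarrow> 1"
proof (induction j)
  case 0
  show ?case by simp
next
  case (Suc j)
  have "(\<lambda>N. real (N + j + 1) / real N) \<longlonglongrightarrow> 1" by real_asymp
  from tendsto_mult[OF Suc.IH this]
  show ?case by (simp add: field_simps)
qed

text \<open>Total mass of the GUE weight: index \<open>j\<close> brings one diagonal Gaussian of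
  variance 1 and \<open>2 * j\<close> real off-diagonal ones of variance 1 / 2.\<close>

definition gue_mass :: "nat \<Rightarrow> real" where
  "gue_mass k = (\<Prod>j<k. pi ^ j * sqrt (2 * pi))"

text \<open>Total mass of \<open>phi\<close>, grouped so that each factor converges: a ratio of
  factorials tending to 1 and the Stirling quotient.\<close>

definition phi_mass :: "nat \<Rightarrow> nat \<Rightarrow> real" where
  "phi_mass k N = (\<Prod>j<k. pi ^ j * (fact (N + j) / (fact N * real N ^ j)) * (fact N * exp (real N) / (real N ^ N * sqrt (real N))))"

lemma phi_mass_tendsto: "phi_mass k \<longlonglongrightarrow> gue_mass k"
proof -
  have "(\<lambda>N. \<Prod>j<k. pi ^ j * (fact (N + j) / (fact N * real N ^ j)) * (fact N * exp (real N) / (real N ^ N * sqrt (real N))))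
     \<longlonglongrightarrow> (\<Prod>j<k. pi ^ j * 1 * sqrt (2 * pi))"
    by (intro tendsto_prod tendsto_mult tendsto_const fact_add_asymp stirling)
  thus ?thesis by (simp add: phi_mass_def[abs_def] gue_mass_def)
qed

text \<open>The matrix gamma integral seen through the rescaling with \<open>r = 0\<close>, where
  the domain is exactly the cutoff of \<open>phi\<close>.\<close>

lemma nn_integral_phi:
  assumes N: "N \<ge> 1"
  shows "(\<integral>\<^sup>+y. ennreal (phi k N y) \<partial>leb (sq k)) = ennreal (phi_mass k N)"
proof -
  define C where "C = real N ^ (N * k) * sqrt (real N) ^ (k * k) * exp (- (real k * real N))"
  have C: "C > 0" using N by (simp add: C_def)
  have "C * phi_mass k N = (\<Prod>j<k. pi ^ j * fact (N + j))"
    unfolding C_def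
  proof (induction k)
    case (Suc k)
    define q where "q = sqrt (real N)"
    have q: "q > 0" "real N = q * q" using N by (auto simp: q_def)
    have e1: "real N ^ (N * Suc k) * q ^ (Suc k * Suc k) * exp (- (real (Suc k) * real N)) =
      (real N ^ (N * k) * q ^ (k * k) * exp (- (real k * real N))) * (real N ^ N * (q * real N ^ k) * exp (- real N))"
    proof -
      have "exp (- (real (Suc k) * real N)) = exp (- (real k * real N)) * exp (- real N)"
        by (simp add: algebra_simps flip: exp_add)
      moreover have "q ^ (Suc k * Suc k) = q ^ (k * k) * (q * real N ^ k)"
        unfolding q(2) by (simp add: power_add power_mult_distrib mult_ac)
      moreover have "real N ^ (N * Suc k) = real N ^ (N * k) * real N ^ N"
        by (simp add: power_add)
      ultimately show ?thesis by (simp only: mult_ac)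
    qed
    have e2: "phi_mass (Suc k) N = phi_mass k N * (pi ^ k * (fact (N + k) / (fact N * real N ^ k)) * (fact N * exp (real N) / (real N ^ N * q)))"
      by (simp add: phi_mass_def q_def)
    have e3: "(real N ^ N * (q * real N ^ k) * exp (- real N)) * (pi ^ k * (fact (N + k) / (fact N * real N ^ k)) * (fact N * exp (real N) / (real N ^ N * q))) = pi ^ k * fact (N + k)"
      using q(1) N by (simp add: exp_minus field_simps)
    have "real N ^ (N * Suc k) * q ^ (Suc k * Suc k) * exp (- (real (Suc k) * real N)) * phi_mass (Suc k) N =
      (real N ^ (N * k) * q ^ (k * k) * exp (- (real k * real N)) * phi_mass k N) * (pi ^ k * fact (N + k))"
      unfolding e1 e2 e3[symmetric] by (simp only: mult_ac)
    thus ?case using Suc.IH by (simp add: q_def)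
  qed (simp add: phi_mass_def)
  hence eq: "phi_mass k N = 1 / C * (\<Prod>j<k. pi ^ j * fact (N + j))"
    using C by (simp add: field_simps)
  have "ennreal (\<Prod>j<k. pi ^ j * fact (N + j)) =
    (\<integral>\<^sup>+x. (if posdef k (hmat k x) then ennreal (exp (- ctrace k (hmat k x))) *
      ennreal (Re (cdet k (shift_diag (of_real (real N * 0)) (hmat k x))) ^ N) else 0) \<partial>leb (sq k))"
    unfolding nn_integral_posdef_det_exp[symmetric]
    by (intro nn_integral_cong) (simp add: shift_diag_def mult.commute flip: ennreal_mult')
  also have "\<dots> = ennreal C *
      (\<integral>\<^sup>+y. (if posdef k (cshift (sqrt (real N) * (1 - 0)) (hmat k y)) then ennreal (phi k N y) else 0) \<partial>leb (sq k))"
    unfolding C_def by (subst nn_integral_det_exp_rescale[OF N]) auto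
  also have "(\<integral>\<^sup>+y. (if posdef k (cshift (sqrt (real N) * (1 - 0)) (hmat k y)) then ennreal (phi k N y) else 0) \<partial>leb (sq k)) =
    (\<integral>\<^sup>+y. ennreal (phi k N y) \<partial>leb (sq k))"
    by (intro nn_integral_cong) (simp add: phi_def)
  finally have "ennreal (1 / C) * ennreal (\<Prod>j<k. pi ^ j * fact (N + j)) = ennreal (1 / C) * ennreal C * (\<integral>\<^sup>+y. ennreal (phi k N y) \<partial>leb (sq k))"
    by (simp only: mult.assoc)
  also have "ennreal (1 / C) * ennreal C = 1"
    using C by (subst ennreal_mult'[symmetric]) auto
  finally have "(\<integral>\<^sup>+y. ennreal (phi k N y) \<partial>leb (sq k)) = ennreal (1 / C) * ennreal (\<Prod>j<k. pi ^ j * fact (N + j))"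
    by (simp only: mult_1)
  thus ?thesis unfolding eq using C by (subst ennreal_mult') auto
qed

definition gue_weight :: "nat \<Rightarrow> (nat \<times> nat \<Rightarrow> real) \<Rightarrow> real" where
  "gue_weight k y = exp (- mtrace_sq k (hmat k y) / 2)"

lemma mtrace_sq_hmat: "mtrace_sq k (hmat k y) = mtrace_sq k (herm_of y)"
  unfolding mtrace_sq_def by (auto intro!: arg_cong[of _ _ Re] sum.cong simp: hmat_def)

lemma measurable_gue_weight [measurable]: "gue_weight k \<in> borel_measurable (leb (sq k))"
proof -
  have [measurable]: "(\<lambda>y. hmat k y e) \<in> borel_measurable (leb (sq k))" for e
    using measurable_PiM_comp[OF measurable_hmat[OF measurable_ident], of e k] by simp
  show ?thesis unfolding gue_weight_def mtrace_sq_def by measurable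
qed

text \<open>Off-diagonal entries occur twice in the trace of the square, so their variance is half
  that of the diagonal ones.\<close>

lemma gue_weight_eq_prod:
  "gue_weight k y = (\<Prod>e\<in>sq k. if fst e = snd e then exp (- (y e)\<^sup>2 / 2) else exp (- (y e)\<^sup>2))"
proof -
  have "mtrace_sq k (herm_of y) = (\<Sum>i<k. \<Sum>j<k. if i = j then (y (i, i))\<^sup>2 else (y (i, j))\<^sup>2 + (y (j, i))\<^sup>2)"
    unfolding mtrace_sq_def Re_sum
    by (intro sum.cong refl) (auto simp: herm_of_def power2_eq_square)
  \<comment> \<open>The symmetric summand is split between the positions (i, j) and (j, i), so that
    exchanging the two sums produces the same sum twice.\<close>
  also have "\<dots> = (\<Sum>i<k. \<Sum>j<k. (if i = j then (y (i, j))\<^sup>2 / 2 else (y (i, j))\<^sup>2) + (if j = i then (y (j, i))\<^sup>2 / 2 else (y (j, i))\<^sup>2))"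
    by (intro sum.cong refl) auto
  also have "\<dots> = (\<Sum>i<k. \<Sum>j<k. (if i = j then (y (i, j))\<^sup>2 / 2 else (y (i, j))\<^sup>2)) +
      (\<Sum>i<k. \<Sum>j<k. (if j = i then (y (j, i))\<^sup>2 / 2 else (y (j, i))\<^sup>2))"
    by (simp only: sum.distrib)
  also have "(\<Sum>i<k. \<Sum>j<k. (if j = i then (y (j, i))\<^sup>2 / 2 else (y (j, i))\<^sup>2)) = (\<Sum>i<k. \<Sum>j<k. (if i = j then (y (i, j))\<^sup>2 / 2 else (y (i, j))\<^sup>2))"
    by (rule sum.swap)
  also have "(\<Sum>i<k. \<Sum>j<k. (if i = j then (y (i, j))\<^sup>2 / 2 else (y (i, j))\<^sup>2)) =
      (\<Sum>e\<in>sq k. if fst e = snd e then (y e)\<^sup>2 / 2 else (y e)\<^sup>2)"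
    unfolding sum.cartesian_product by (intro sum.cong) auto
  finally have "- mtrace_sq k (herm_of y) / 2 = (\<Sum>e\<in>sq k. - (if fst e = snd e then (y e)\<^sup>2 / 2 else (y e)\<^sup>2))"
    by (simp add: sum_negf)
  thus ?thesis unfolding gue_weight_def mtrace_sq_hmat
    by (simp add: exp_sum) (intro prod.cong, auto)
qed

lemma gue_weight_integral:
  "integrable (leb (sq k)) (gue_weight k)" "(\<integral>y. gue_weight k y \<partial>leb (sq k)) = gue_mass k"
proof -
  let ?f = "\<lambda>e y. if fst e = snd e then exp (- y\<^sup>2 / 2) else exp (- y\<^sup>2 :: real)"
  have s: "(1 / sqrt 2)\<^sup>2 = (1 / 2 :: real)" by (simp add: power_divide)
  have int: "integrable lborel (?f e)" and val: "(\<integral>y. ?f e y \<partial>lborel) = (if fst e = snd e then sqrt (2 * pi) else sqrt pi)"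
    for e :: "nat \<times> nat"
    using normal_gaussian[of 1] normal_gaussian[of "1 / sqrt 2"] unfolding s
    by (cases "fst e = snd e"; simp)+
  show "integrable (leb (sq k)) (gue_weight k)"
    unfolding gue_weight_eq_prod[abs_def] by (rule lb.product_integrable_prod) (use int in auto)
  have "(\<integral>y. gue_weight k y \<partial>leb (sq k)) = (\<Prod>e\<in>sq k. if fst e = snd e then sqrt (2 * pi) else sqrt pi)"
    unfolding gue_weight_eq_prod[abs_def]
    by (subst lb.product_integral_prod[where f = ?f]) (use int val in auto)
  also have "\<dots> = (\<Prod>i<k. \<Prod>j<k. if i = j then sqrt (2 * pi) else sqrt pi)"
    by (simp add: prod.cartesian_product case_prod_beta)
  also have "\<dots> = gue_mass k"
  proof (induction k)
    case (Suc k)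
    have "(\<Prod>i<Suc k. \<Prod>j<Suc k. if i = j then sqrt (2 * pi) else sqrt pi) =
      (\<Prod>i<k. \<Prod>j<k. if i = j then sqrt (2 * pi) else sqrt pi) * (\<Prod>i<k. sqrt pi) * ((\<Prod>j<k. sqrt pi) * sqrt (2 * pi))"
      by (simp add: prod.distrib cong: prod.cong_simp)
    also have "(\<Prod>i<k. sqrt pi) = sqrt pi ^ k" by simp
    finally show ?case unfolding Suc.IH
      by (simp add: gue_mass_def mult.assoc[symmetric] power_mult_distrib[symmetric])
  qed (simp add: gue_mass_def)
  finally show "(\<integral>y. gue_weight k y \<partial>leb (sq k)) = gue_mass k" .
qed

lemma gue_mass_pos: "gue_mass k > 0"
  unfolding gue_mass_def by (auto intro!: prod_pos)

text \<open>For fixed \<open>y\<close> the cutoff eventually holds, and the shifted and scaled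
  matrix is exactly the identity minus \<open>H / sqrt n\<close>; the determinant limit is applied
  with \<open>B = 0\<close>.\<close>

lemma phi_tendsto: "(\<lambda>n. phi k n y) \<longlonglongrightarrow> gue_weight k y"
proof -
  let ?H = "hmat k y"
  let ?s = "\<lambda>n. complex_of_real (sqrt (real n))"
  define A where "A n = (\<lambda>e. cshift (sqrt (real n)) ?H e / ?s n)" for n :: nat
  have trH: "(\<Sum>i<k. ?H (i, i)) = of_real (ctrace k ?H)"
    unfolding ctrace_def Re_sum of_real_sum
    by (intro sum.cong refl) (use hermitian_diag_real[OF hermitian_hmat] in auto)
  have trH2: "(\<Sum>i<k. \<Sum>j<k. ?H (i, j) * ?H (j, i)) = of_real (mtrace_sq k ?H)"
  proof -
    have "?H (i, j) * ?H (j, i) = of_real (Re (?H (i, j) * ?H (j, i)))" if "i < k" "j < k" for i j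
      using hermitianD[OF hermitian_hmat that, of y] by (simp add: complex_eq_iff flip: hermitianD[OF hermitian_hmat that])
    thus ?thesis unfolding mtrace_sq_def Re_sum of_real_sum by (intro sum.cong refl) auto
  qed
  have "(\<lambda>n. cdet k (A n) ^ n * exp (?s n * (\<Sum>i<k. ?H (i, i)))) \<longlonglongrightarrow>
    exp ((\<Sum>i<k. (\<lambda>_. 0) (i, i)) - (\<Sum>i<k. \<Sum>j<k. ?H (i, j) * ?H (j, i)) / 2)"
  proof (rule cdet_power_tendsto)
    fix i j
    show "(\<lambda>n. of_nat n * (A n (i, j) - ((if i = j then 1 else 0) - ?H (i, j) / ?s n))) \<longlonglongrightarrow> 0"
    proof (rule Lim_transform_eventually[OF tendsto_const])
      show "\<forall>\<^sub>F n in sequentially. 0 = of_nat n * (A n (i, j) - ((if i = j then 1 else 0) - ?H (i, j) / ?s n))"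
        using eventually_gt_at_top[of 0]
        by eventually_elim (auto simp: A_def cshift_def diff_divide_distrib)
    qed
  qed
  also have "exp ((\<Sum>i<k. (\<lambda>_. 0) (i, i)) - (\<Sum>i<k. \<Sum>j<k. ?H (i, j) * ?H (j, i)) / 2) = of_real (gue_weight k y)"
    unfolding trH2 gue_weight_def by (simp add: exp_of_real[symmetric])
  finally have "(\<lambda>n. Re (cdet k (A n) ^ n * exp (?s n * (\<Sum>i<k. ?H (i, i))))) \<longlonglongrightarrow> Re (of_real (gue_weight k y))"
    by (rule tendsto_Re)
  hence lim: "(\<lambda>n. Re (cdet k (A n) ^ n * exp (?s n * (\<Sum>i<k. ?H (i, i))))) \<longlonglongrightarrow> gue_weight k y" by simp
  show ?thesis
  proof (rule Lim_transform_eventually[OF lim])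
    have "filterlim (\<lambda>n. sqrt (real n)) at_top sequentially" by real_asymp
    hence "\<forall>\<^sub>F n in sequentially. (\<Sum>i<k. \<Sum>j<k. cmod (?H (i, j))) < sqrt (real n)"
      by (simp add: filterlim_at_top_dense)
    with eventually_gt_at_top[of 0]
    show "\<forall>\<^sub>F n in sequentially. Re (cdet k (A n) ^ n * exp (?s n * (\<Sum>i<k. ?H (i, i)))) = phi k n y"
    proof eventually_elim
      case (elim n)
      have pd: "posdef k (cshift (sqrt (real n)) ?H)"
        by (rule posdef_cshift_large[OF elim(2)])
      have s: "0 < 1 / sqrt (real n)" using elim(1) by simp
      have A: "A n = (\<lambda>e. of_real (1 / sqrt (real n)) * cshift (sqrt (real n)) ?H e)"
        by (simp add: A_def)
      have "posdef k (A n)" unfolding A using pd by (subst posdef_scale[OF s])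
      moreover have "hermitian k (A n)"
        using hermitianD[OF hermitian_cshift[OF hermitian_hmat]] unfolding hermitian_def A by auto
      ultimately have "cdet k (A n) = of_real (Re (cdet k (A n)))" using cdet_posdef by blast
      hence "Re (cdet k (A n) ^ n * exp (?s n * (\<Sum>i<k. ?H (i, i)))) = Re (of_real (Re (cdet k (A n))) ^ n * exp (?s n * of_real (ctrace k ?H)))"
        unfolding trH by metis
      also have "\<dots> = Re (cdet k (A n)) ^ n * exp (sqrt (real n) * ctrace k ?H)"
        by (simp add: exp_of_real flip: of_real_power of_real_mult)
      finally show ?case using pd by (simp add: phi_def A_def)
    qed
  qed
qed

lemma phi_integrable: "n \<ge> 1 \<Longrightarrow> integrable (leb (sq k)) (phi k n)"
  by (rule integrableI_nonneg) (auto simp: phi_nonneg nn_integral_phi)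

text \<open>The masses are known in closed form, so the limsup condition of Scheffe's lemma is
  convergence of numbers. The index is \<open>Suc n\<close> because integrability and the mass
  formula are stated from 1 on.\<close>

lemma phi_L1_tendsto:
  "(\<lambda>n. \<integral>y. \<bar>phi k (Suc n) y - gue_weight k y\<bar> \<partial>leb (sq k)) \<longlonglongrightarrow> 0"
proof -
  have w0: "0 \<le> gue_weight k y" for y by (simp add: gue_weight_def)
  have mass0: "phi_mass k (Suc n) \<ge> 0" for n
    unfolding phi_mass_def by (intro prod_nonneg) auto
  have "(\<lambda>n. \<integral>\<^sup>+y. norm (phi k (Suc n) y - gue_weight k y) \<partial>leb (sq k)) \<longlonglongrightarrow> 0"
  proof (rule Scheffe_lemma1)
    show "AE y in leb (sq k). (\<lambda>n. phi k (Suc n) y) \<longlonglongrightarrow> gue_weight k y"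
      by (intro AE_I2 LIMSEQ_Suc phi_tendsto)
    have "(\<lambda>n. \<integral>\<^sup>+y. norm (phi k (Suc n) y) \<partial>leb (sq k)) = (\<lambda>n. ennreal (phi_mass k (Suc n)))"
      by (simp add: phi_nonneg nn_integral_phi)
    moreover have "(\<integral>\<^sup>+y. norm (gue_weight k y) \<partial>leb (sq k)) = ennreal (gue_mass k)"
      using nn_integral_eq_integral[OF gue_weight_integral(1)] by (simp add: w0 gue_weight_integral(2))
    moreover have "(\<lambda>n. ennreal (phi_mass k (Suc n))) \<longlonglongrightarrow> ennreal (gue_mass k)"
      by (intro tendsto_ennrealI LIMSEQ_Suc phi_mass_tendsto)
    ultimately show "limsup (\<lambda>n. \<integral>\<^sup>+y. norm (phi k (Suc n) y) \<partial>leb (sq k)) \<le> (\<integral>\<^sup>+y. norm (gue_weight k y) \<partial>leb (sq k))"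
      by (simp add: lim_imp_Limsup)
  qed (simp_all add: phi_integrable gue_weight_integral)
  moreover have "(\<integral>\<^sup>+y. norm (phi k (Suc n) y - gue_weight k y) \<partial>leb (sq k)) = ennreal (\<integral>y. \<bar>phi k (Suc n) y - gue_weight k y\<bar> \<partial>leb (sq k))" for n
    by (subst nn_integral_eq_integral) (auto intro!: integrable_abs Bochner_Integration.integrable_diff phi_integrable gue_weight_integral)
  ultimately have "(\<lambda>n. ennreal (\<integral>y. \<bar>phi k (Suc n) y - gue_weight k y\<bar> \<partial>leb (sq k))) \<longlonglongrightarrow> ennreal 0" by simp
  thus ?thesis by (subst (asm) tendsto_ennreal_iff) auto
qed

subsection \<open>The edge asymptotics\<close>

text \<open>The rescaling identity with \<open>N = 1\<close> transfers nullity: if the shifted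
  domain were null, a strictly positive integrand would have integral 0 over the positive definite
  cone, and the cone would be null.\<close>

lemma posdef_cshift_not_null:
  assumes "\<xi> \<le> 1"
  shows "\<not> (AE y in leb (sq k). \<not> posdef k (cshift \<xi> (hmat k y)))"
proof
  assume ae: "AE y in leb (sq k). \<not> posdef k (cshift \<xi> (hmat k y))"
  \<comment> \<open>\<open>r\<close> is chosen so that the domain for \<open>N = 1\<close> is the
    given one; \<open>\<xi> \<le> 1\<close> is the requirement \<open>r \<ge> 0\<close>.\<close>
  define r where "r = 1 - \<xi>"
  have r: "r \<ge> 0" using assms by (simp add: r_def)
  have "(\<integral>\<^sup>+x. (if posdef k (hmat k x) then ennreal (exp (- ctrace k (hmat k x))) *
      ennreal (Re (cdet k (shift_diag (of_real (real 1 * r)) (hmat k x))) ^ 1) else 0) \<partial>leb (sq k)) =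
    ennreal (real 1 ^ (1 * k) * sqrt (real 1) ^ (k * k) * exp (- (real k * real 1 * (1 - r)))) *
      (\<integral>\<^sup>+y. (if posdef k (cshift (sqrt (real 1) * (1 - r)) (hmat k y)) then ennreal (phi k 1 y) else 0) \<partial>leb (sq k))"
    by (rule nn_integral_det_exp_rescale) (use r in auto)
  also have "(\<integral>\<^sup>+y. (if posdef k (cshift (sqrt (real 1) * (1 - r)) (hmat k y)) then ennreal (phi k 1 y) else 0) \<partial>leb (sq k)) =
    (\<integral>\<^sup>+(y :: nat \<times> nat \<Rightarrow> real). 0 \<partial>leb (sq k))"
    using ae by (intro nn_integral_cong_AE) (auto simp: r_def)
  finally have "(\<integral>\<^sup>+x. (if posdef k (hmat k x) then ennreal (exp (- ctrace k (hmat k x))) *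
      ennreal (Re (cdet k (shift_diag (of_real r) (hmat k x)))) else 0) \<partial>leb (sq k)) = 0"
    by (simp only: of_nat_1 mult_1 power_one_right nn_integral_const mult_zero_left mult_zero_right)
  hence "AE x in leb (sq k). (if posdef k (hmat k x) then ennreal (exp (- ctrace k (hmat k x))) *
      ennreal (Re (cdet k (shift_diag (of_real r) (hmat k x)))) else 0) = 0"
    by (subst (asm) nn_integral_0_iff_AE) auto
  hence "AE x in leb (sq k). \<not> posdef k (hmat k x)"
  proof eventually_elim
    case (elim x)
    show ?case
    proof
      assume pd: "posdef k (hmat k x)"
      have "posdef k (shift_diag (of_real r) (hmat k x))"
        unfolding posdef_def qform_shift_diag
        using pd r by (auto simp: posdef_def intro!: add_pos_nonneg mult_nonneg_nonneg sum_nonneg)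
      hence "0 < Re (cdet k (shift_diag (of_real r) (hmat k x)))"
        using cdet_posdef hermitian_shift_diag[OF hermitian_hmat] by blast
      thus False using elim pd by simp
    qed
  qed
  \<comment> \<open>The matrix gamma integral with exponent 0 shows that the cone has positive
    measure.\<close>
  hence "(\<integral>\<^sup>+x. (if posdef k (hmat k x) then ennreal (Re (cdet k (hmat k x)) ^ 0 * exp (- ctrace k (hmat k x))) else 0) \<partial>leb (sq k)) =
    (\<integral>\<^sup>+(x :: nat \<times> nat \<Rightarrow> real). 0 \<partial>leb (sq k))"
    by (intro nn_integral_cong_AE) auto
  hence "ennreal (\<Prod>j<k. pi ^ j * fact (0 + j)) = 0"
    unfolding nn_integral_posdef_det_exp by simp
  moreover have "(\<Prod>j<k. pi ^ j * fact (0 + j) :: real) > 0" by (intro prod_pos) auto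
  ultimately show False by simp
qed

text \<open>The distribution function of the largest eigenvalue before normalisation, phrased by
  positive definiteness so that monotonicity in \<open>\<xi>\<close> is immediate.\<close>

definition gue_part :: "nat \<Rightarrow> real \<Rightarrow> real" where
  "gue_part k \<xi> = (\<integral>y. of_bool (posdef k (cshift \<xi> (hmat k y))) * gue_weight k y \<partial>leb (sq k))"

lemma integrable_of_bool_posdef:
  assumes "integrable (leb (sq k)) f"
  shows "integrable (leb (sq k)) (\<lambda>y. of_bool (posdef k (cshift \<xi> (hmat k y))) * (f y :: real))"
proof (rule Bochner_Integration.integrable_bound[OF assms])
  have [measurable]: "f \<in> borel_measurable (leb (sq k))" using assms by simp
  show "(\<lambda>y. of_bool (posdef k (cshift \<xi> (hmat k y))) * f y) \<in> borel_measurable (leb (sq k))"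
    unfolding of_bool_def by measurable
qed auto

lemma gue_part_mono: "\<xi> \<le> \<eta> \<Longrightarrow> gue_part k \<xi> \<le> gue_part k \<eta>"
  unfolding gue_part_def
  by (intro integral_mono integrable_of_bool_posdef gue_weight_integral)
     (auto simp: gue_weight_def intro: posdef_cshift_mono)

lemma gue_part_pos:
  assumes "\<xi> \<le> 1"
  shows "gue_part k \<xi> > 0"
proof -
  have "gue_part k \<xi> \<ge> 0"
    unfolding gue_part_def by (intro Bochner_Integration.integral_nonneg) (simp add: gue_weight_def)
  moreover have "gue_part k \<xi> \<noteq> 0"
  proof
    assume "gue_part k \<xi> = 0"
    moreover have "AE y in leb (sq k). 0 \<le> of_bool (posdef k (cshift \<xi> (hmat k y))) * gue_weight k y"
      by (simp add: gue_weight_def)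
    ultimately have "AE y in leb (sq k). of_bool (posdef k (cshift \<xi> (hmat k y))) * gue_weight k y = 0"
      unfolding gue_part_def
      using integral_nonneg_eq_0_iff_AE[OF integrable_of_bool_posdef[OF gue_weight_integral(1)]] by blast
    hence "AE y in leb (sq k). \<not> posdef k (cshift \<xi> (hmat k y))"
      by eventually_elim (auto simp: gue_weight_def)
    thus False using posdef_cshift_not_null[OF assms] by simp
  qed
  ultimately show ?thesis by simp
qed

lemma lambda_max_herm_of:
  assumes "k \<ge> 1"
  shows "lambda_max k (herm_of y) < x \<longleftrightarrow> posdef k (cshift x (hmat k y))"
proof -
  have "lambda_max k (herm_of y) = lambda_max k (hmat k y)"
    unfolding lambda_max_def
    by (intro arg_cong[of _ _ Max] Collect_cong arg_cong2[of _ _ _ _ "(=)"] refl cdet_cong) (simp add: hmat_def)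
  thus ?thesis using lambda_max_less_iff[OF hermitian_hmat assms] by simp
qed

proposition F_gue_eq:
  assumes k: "k \<ge> 1"
  shows "F_gue k \<xi> = gue_part k \<xi> / gue_mass k"
proof -
  have un: "gue_unnorm k = density (leb (sq k)) (\<lambda>y. ennreal (gue_weight k y))"
    by (simp add: gue_unnorm_def gue_weight_def mtrace_sq_hmat)
  have w0: "0 \<le> gue_weight k y" for y by (simp add: gue_weight_def)
  have mass: "emeasure (gue_unnorm k) (space (gue_unnorm k)) = ennreal (gue_mass k)"
  proof -
    have "emeasure (gue_unnorm k) (space (gue_unnorm k)) = (\<integral>\<^sup>+y. ennreal (gue_weight k y) \<partial>leb (sq k))"
      unfolding un by (subst emeasure_density) (auto intro!: nn_integral_cong)
    also have "\<dots> = ennreal (gue_mass k)"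
      using nn_integral_eq_integral[OF gue_weight_integral(1)] w0 by (simp add: gue_weight_integral(2))
    finally show ?thesis .
  qed
  define A where "A = {y \<in> space (leb (sq k)). posdef k (cshift \<xi> (hmat k y))}"
  have A [measurable]: "A \<in> sets (leb (sq k))" unfolding A_def by measurable
  have "{y \<in> space (gue k). lambda_max k (herm_of y) < \<xi>} = A"
    by (auto simp: A_def lambda_max_herm_of[OF k] gue_def un)
  hence "F_gue k \<xi> = measure (gue k) A" by (simp add: F_gue_def)
  also have "\<dots> = gue_part k \<xi> / gue_mass k"
  proof -
    have "emeasure (gue k) A = (\<integral>\<^sup>+y. ennreal (1 / gue_mass k) * indicator A y \<partial>gue_unnorm k)"
      unfolding gue_def mass using gue_mass_pos[of k] by (subst emeasure_density) (auto simp: un)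
    also have "\<dots> = (\<integral>\<^sup>+y. ennreal (gue_weight k y) * (ennreal (1 / gue_mass k) * indicator A y) \<partial>leb (sq k))"
      unfolding un by (rule nn_integral_density) measurable
    also have "\<dots> = (\<integral>\<^sup>+y. ennreal (1 / gue_mass k * (of_bool (posdef k (cshift \<xi> (hmat k y))) * gue_weight k y)) \<partial>leb (sq k))"
      using gue_mass_pos[of k] w0
      by (intro nn_integral_cong) (auto simp: A_def indicator_def mult.commute simp flip: ennreal_mult)
    also have "\<dots> = ennreal (\<integral>y. 1 / gue_mass k * (of_bool (posdef k (cshift \<xi> (hmat k y))) * gue_weight k y) \<partial>leb (sq k))"
      using gue_mass_pos[of k] w0
      by (intro nn_integral_eq_integral integrable_mult_right integrable_of_bool_posdef gue_weight_integral) auto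
    also have "\<dots> = ennreal (gue_part k \<xi> / gue_mass k)"
      by (simp add: gue_part_def)
    finally have e: "emeasure (gue k) A = ennreal (gue_part k \<xi> / gue_mass k)" .
    have "gue_part k \<xi> \<ge> 0"
      unfolding gue_part_def using w0 by (intro Bochner_Integration.integral_nonneg) simp
    thus ?thesis unfolding measure_def e using gue_mass_pos[of k] by simp
  qed
  finally show ?thesis .
qed

text \<open>Index \<open>j\<close> contributes \<open>pi\<close> to the power (j + 1) + j, and these
  odd exponents add up to k^2, the power in the Gaussian normalisation. What remains is a power of 2
  pi over the product of factorials.\<close>

lemma gauss_const_gue_mass: "gauss_const k * gue_mass k = (2 * pi) powr (real k / 2) / barnesG1 k"
proof -
  have "gauss_const k * gue_mass k * pi ^ (k * k) = wishart_const k * gue_mass k"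
    by (simp add: gauss_const_def)
  also have "\<dots> = (\<Prod>j<k. pi ^ Suc j / fact j * (pi ^ j * sqrt (2 * pi)))"
    by (simp only: wishart_const_def gue_mass_def prod.distrib)
  also have "\<dots> = (\<Prod>j<k. pi ^ (2 * j + 1) * (sqrt (2 * pi) / fact j))"
  proof (intro prod.cong refl)
    fix j
    have "pi ^ (2 * j + 1) = pi ^ Suc j * pi ^ j" by (simp only: power_add[symmetric]) (simp add: mult_2)
    thus "pi ^ Suc j / fact j * (pi ^ j * sqrt (2 * pi)) = pi ^ (2 * j + 1) * (sqrt (2 * pi) / fact j)"
      by (simp only: times_divide_eq_left times_divide_eq_right mult.assoc)
  qed
  also have "\<dots> = (\<Prod>j<k. pi ^ (2 * j + 1)) * sqrt (2 * pi) ^ k / barnesG1 k"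
    by (simp only: prod.distrib) (simp add: prod_dividef barnesG1_def)
  also have "(\<Prod>j<k. pi ^ (2 * j + 1)) = pi ^ (k * k)"
  proof (induction k)
    case (Suc k)
    have "k * k + (2 * k + 1) = Suc k * Suc k" by simp
    thus ?case using Suc.IH by (simp only: prod.lessThan_Suc power_add[symmetric])
  qed simp
  also have "sqrt (2 * pi) ^ k = (2 * pi) powr (real k / 2)"
  proof -
    have "(2 * pi) powr (real k / 2) = ((2 * pi) powr (1 / 2)) powr real k"
      by (simp add: powr_powr)
    also have "\<dots> = sqrt (2 * pi) ^ k"
      by (simp add: powr_half_sqrt powr_realpow)
    finally show ?thesis ..
  qed
  finally have "(gauss_const k * gue_mass k) * pi ^ (k * k) = ((2 * pi) powr (real k / 2) / barnesG1 k) * pi ^ (k * k)"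
    by (simp only: times_divide_eq_left times_divide_eq_right mult.commute)
  thus ?thesis by (subst (asm) mult_right_cancel) simp_all
qed

theorem theorem1p3:
  fixes L :: real and k :: nat
  assumes "L > 0" and "k \<ge> 1"
  shows "\<forall>\<epsilon>>0. \<exists>N0. \<forall>N\<ge>N0. \<forall>z::complex. cmod z \<le> 1 + L / sqrt (real N) \<longrightarrow>
     \<bar>ginibre_moment N k z
        - exp (real N * real k * ((cmod z)^2 - 1) + (real k)^2 / 2 * ln (real N))
          * (2 * pi) powr (real k / 2) / barnesG1 k
          * F_gue k (sqrt (real N) * (1 - (cmod z)^2))\<bar>
     \<le> \<epsilon> * (exp (real N * real k * ((cmod z)^2 - 1) + (real k)^2 / 2 * ln (real N))
          * (2 * pi) powr (real k / 2) / barnesG1 k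
          * F_gue k (sqrt (real N) * (1 - (cmod z)^2)))"
proof (intro allI impI, goal_cases)
  case (1 \<epsilon>)
  define F where "F N z = exp (real N * real k * ((cmod z)^2 - 1) + (real k)^2 / 2 * ln (real N))
          * (2 * pi) powr (real k / 2) / barnesG1 k
          * F_gue k (sqrt (real N) * (1 - (cmod z)^2))" for N :: nat and z :: complex
  have \<epsilon>: "\<epsilon> > 0" by (rule 1)
  \<comment> \<open>A lower bound for sqrt N (1 - |z|^2) on the whole disc: the exact value at the
    edge is - (2 L + L^2 / sqrt N), and sqrt N is at least 1.\<close>
  define \<xi>0 where "\<xi>0 = - (2 * L + L\<^sup>2)"
  have p0: "gue_part k \<xi>0 > 0"
    by (rule gue_part_pos) (use assms in \<open>simp add: \<xi>0_def add_nonneg_nonneg order.trans[of _ 0]\<close>)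
  \<comment> \<open>The error is measured against the smallest main term that can occur, which is
    fixed before \<open>N\<close> and \<open>z\<close> are chosen.\<close>
  have "\<forall>\<^sub>F n in sequentially. (\<integral>y. \<bar>phi k (Suc n) y - gue_weight k y\<bar> \<partial>leb (sq k)) < \<epsilon> * gue_part k \<xi>0"
    using \<epsilon> p0 by (intro order_tendstoD(2)[OF phi_L1_tendsto]) auto
  then obtain n0 where n0: "\<And>n. n \<ge> n0 \<Longrightarrow> (\<integral>y. \<bar>phi k (Suc n) y - gue_weight k y\<bar> \<partial>leb (sq k)) < \<epsilon> * gue_part k \<xi>0"
    by (auto simp: eventually_sequentially)
  have "\<exists>N0. \<forall>N\<ge>N0. \<forall>z::complex. cmod z \<le> 1 + L / sqrt (real N) \<longrightarrow>
     \<bar>ginibre_moment N k z - F N z\<bar> \<le> \<epsilon> * F N z"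
  \<comment> \<open>The successor undoes the shifted index of the L1 estimate and guarantees
    \<open>N \<ge> 1\<close>.\<close>
  proof (intro exI[of _ "Suc n0"] allI impI)
    fix N :: nat and z :: complex
    assume N: "N \<ge> Suc n0" and z: "cmod z \<le> 1 + L / sqrt (real N)"
    have N1: "N \<ge> 1" using N by simp
    define q where "q = sqrt (real N)"
    have q: "q \<ge> 1" "q * q = real N" using N1 by (auto simp: q_def)
    define \<xi> where "\<xi> = sqrt (real N) * (1 - (cmod z)\<^sup>2)"
    define c where "c = gauss_const k * sqrt (real N) ^ (k * k) * exp (real N * real k * ((cmod z)\<^sup>2 - 1))"
    have c: "c > 0" using N1 gauss_const_pos[of k] by (simp add: c_def)
    have "\<xi>0 \<le> \<xi>"
    proof -
      have "(cmod z)\<^sup>2 \<le> (1 + L / q)\<^sup>2"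
        using z by (intro power_mono) (auto simp: q_def)
      hence "q * (1 - (1 + L / q)\<^sup>2) \<le> \<xi>"
        unfolding \<xi>_def q_def[symmetric] using q by (intro mult_left_mono) auto
      moreover have "q * (1 - (1 + L / q)\<^sup>2) = - (2 * L + L\<^sup>2 / q)"
        using q(1) by (simp add: power2_eq_square field_simps)
      moreover have "L\<^sup>2 / q \<le> L\<^sup>2" using q(1) by (simp add: divide_le_eq mult_le_cancel_left1)
      ultimately show ?thesis by (simp add: \<xi>0_def)
    qed
    hence gp: "gue_part k \<xi>0 \<le> gue_part k \<xi>" by (rule gue_part_mono)
    let ?b = "\<lambda>y. of_bool (posdef k (cshift \<xi> (hmat k y))) :: real"
    note ip = integrable_of_bool_posdef[OF phi_integrable[OF N1], where \<xi> = \<xi>]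
    note ig = integrable_of_bool_posdef[OF gue_weight_integral(1), where \<xi> = \<xi>]
    have moment: "ginibre_moment N k z = c * (\<integral>y. ?b y * phi k N y \<partial>leb (sq k))"
    proof -
      have "(\<integral>\<^sup>+y. (if posdef k (cshift \<xi> (hmat k y)) then ennreal (phi k N y) else 0) \<partial>leb (sq k)) =
         (\<integral>\<^sup>+y. ennreal (?b y * phi k N y) \<partial>leb (sq k))"
        by (intro nn_integral_cong) auto
      also have "\<dots> = ennreal (\<integral>y. ?b y * phi k N y \<partial>leb (sq k))"
        using ip phi_nonneg by (intro nn_integral_eq_integral) auto
      finally have "ennreal (ginibre_moment N k z) = ennreal c * ennreal (\<integral>y. ?b y * phi k N y \<partial>leb (sq k))"
        using ginibre_moment_eq(1)[OF N1, of k z] by (simp only: c_def \<xi>_def)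
      also have "\<dots> = ennreal (c * (\<integral>y. ?b y * phi k N y \<partial>leb (sq k)))"
        using c by (simp add: ennreal_mult')
      finally show ?thesis
        using ginibre_moment_eq(2)[OF N1, of k z] c phi_nonneg
        by (subst (asm) ennreal_inj) (auto intro!: mult_nonneg_nonneg Bochner_Integration.integral_nonneg)
    qed
    have main: "F N z = c * gue_part k \<xi>"
    proof -
      have "exp ((real k)\<^sup>2 / 2 * ln (real N)) = sqrt (real N) ^ (k * k)"
      proof -
        have "(real k)\<^sup>2 / 2 * ln (real N) = real (k * k) * ln (sqrt (real N))"
          using N1 by (simp add: ln_sqrt power2_eq_square)
        thus ?thesis using N1 by (simp only: exp_of_nat_mult) simp
      qed
      hence "exp (real N * real k * ((cmod z)^2 - 1) + (real k)^2 / 2 * ln (real N)) =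
         exp (real N * real k * ((cmod z)^2 - 1)) * sqrt (real N) ^ (k * k)"
        by (simp add: exp_add)
      moreover have "(2 * pi) powr (real k / 2) / barnesG1 k * F_gue k \<xi> = gauss_const k * gue_part k \<xi>"
        unfolding gauss_const_gue_mass[symmetric] F_gue_eq[OF assms(2)] using gue_mass_pos[of k] by simp
      ultimately show ?thesis
        unfolding F_def c_def \<xi>_def[symmetric] by (simp only: times_divide_eq_right[symmetric] mult.assoc) (simp only: mult_ac)
    qed
    have "\<bar>c * (\<integral>y. ?b y * phi k N y \<partial>leb (sq k)) - c * gue_part k \<xi>\<bar> = c * \<bar>\<integral>y. ?b y * phi k N y - ?b y * gue_weight k y \<partial>leb (sq k)\<bar>"
      unfolding gue_part_def Bochner_Integration.integral_diff[OF ip ig]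
      using c by (simp only: right_diff_distrib[symmetric] abs_mult abs_of_pos)
    \<comment> \<open>Dropping the indicator of the domain leaves a bound that does not depend on
      \<open>z\<close>.\<close>
    also have "\<dots> \<le> c * (\<integral>y. \<bar>phi k N y - gue_weight k y\<bar> \<partial>leb (sq k))"
    proof (rule mult_left_mono)
      have "\<bar>\<integral>y. ?b y * phi k N y - ?b y * gue_weight k y \<partial>leb (sq k)\<bar> \<le> (\<integral>y. \<bar>?b y * phi k N y - ?b y * gue_weight k y\<bar> \<partial>leb (sq k))"
        by (rule integral_abs_bound)
      also have "\<dots> \<le> (\<integral>y. \<bar>phi k N y - gue_weight k y\<bar> \<partial>leb (sq k))"
        by (intro integral_mono integrable_abs Bochner_Integration.integrable_diff ip ig phi_integrable N1 gue_weight_integral) auto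
      finally show "\<bar>\<integral>y. ?b y * phi k N y - ?b y * gue_weight k y \<partial>leb (sq k)\<bar> \<le> (\<integral>y. \<bar>phi k N y - gue_weight k y\<bar> \<partial>leb (sq k))" .
    qed (use c in auto)
    also have "\<dots> \<le> c * (\<epsilon> * gue_part k \<xi>)"
    proof (rule mult_left_mono)
      have "(\<integral>y. \<bar>phi k N y - gue_weight k y\<bar> \<partial>leb (sq k)) < \<epsilon> * gue_part k \<xi>0"
        using n0[of "N - 1"] N by simp
      also have "\<dots> \<le> \<epsilon> * gue_part k \<xi>" using gp \<epsilon> by (intro mult_left_mono) auto
      finally show "(\<integral>y. \<bar>phi k N y - gue_weight k y\<bar> \<partial>leb (sq k)) \<le> \<epsilon> * gue_part k \<xi>" by simp
    qed (use c in auto)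
    also have "\<dots> = \<epsilon> * (c * gue_part k \<xi>)" by simp
    finally show "\<bar>ginibre_moment N k z - F N z\<bar> \<le> \<epsilon> * F N z"
      unfolding main moment .
  qed
  thus ?case unfolding F_def .
qed

end
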